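(* Let $\mathcal{H}$ be a separable complex Hilbert space. Let $\mathrm{CSO}$ be the set of all complex symmetric operators in $\mathcal{B}(\mathcal{H})$, let $\mathrm{RCSO}$ be the set of reducible operators in $\mathrm{CSO}$, and let $\mathrm{ICSO}$ be the set of irreducible operators in $\mathrm{CSO}$. Let $\overline{\mathcal{E}}$ denote the norm closure in $\mathcal{B}(\mathcal{H})$ of a subset $\mathcal{E}\subset\mathcal{B}(\mathcal{H})$. (a) If $\dim\mathcal{H}<\infty$, then $\overline{\mathrm{ICSO}}=\mathrm{CSO}$, and $\mathrm{RCSO}$ is a nowhere dense closed subset of $\mathrm{CSO}$ (with the norm topology). (b) If $\dim\mathcal{H}=\infty$, then $\overline{\mathrm{RCSO}}=\overline{\mathrm{ICSO}}=\overline{\mathrm{CSO}}$.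
   Context: $\mathcal{B}(\mathcal{H})$ is the algebra of bounded linear operators on $\mathcal{H}$. A conjugation on $\mathcal{H}$ is a conjugate-linear map $C:\mathcal{H}\to\mathcal{H}$ that is invertible with $C^{-1}=C$ and satisfies $\langle Cx,Cy\rangle=\langle y,x\rangle$ for all $x,y\in\mathcal{H}$. An operator $T\in\mathcal{B}(\mathcal{H})$ is complex symmetric if there is a conjugation $C$ on $\mathcal{H}$ with $CTC=T^*$. An operator is irreducible if it commutes with no nontrivial (orthogonal) projection, i.e. with no projection other than $0$ and $I$; otherwise it is reducible. *)

theory Defs
  imports "HOL-Analysis.Analysis"
begin

section \<open>Complex Hilbert spaces\<close>

class complex_vector = real_vector +
  fixes scaleC :: "complex \<Rightarrow> 'a \<Rightarrow> 'a"  (infixr \<open>*\<^sub>C\<close> 75)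
  assumes scaleC_add_right: "a *\<^sub>C (x + y) = a *\<^sub>C x + a *\<^sub>C y"
    and scaleC_add_left: "(a + b) *\<^sub>C x = a *\<^sub>C x + b *\<^sub>C x"
    and scaleC_scaleC: "a *\<^sub>C (b *\<^sub>C x) = (a * b) *\<^sub>C x"
    and scaleC_one: "1 *\<^sub>C x = x"
    and scaleR_eq_scaleC: "r *\<^sub>R x = complex_of_real r *\<^sub>C x"

interpretation complex_vector: vector_space "scaleC :: complex \<Rightarrow> 'a \<Rightarrow> 'a::complex_vector"
  by standard (simp_all add: scaleC_add_right scaleC_add_left scaleC_scaleC scaleC_one)

text \<open>
  The inner product \<open>cinner\<close> is linear in its first argument. The underlying real inner product
  is its real part, so that \<open>norm x = sqrt (Re (cinner x x))\<close>, and positive definiteness of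
  \<open>cinner\<close> is inherited from \<^class>\<open>real_inner\<close> (\<open>cinner x x\<close> is real by
  \<open>cinner_commute\<close>).
\<close>

class complex_inner = complex_vector + real_inner +
  fixes cinner :: "'a \<Rightarrow> 'a \<Rightarrow> complex"
  assumes cinner_commute: "cinner x y = cnj (cinner y x)"
    and cinner_add_left: "cinner (x + y) z = cinner x z + cinner y z"
    and cinner_scaleC_left: "cinner (c *\<^sub>C x) y = c * cinner x y"
    and inner_eq_Re_cinner: "inner x y = Re (cinner x y)"

class complex_hilbert_space = complex_inner + complete_space

definition finite_cdim :: "'a::complex_vector itself \<Rightarrow> bool" where
  "finite_cdim _ \<longleftrightarrow> (\<exists>B :: 'a set. finite B \<and> complex_vector.span B = UNIV)"


section \<open>Bounded operators and adjoints\<close>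

text \<open>
  The algebra of bounded complex-linear operators, as a closed real subalgebra of the
  bounded real-linear maps; the norm of \<^typ>\<open>'a \<Rightarrow>\<^sub>L 'a\<close> restricts to the operator norm.
\<close>

definition bounded_ops :: "('a::complex_inner \<Rightarrow>\<^sub>L 'a) set" where
  "bounded_ops = {T. \<forall>c x. blinfun_apply T (c *\<^sub>C x) = c *\<^sub>C blinfun_apply T x}"

definition adjoint_op :: "('a::complex_inner \<Rightarrow>\<^sub>L 'a) \<Rightarrow> ('a \<Rightarrow>\<^sub>L 'a)" where
  "adjoint_op T = (THE S. S \<in> bounded_ops \<and>
     (\<forall>x y. cinner (blinfun_apply T x) y = cinner x (blinfun_apply S y)))"

text \<open>The following lemmas show that the description above determines a unique operator.\<close>

lemma riesz_real:
  fixes f :: "'a::{real_inner, complete_space} \<Rightarrow> real"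
  assumes "bounded_linear f"
  shows "\<exists>v. \<forall>x. f x = inner v x"
proof -
  interpret f: bounded_linear f by fact
  define p where "p x = (norm x)\<^sup>2 - 2 * f x" for x
  obtain K where K: "\<And>x. norm (f x) \<le> norm x * K"
    using f.bounded by blast
  have low: "- K\<^sup>2 \<le> p x" for x
  proof -
    have "f x \<le> norm x * K" using K[of x] by simp
    moreover have "0 \<le> (norm x - K)\<^sup>2" by simp
    ultimately show ?thesis by (simp add: p_def power2_diff)
  qed
  define m where "m = (INF x. p x)"
  have bdd: "bdd_below (range p)" using low by (intro bdd_belowI[of _ "- K\<^sup>2"]) auto
  have m_le: "m \<le> p x" for x
    unfolding m_def by (rule cINF_lower[OF bdd]) simp
  have "\<exists>x. p x < m + inverse (real (Suc n))" for n
  proof -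
    have "m < m + inverse (real (Suc n))" by simp
    then show ?thesis
      using cInf_lessD[of "range p"] by (auto simp: m_def)
  qed
  then obtain X where X: "\<And>n. p (X n) < m + inverse (real (Suc n))" by metis
  have par: "(norm (x - y))\<^sup>2 \<le> 2 * p x + 2 * p y - 4 * m" for x y
  proof -
    define z where "z = (1/2) *\<^sub>R (x + y)"
    have "p z = (norm (x + y))\<^sup>2 / 4 - f x - f y"
      by (simp add: p_def z_def f.scaleR f.add power_divide add_divide_distrib del: scaleR_add_right)
    moreover have "(norm (x - y))\<^sup>2 + (norm (x + y))\<^sup>2 = 2 * (norm x)\<^sup>2 + 2 * (norm y)\<^sup>2"
      by (simp add: power2_norm_eq_inner algebra_simps)
    ultimately show ?thesis
      using m_le[of z] p_def[of x] p_def[of y] by argo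
  qed
  have "Cauchy X"
  proof (rule metric_CauchyI)
    fix e :: real assume "0 < e"
    then obtain N where N: "inverse (real (Suc N)) < e\<^sup>2 / 4"
      using reals_Archimedean[of "e\<^sup>2 / 4"] by auto
    have "dist (X a) (X b) < e" if "a \<ge> N" "b \<ge> N" for a b
    proof -
      have "inverse (real (Suc a)) \<le> inverse (real (Suc N))"
        "inverse (real (Suc b)) \<le> inverse (real (Suc N))"
        using that by (auto intro!: le_imp_inverse_le)
      then have "(norm (X a - X b))\<^sup>2 < e\<^sup>2"
        using par[of "X a" "X b"] X[of a] X[of b] N by linarith
      then show ?thesis
        using \<open>0 < e\<close> by (simp add: dist_norm power_less_imp_less_base)
    qed
    then show "\<exists>M. \<forall>a\<ge>M. \<forall>b\<ge>M. dist (X a) (X b) < e" by blast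
  qed
  then obtain v where v: "X \<longlonglongrightarrow> v"
    using Cauchy_convergent_iff convergent_def by blast
  have "(\<lambda>n. p (X n)) \<longlonglongrightarrow> p v"
    unfolding p_def by (intro tendsto_intros f.tendsto v)
  moreover have "(\<lambda>n. m + inverse (real (Suc n))) \<longlonglongrightarrow> m + 0"
    by (intro tendsto_intros LIMSEQ_inverse_real_of_nat)
  ultimately have pv: "p v \<le> m"
    using X by (intro LIMSEQ_le[of "\<lambda>n. p (X n)" "p v" "\<lambda>n. m + inverse (real (Suc n))" m])
      (auto intro: less_imp_le)
  have "f h = inner v h" for h
  proof -
    define a where "a = inner v h - f h"
    define N where "N = (norm h)\<^sup>2"
    have N0: "0 \<le> N" by (simp add: N_def)
    define t where "t = - a / (N + 1)"
    have "(norm (v + t *\<^sub>R h))\<^sup>2 = (norm v)\<^sup>2 + 2 * t * inner v h + t\<^sup>2 * (norm h)\<^sup>2"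
      unfolding power2_norm_eq_inner
      by (simp add: inner_add_left inner_add_right inner_commute[of h v] power2_eq_square distrib_left)
    then have "p (v + t *\<^sub>R h) = p v + t\<^sup>2 * N + 2 * t * a"
      by (simp add: p_def a_def N_def f.add f.scaleR algebra_simps)
    then have "0 \<le> t\<^sup>2 * N + 2 * t * a"
      using pv m_le[of "v + t *\<^sub>R h"] by linarith
    also have "t\<^sup>2 * N + 2 * t * a = - (a\<^sup>2 * (N + 2)) / (N + 1)\<^sup>2"
    proof -
      have "N + 1 \<noteq> 0" using N0 by simp
      then show ?thesis
        by (simp add: t_def power_divide divide_simps) (simp add: power2_eq_square algebra_simps)
    qed
    finally have "a\<^sup>2 * (N + 2) \<le> 0"
      using N0 by (simp add: divide_le_0_iff zero_le_divide_iff)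
    then have "a = 0"
      using N0 by (simp add: mult_le_0_iff)
    then show ?thesis by (simp add: a_def)
  qed
  then show ?thesis by blast
qed

lemma cinner_eqI:
  fixes x y :: "'a::complex_inner"
  assumes "\<And>z. cinner z x = cinner z y"
  shows "x = y"
proof -
  have "inner z (x - y) = 0" for z
    by (metis assms inner_diff_right inner_eq_Re_cinner diff_self)
  then show ?thesis
    by (metis inner_eq_zero_iff right_minus_eq)
qed

lemma cinner_scaleC_right: "cinner x (c *\<^sub>C y) = cnj c * cinner x y"
  by (metis cinner_commute cinner_scaleC_left complex_cnj_cnj complex_cnj_mult)

lemma adjoint_op_exists:
  fixes T :: "'a::complex_hilbert_space \<Rightarrow>\<^sub>L 'a"
  assumes T: "T \<in> bounded_ops"
  shows "\<exists>!S. S \<in> bounded_ops \<and>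
     (\<forall>x y. cinner (blinfun_apply T x) y = cinner x (blinfun_apply S y))"
proof (rule ex_ex1I)
  have "\<exists>v. \<forall>x. inner (blinfun_apply T x) y = inner v x" for y
    by (rule riesz_real) (intro bounded_linear_intros)
  then obtain s where s: "\<And>y x. inner (blinfun_apply T x) y = inner (s y) x" by metis
  have cs: "cinner (blinfun_apply T x) y = cinner x (s y)" for x y
  proof (rule complex_eqI)
    have Re_eq: "Re (cinner (blinfun_apply T x) y) = Re (cinner x (s y))" for x
      using s[of x y] by (simp add: inner_commute[of "s y"] flip: inner_eq_Re_cinner)
    from Re_eq[of x] show "Re (cinner (blinfun_apply T x) y) = Re (cinner x (s y))" .
    have "blinfun_apply T (\<i> *\<^sub>C x) = \<i> *\<^sub>C blinfun_apply T x"
      using T by (simp add: bounded_ops_def)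
    with Re_eq[of "\<i> *\<^sub>C x"]
    show "Im (cinner (blinfun_apply T x) y) = Im (cinner x (s y))"
      by (simp add: cinner_scaleC_left)
  qed
  have add: "s (y + z) = s y + s z" for y z
  proof -
    have "inner (s (y + z) - (s y + s z)) x = 0" for x
      by (simp add: inner_diff_left inner_add_left inner_add_right flip: s)
    then show ?thesis by (metis inner_eq_zero_iff right_minus_eq)
  qed
  have scaleC: "s (c *\<^sub>C y) = c *\<^sub>C s y" for c y
    by (rule cinner_eqI) (simp add: cinner_scaleC_right flip: cs)
  have bound: "norm (s y) \<le> norm y * norm T" for y
  proof -
    have "(norm (s y))\<^sup>2 = inner (blinfun_apply T (s y)) y"
      by (simp add: power2_norm_eq_inner s)
    also have "\<dots> \<le> norm (blinfun_apply T (s y)) * norm y"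
      by (rule norm_cauchy_schwarz)
    also have "\<dots> \<le> (norm T * norm (s y)) * norm y"
      by (intro mult_right_mono norm_blinfun) simp
    finally have "norm (s y) * norm (s y) \<le> norm (s y) * (norm y * norm T)"
      by (simp add: power2_eq_square mult_ac)
    then show ?thesis
      by (cases "norm (s y) = 0") (auto simp: mult_le_cancel_left)
  qed
  have "bounded_linear s"
    by (rule bounded_linear_intro[OF add _ bound]) (simp add: scaleR_eq_scaleC scaleC)
  then have "blinfun_apply (Blinfun s) = s"
    by (rule bounded_linear_Blinfun_apply)
  then show "\<exists>S. S \<in> bounded_ops \<and>
     (\<forall>x y. cinner (blinfun_apply T x) y = cinner x (blinfun_apply S y))"
    by (intro exI[of _ "Blinfun s"]) (simp add: bounded_ops_def scaleC cs)
next
  fix S S' :: "'a \<Rightarrow>\<^sub>L 'a"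
  assume S: "S \<in> bounded_ops \<and>
     (\<forall>x y. cinner (blinfun_apply T x) y = cinner x (blinfun_apply S y))"
    and S': "S' \<in> bounded_ops \<and>
     (\<forall>x y. cinner (blinfun_apply T x) y = cinner x (blinfun_apply S' y))"
  show "S = S'"
    by (rule blinfun_eqI, rule cinner_eqI) (metis S S')
qed

lemma
  fixes T :: "'a::complex_hilbert_space \<Rightarrow>\<^sub>L 'a"
  assumes "T \<in> bounded_ops"
  shows adjoint_op_in_bounded_ops: "adjoint_op T \<in> bounded_ops"
    and cinner_adjoint_op:
      "cinner (blinfun_apply T x) y = cinner x (blinfun_apply (adjoint_op T) y)"
  using theI'[OF adjoint_op_exists[OF assms]] unfolding adjoint_op_def by blast+


section \<open>Complex symmetric and irreducible operators\<close>

definition conjugation :: "('a::complex_inner \<Rightarrow> 'a) \<Rightarrow> bool" where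
  "conjugation C \<longleftrightarrow>
     (\<forall>x y. C (x + y) = C x + C y) \<and>
     (\<forall>c x. C (c *\<^sub>C x) = cnj c *\<^sub>C C x) \<and>
     C \<circ> C = id \<and>
     (\<forall>x y. cinner (C x) (C y) = cinner y x)"

definition complex_symmetric :: "('a::complex_hilbert_space \<Rightarrow>\<^sub>L 'a) \<Rightarrow> bool" where
  "complex_symmetric T \<longleftrightarrow>
     (\<exists>C. conjugation C \<and> C \<circ> blinfun_apply T \<circ> C = blinfun_apply (adjoint_op T))"

definition orthogonal_projection :: "('a::complex_hilbert_space \<Rightarrow>\<^sub>L 'a) \<Rightarrow> bool" where
  "orthogonal_projection P \<longleftrightarrow> P \<in> bounded_ops \<and> P o\<^sub>L P = P \<and> adjoint_op P = P"

definition irreducible_op :: "('a::complex_hilbert_space \<Rightarrow>\<^sub>L 'a) \<Rightarrow> bool" where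
  "irreducible_op T \<longleftrightarrow>
     (\<forall>P. orthogonal_projection P \<and> P o\<^sub>L T = T o\<^sub>L P \<longrightarrow> P = 0 \<or> P = id_blinfun)"

definition CSO :: "('a::complex_hilbert_space \<Rightarrow>\<^sub>L 'a) set" where
  "CSO = {T \<in> bounded_ops. complex_symmetric T}"

definition RCSO :: "('a::complex_hilbert_space \<Rightarrow>\<^sub>L 'a) set" where
  "RCSO = {T \<in> CSO. \<not> irreducible_op T}"

definition ICSO :: "('a::complex_hilbert_space \<Rightarrow>\<^sub>L 'a) set" where
  "ICSO = {T \<in> CSO. irreducible_op T}"

definition norm_closure :: "('a::complex_hilbert_space \<Rightarrow>\<^sub>L 'a) set \<Rightarrow> ('a \<Rightarrow>\<^sub>L 'a) set" where
  "norm_closure E = top_of_set bounded_ops closure_of E"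

definition nowhere_dense_in :: "'b topology \<Rightarrow> 'b set \<Rightarrow> bool" where
  "nowhere_dense_in X S \<longleftrightarrow> S \<subseteq> topspace X \<and> X interior_of (X closure_of S) = {}"

end

(*
  Let C be a conjugation with C T C = T*. Then T = A + iB, where the self-adjoint operators A and B
  commute with C, that is, they restrict to symmetric operators on the real Hilbert space of
  C-fixed vectors. A projection commutes with T iff it commutes with A and B.

  Irreducible operators are dense: a polar decomposition, iterated on |A| - M/2, approximates A in
  norm by an operator that is diagonal in a basis (e_n) of C-fixed vectors. Make its eigenvalues
  distinct by a small diagonal perturbation, and all entries <B e_0, e_n> nonzero by a small
  perturbation of rank two. A commuting projection is then diagonal with constant diagonal.

  In finite dimension conjugations and projections have convergent subsequences, and the limit of
  nontrivial projections is nontrivial because the trace passes to the limit.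

  Reducible operators are dense in infinite dimension: this is the argument of Voiculescu's theorem
  for the real pair (A, B). Take a weakly null orthonormal sequence x_j of C-fixed vectors along which
  all inner products <w x_j, w' x_j> of words w, w' in A and B converge. The limits define a
  representation of (A, B) in which A and B are block tridiagonal for the filtration by word length.
  Far out in the sequence H contains arbitrarily exact, mutually orthogonal copies of the
  finite corners of that representation. Passing slowly from copy to copy as the word length grows
  gives an orthonormal sequence whose span is almost invariant under A and B, so the projection P
  onto it almost commutes with T and T is close to P T P + (1 - P) T (1 - P).
*)

theory Submission
  imports Defs "HOL-Library.Diagonal_Subsequence" "HOL-Library.Discrete_Functions"
begin

text \<open>Cutting the limit representation off at some word length would not do: A and B map words
  of length m to words of length m + 1, so the span of a finite corner has a boundary error of full
  size. Nor can one copy be followed forever, since a vector far out in the sequence reproduces only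
  a finite corner. Turning from each copy into the next, orthogonal one settles both: only
  neighbouring word lengths interact, so the error is governed by the angle turned per level, and no
  boundary term arises. A unit vector kept orthogonal to all copies makes the projection differ from
  the identity.

  For the irreducible operators no spectral measure is used. Subtracting M/2 from |A| halves the
  norm bound, so n rounds leave an error M/2^n and an operator whose eigenvectors span the space
  algebraically. All operators are treated as bounded real-linear maps; multiplication by i and C
  are then two more operators commuting with A, and commutation with them makes the approximant
  complex linear and real for C.\<close>

instance complex_hilbert_space \<subseteq> banach ..

section \<open>Symmetric operators on real Hilbert spaces\<close>

lemma inner_eq_0_of_minimal:
  fixes y h :: "'a::real_inner"
  assumes "\<And>t. (norm y)\<^sup>2 \<le> (norm (y - t *\<^sub>R h))\<^sup>2"
  shows "inner y h = 0"
proof (cases "h = 0")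
  case False
  define N where "N = (norm h)\<^sup>2"
  have N: "N > 0" using False by (simp add: N_def)
  define t where "t = inner y h / N"
  have "(norm (y - t *\<^sub>R h))\<^sup>2 = (norm y)\<^sup>2 - 2 * t * inner y h + t\<^sup>2 * N"
    unfolding power2_norm_eq_inner N_def
    by (simp add: inner_diff_left inner_diff_right inner_commute[of h y] power2_eq_square algebra_simps)
  also have "\<dots> = (norm y)\<^sup>2 - (inner y h)\<^sup>2 / N"
    using N by (simp add: t_def power2_eq_square field_simps)
  finally have "(inner y h)\<^sup>2 / N \<le> 0" using assms[of t] by linarith
  then have "(inner y h)\<^sup>2 \<le> 0" using N by (simp add: divide_le_0_iff)
  then show ?thesis by simp
qed simp

text \<open>By the parallelogram law a minimising sequence for the distance to W is Cauchy; its
  limit is the foot of the perpendicular. The scheme is that of \<open>riesz_real\<close>.\<close>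

lemma orthogonal_component_exists:
  fixes W :: "'a::{real_inner,banach} set"
  assumes W: "subspace W" "closed W"
  shows "\<exists>p\<in>W. \<forall>w\<in>W. inner (x - p) w = 0"
proof -
  define p where "p w = (norm (x - w))\<^sup>2" for w
  define m where "m = (INF w\<in>W. p w)"
  have ne: "W \<noteq> {}" using W(1) subspace_0 by blast
  have bdd: "bdd_below (p ` W)" by (intro bdd_belowI[of _ 0]) (auto simp: p_def)
  have m_le: "m \<le> p w" if "w \<in> W" for w
    unfolding m_def by (rule cINF_lower[OF bdd that])
  have "\<exists>w\<in>W. p w < m + inverse (real (Suc n))" for n
  proof -
    have "m < m + inverse (real (Suc n))" by simp
    then show ?thesis
      using cInf_lessD[of "p ` W"] ne by (auto simp: m_def)
  qed
  then obtain X where XW: "\<And>n. X n \<in> W" and X: "\<And>n. p (X n) < m + inverse (real (Suc n))" by metis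
  have par: "(norm (u - v))\<^sup>2 \<le> 2 * p u + 2 * p v - 4 * m" if "u \<in> W" "v \<in> W" for u v
  proof -
    define z where "z = (1/2) *\<^sub>R (u + v)"
    have "z \<in> W" unfolding z_def using that W(1) by (intro subspace_scale subspace_add)
    moreover have "(norm (u - v))\<^sup>2 + 4 * p z = 2 * p u + 2 * p v"
      by (simp add: p_def z_def power2_norm_eq_inner algebra_simps inner_commute)
    ultimately show ?thesis using m_le[of z] by linarith
  qed
  have "Cauchy X"
  proof (rule metric_CauchyI)
    fix e :: real assume "0 < e"
    then obtain N where N: "inverse (real (Suc N)) < e\<^sup>2 / 4"
      using reals_Archimedean[of "e\<^sup>2 / 4"] by auto
    have "dist (X a) (X b) < e" if "a \<ge> N" "b \<ge> N" for a b
    proof -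
      have "inverse (real (Suc a)) \<le> inverse (real (Suc N))"
        "inverse (real (Suc b)) \<le> inverse (real (Suc N))"
        using that by (auto intro!: le_imp_inverse_le)
      then have "(norm (X a - X b))\<^sup>2 < e\<^sup>2"
        using par[OF XW[of a] XW[of b]] X[of a] X[of b] N by linarith
      then show ?thesis
        using \<open>0 < e\<close> by (simp add: dist_norm power_less_imp_less_base)
    qed
    then show "\<exists>M. \<forall>a\<ge>M. \<forall>b\<ge>M. dist (X a) (X b) < e" by blast
  qed
  then obtain v where v: "X \<longlonglongrightarrow> v"
    using Cauchy_convergent_iff convergent_def by blast
  have vW: "v \<in> W" using W(2) XW v closed_sequentially by blast
  have "(\<lambda>n. p (X n)) \<longlonglongrightarrow> p v"
    unfolding p_def by (intro tendsto_intros v)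
  moreover have "(\<lambda>n. m + inverse (real (Suc n))) \<longlonglongrightarrow> m + 0"
    by (intro tendsto_intros LIMSEQ_inverse_real_of_nat)
  ultimately have pv: "p v \<le> m"
    using X by (intro LIMSEQ_le[of "\<lambda>n. p (X n)" "p v" "\<lambda>n. m + inverse (real (Suc n))" m])
      (auto intro: less_imp_le)
  have "inner (x - v) w = 0" if "w \<in> W" for w
  proof (rule inner_eq_0_of_minimal)
    fix t
    have "v + t *\<^sub>R w \<in> W" using vW that W(1) by (intro subspace_add subspace_scale)
    from m_le[OF this] show "(norm (x - v))\<^sup>2 \<le> (norm (x - v - t *\<^sub>R w))\<^sup>2"
      using pv unfolding p_def diff_diff_eq by linarith
  qed
  with vW show ?thesis by blast
qed

definition symmetric_op :: "('a::real_inner \<Rightarrow>\<^sub>L 'a) \<Rightarrow> bool" where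
  "symmetric_op A \<longleftrightarrow> (\<forall>x y. inner (A x) y = inner x (A y))"

definition is_projection_onto :: "('a::real_inner \<Rightarrow>\<^sub>L 'a) \<Rightarrow> 'a set \<Rightarrow> bool" where
  "is_projection_onto P W \<longleftrightarrow> (\<forall>x. P x \<in> W) \<and> (\<forall>x\<in>W. P x = x) \<and> (\<forall>x. \<forall>w\<in>W. inner (x - P x) w = 0)"

lemma projection_exists:
  fixes W :: "'a::{real_inner,banach} set"
  assumes W: "subspace W" "closed W"
  shows "\<exists>P. is_projection_onto P W"
proof -
  obtain p where pW: "\<And>x. p x \<in> W" and po: "\<And>x w. w \<in> W \<Longrightarrow> inner (x - p x) w = 0"
    using orthogonal_component_exists[OF W] by metis
  \<comment> \<open>Uniqueness of the foot yields linearity of p: sums and multiples of feet have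
    the defining property.\<close>
  have uniq: "p x = q" if "q \<in> W" "\<And>w. w \<in> W \<Longrightarrow> inner (x - q) w = 0" for x q
  proof -
    have d: "p x - q \<in> W" using pW that W(1) subspace_diff by blast
    have "inner (p x - q) (p x - q) = inner (x - q) (p x - q) - inner (x - p x) (p x - q)"
      by (simp add: inner_diff_left)
    also have "\<dots> = 0" using that(2)[OF d] po[OF d] by simp
    finally show ?thesis by simp
  qed
  have "bounded_linear p"
  proof (rule bounded_linear_intro[where K=1])
    show "p (x + y) = p x + p y" for x y
    proof (rule uniq)
      show "p x + p y \<in> W" by (intro subspace_add W pW)
      fix w assume w: "w \<in> W"
      have "inner (x + y - (p x + p y)) w = inner (x - p x) w + inner (y - p y) w"
        by (simp add: inner_diff_left inner_add_left)
      then show "inner (x + y - (p x + p y)) w = 0" using po[OF w] by simp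
    qed
    show "p (r *\<^sub>R x) = r *\<^sub>R p x" for r x
    proof (rule uniq)
      show "r *\<^sub>R p x \<in> W" by (intro subspace_scale W pW)
      fix w assume w: "w \<in> W"
      have "inner (r *\<^sub>R x - r *\<^sub>R p x) w = r * inner (x - p x) w"
        by (simp add: inner_diff_left right_diff_distrib)
      then show "inner (r *\<^sub>R x - r *\<^sub>R p x) w = 0" using po[OF w] by simp
    qed
    show "norm (p x) \<le> norm x * 1" for x
    proof -
      have "(norm (p x))\<^sup>2 = inner x (p x)"
        using po[OF pW[of x], of x] by (simp add: inner_diff_left power2_norm_eq_inner)
      also have "\<dots> \<le> norm x * norm (p x)" by (rule norm_cauchy_schwarz)
      finally show ?thesis
        by (cases "norm (p x) = 0") (auto simp: power2_eq_square)
    qed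
  qed
  then have "Blinfun p x = p x" for x by (simp add: bounded_linear_Blinfun_apply)
  moreover have "p x = x" if "x \<in> W" for x using uniq[OF that] by simp
  ultimately show ?thesis using pW po by (intro exI[of _ "Blinfun p"]) (auto simp: is_projection_onto_def)
qed

lemma symmetric_projection:
  assumes "is_projection_onto P W"
  shows "symmetric_op P"
  unfolding symmetric_op_def
proof (intro allI)
  fix x y
  have "inner (x - P x) (P y) = 0" "inner (y - P y) (P x) = 0"
    using assms by (auto simp: is_projection_onto_def)
  then show "inner (P x) y = inner x (P y)"
    by (simp add: inner_diff_left inner_diff_right inner_commute)
qed

lemma idem_projection: "is_projection_onto P W \<Longrightarrow> P (P x) = P x"
  by (auto simp: is_projection_onto_def)

text \<open>A subspace invariant under S and its adjoint reduces S. The adjoint S' enters as a plain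
  function, so that C or a multiple of S can be supplied for it.\<close>

lemma projection_comm:
  assumes P: "is_projection_onto P W"
    and S: "\<And>w. w \<in> W \<Longrightarrow> blinfun_apply S w \<in> W"
    and S': "\<And>w. w \<in> W \<Longrightarrow> S' w \<in> W"
    and adj: "\<And>x y. inner (blinfun_apply S x) y = inner x (S' y)"
  shows "P (S x) = S (P x)"
proof -
  have PW: "P x \<in> W" "P (S x) \<in> W" "\<And>w. w \<in> W \<Longrightarrow> P w = w" for x
    using P by (auto simp: is_projection_onto_def)
  have sp: "inner (P x) y = inner x (P y)" for x y
    using symmetric_projection[OF P] by (simp add: symmetric_op_def)
  have "inner (P (S x)) y = inner (S (P x)) y" for y
  proof -
    have "inner (P (S x)) y = inner x (S' (P y))" by (simp add: sp adj)
    also have "\<dots> = inner (P x) (S' (P y))" using PW S' by (simp add: sp)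
    also have "\<dots> = inner (P (S (P x))) y" by (simp add: sp adj)
    also have "\<dots> = inner (S (P x)) y" using PW S by simp
    finally show ?thesis .
  qed
  then show ?thesis by (metis inner_commute vector_eq_ldot)
qed

lemma symmetric_norm_le:
  assumes A: "symmetric_op A" and c: "c \<ge> 0" and q: "\<And>x. \<bar>inner (blinfun_apply A x) x\<bar> \<le> c * (norm x)\<^sup>2"
  shows "norm A \<le> c"
proof (rule norm_blinfun_bound[OF c])
  fix x
  have s: "inner (A u) v = inner u (A v)" for u v using A by (simp add: symmetric_op_def)
  have b: "4 * inner (A u) v \<le> 2 * c * ((norm u)\<^sup>2 + (norm v)\<^sup>2)" for u v
  proof -
    have "4 * inner (A u) v = inner (A (u + v)) (u + v) - inner (A (u - v)) (u - v)"
      using s[of v u]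
      by (simp add: blinfun.bilinear_simps inner_add_left inner_add_right inner_diff_left inner_diff_right inner_commute)
    also have "\<dots> \<le> c * (norm (u + v))\<^sup>2 + c * (norm (u - v))\<^sup>2"
      using q[of "u + v"] q[of "u - v"] by linarith
    also have "\<dots> = 2 * c * ((norm u)\<^sup>2 + (norm v)\<^sup>2)"
      unfolding power2_norm_eq_inner by (simp add: algebra_simps)
    finally show ?thesis .
  qed
  show "norm (A x) \<le> c * norm x"
  proof (cases "A x = 0 \<or> x = 0")
    case True
    then show ?thesis using c by auto
  next
    case False
    \<comment> \<open>The factor r gives \<open>r *\<^sub>R A x\<close> the norm of x, which
      balances the two squares in b.\<close>
    define r where "r = norm x / norm (A x)"
    have r: "r > 0" using False by (simp add: r_def)
    have "4 * inner (A x) (r *\<^sub>R A x) \<le> 2 * c * ((norm x)\<^sup>2 + (norm (r *\<^sub>R A x))\<^sup>2)" by (rule b)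
    moreover have "inner (A x) (r *\<^sub>R A x) = norm x * norm (A x)"
      using False by (simp add: r_def flip: power2_norm_eq_inner) (simp add: power2_eq_square)
    moreover have "norm (r *\<^sub>R A x) = norm x" using False r by (simp add: r_def)
    ultimately have "norm x * norm (A x) \<le> norm x * (c * norm x)" by (simp only:) (simp add: power2_eq_square mult_ac)
    then show ?thesis using False by simp
  qed
qed

lemma symmetric_opD: "symmetric_op A \<Longrightarrow> inner (blinfun_apply A x) y = inner x (blinfun_apply A y)"
  by (simp add: symmetric_op_def)

lemma symmetric_op_arith:
  assumes "symmetric_op A" "symmetric_op B"
  shows "symmetric_op (A + B)" "symmetric_op (A - B)"
  using assms by (auto simp: symmetric_op_def blinfun.bilinear_simps inner_add_left inner_add_right
     inner_diff_left inner_diff_right)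

lemma symmetric_op_scaleR: "symmetric_op A \<Longrightarrow> symmetric_op (c *\<^sub>R A)"
  by (simp add: symmetric_op_def blinfun.scaleR_left)

lemma symmetric_op_id: "symmetric_op id_blinfun"
  by (simp add: symmetric_op_def)

lemma symmetric_op_compose:
  assumes "symmetric_op A" "symmetric_op B" "A o\<^sub>L B = B o\<^sub>L A"
  shows "symmetric_op (A o\<^sub>L B)"
proof -
  have "A (B x) = B (A x)" for x using assms(3) by (metis blinfun_apply_blinfun_compose)
  then show ?thesis using assms(1,2) by (simp add: symmetric_op_def)
qed

lemma symmetric_op_lim:
  assumes "X \<longlonglongrightarrow> A" "\<And>n. symmetric_op (X n)"
  shows "symmetric_op A"
  unfolding symmetric_op_def
proof (intro allI)
  fix x y
  have "(\<lambda>n. inner (X n x) y) \<longlonglongrightarrow> inner (A x) y" "(\<lambda>n. inner x (X n y)) \<longlonglongrightarrow> inner x (A y)"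
    by (intro tendsto_intros assms(1))+
  then show "inner (A x) y = inner x (A y)"
    using assms(2) LIMSEQ_unique by (simp add: symmetric_op_def) blast
qed

abbreviation (input) compose_op (infixl \<open>\<circ>\<^sub>L\<close> 70) where
  "S \<circ>\<^sub>L T \<equiv> S o\<^sub>L T"

lemma compose_arith:
  "(A + B) \<circ>\<^sub>L C = A \<circ>\<^sub>L C + B \<circ>\<^sub>L C" "C \<circ>\<^sub>L (A + B) = C \<circ>\<^sub>L A + C \<circ>\<^sub>L B"
  "(A - B) \<circ>\<^sub>L C = A \<circ>\<^sub>L C - B \<circ>\<^sub>L C" "C \<circ>\<^sub>L (A - B) = C \<circ>\<^sub>L A - C \<circ>\<^sub>L B"
  "(r *\<^sub>R A) \<circ>\<^sub>L C = r *\<^sub>R (A \<circ>\<^sub>L C)" "C \<circ>\<^sub>L (r *\<^sub>R A) = r *\<^sub>R (C \<circ>\<^sub>L A)"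
  by (rule blinfun_eqI, simp add: blinfun.bilinear_simps)+

lemma compose_id: "id_blinfun \<circ>\<^sub>L A = A" "A \<circ>\<^sub>L id_blinfun = A"
  by (rule blinfun_eqI, simp)+

lemma tendsto_compose_blinfun:
  assumes "(X \<longlongrightarrow> A) F" "(Y \<longlongrightarrow> B) F"
  shows "((\<lambda>n. X n \<circ>\<^sub>L Y n) \<longlongrightarrow> A \<circ>\<^sub>L B) F"
  by (rule bounded_bilinear.tendsto[OF bounded_bilinear_blinfun_compose assms])

lemma compose_assoc: "(A \<circ>\<^sub>L B) \<circ>\<^sub>L C = A \<circ>\<^sub>L (B \<circ>\<^sub>L C)"
  by (rule blinfun_eqI) simp

lemma commuting_square_diff:
  fixes A B :: "'a::real_normed_vector \<Rightarrow>\<^sub>L 'a"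
  assumes "A \<circ>\<^sub>L B = B \<circ>\<^sub>L A"
  shows "A \<circ>\<^sub>L A - B \<circ>\<^sub>L B = (A - B) \<circ>\<^sub>L (A + B)"
  using assms by (simp add: compose_arith)

section \<open>Absolute values and polar decomposition\<close>

text \<open>The iteration \<open>X \<mapsto> (Y + X\<^sup>2) / 2\<close> converges to \<open>1 - sqrt (1 - Y)\<close>; its scalar version
  at \<open>Y = 1\<close> dominates the increments.\<close>

primrec scalar_iter :: "nat \<Rightarrow> real" where
  "scalar_iter 0 = 0"
| "scalar_iter (Suc n) = (1 + (scalar_iter n)\<^sup>2) / 2"

primrec op_iter :: "('a::real_normed_vector \<Rightarrow>\<^sub>L 'a) \<Rightarrow> nat \<Rightarrow> 'a \<Rightarrow>\<^sub>L 'a" where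
  "op_iter Y 0 = 0"
| "op_iter Y (Suc n) = (1/2) *\<^sub>R (Y + op_iter Y n \<circ>\<^sub>L op_iter Y n)"

lemma scalar_iter_bounds: "0 \<le> scalar_iter n \<and> scalar_iter n \<le> 1"
  by (induction n) (auto intro: power_le_one)

lemma scalar_iter_mono: "scalar_iter n \<le> scalar_iter (Suc n)"
proof -
  have "0 \<le> (1 - scalar_iter n)\<^sup>2" by simp
  then show ?thesis by (simp add: power2_diff)
qed

text \<open>Each iterate is a polynomial in Y. S is arbitrary, since it will be C or multiplication
  by i as well as another iterate.\<close>

lemma op_iter_comm_gen:
  assumes "S \<circ>\<^sub>L Y = Y \<circ>\<^sub>L S"
  shows "S \<circ>\<^sub>L op_iter Y n = op_iter Y n \<circ>\<^sub>L S"
proof (induction n)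
  case 0
  show ?case by (rule blinfun_eqI) simp
next
  case (Suc n)
  have "S \<circ>\<^sub>L (op_iter Y n \<circ>\<^sub>L op_iter Y n) = (op_iter Y n \<circ>\<^sub>L op_iter Y n) \<circ>\<^sub>L S"
    by (metis Suc compose_assoc)
  then show ?case using assms by (simp add: compose_arith)
qed

lemma op_iter_norm: "norm Y \<le> 1 \<Longrightarrow> norm (op_iter Y n) \<le> scalar_iter n"
proof (induction n)
  case (Suc n)
  have "norm (op_iter Y n \<circ>\<^sub>L op_iter Y n) \<le> norm (op_iter Y n) * norm (op_iter Y n)"
    by (rule norm_blinfun_compose)
  also have "\<dots> \<le> (scalar_iter n)\<^sup>2"
    unfolding power2_eq_square using Suc by (intro mult_mono) (auto simp: scalar_iter_bounds)
  finally have "norm (Y + op_iter Y n \<circ>\<^sub>L op_iter Y n) \<le> 1 + (scalar_iter n)\<^sup>2"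
    using Suc.prems norm_triangle_ineq[of Y "op_iter Y n \<circ>\<^sub>L op_iter Y n"] by linarith
  then show ?case by simp
qed simp

text \<open>Iterates commute, so U^2 - V^2 = (U - V)(U + V). Both factors are bounded by their
  scalar counterparts, and the scalar recursion turns the product of these into the next scalar
  increment.\<close>

lemma op_iter_increment:
  assumes "norm Y \<le> 1"
  shows "norm (op_iter Y (Suc n) - op_iter Y n) \<le> scalar_iter (Suc n) - scalar_iter n"
proof (induction n)
  case 0
  then show ?case using assms by simp
next
  case (Suc n)
  let ?U = "op_iter Y (Suc n)" and ?V = "op_iter Y n"
  have YV: "op_iter Y m \<circ>\<^sub>L Y = Y \<circ>\<^sub>L op_iter Y m" for m
    using op_iter_comm_gen[OF refl, of Y m] by simp
  have "?U \<circ>\<^sub>L ?V = ?V \<circ>\<^sub>L ?U" by (rule op_iter_comm_gen) (rule YV)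
  then have "?U \<circ>\<^sub>L ?U - ?V \<circ>\<^sub>L ?V = (?U - ?V) \<circ>\<^sub>L (?U + ?V)" by (rule commuting_square_diff)
  moreover have "op_iter Y (Suc (Suc n)) - ?U = (1/2) *\<^sub>R (?U \<circ>\<^sub>L ?U - ?V \<circ>\<^sub>L ?V)"
    by (subst op_iter.simps(2)[of Y "Suc n"], subst (3) op_iter.simps(2)[of Y n])
      (simp add: algebra_simps flip: scaleR_diff_right)
  ultimately have "norm (op_iter Y (Suc (Suc n)) - ?U) \<le> (1/2) * (norm (?U - ?V) * norm (?U + ?V))"
    by (simp add: norm_blinfun_compose del: op_iter.simps)
  also have "\<dots> \<le> (1/2) * ((scalar_iter (Suc n) - scalar_iter n) * (scalar_iter (Suc n) + scalar_iter n))"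
    using Suc op_iter_norm[OF assms, of n] op_iter_norm[OF assms, of "Suc n"] scalar_iter_mono[of n]
      norm_triangle_ineq[of ?U ?V]
    by (intro mult_left_mono mult_mono) (auto simp del: op_iter.simps scalar_iter.simps)
  also have "\<dots> = scalar_iter (Suc (Suc n)) - scalar_iter (Suc n)"
    by (subst scalar_iter.simps(2)[of "Suc n"], subst (3) scalar_iter.simps(2)[of n])
      (simp add: power2_eq_square algebra_simps del: scalar_iter.simps)
  finally show ?case .
qed

text \<open>\<open>scalar_iter\<close> increases and is bounded by 1, hence is Cauchy; by
  telescoping it dominates all differences of the operator iterates.\<close>

lemma op_iter_convergent:
  fixes Y :: "'a::banach \<Rightarrow>\<^sub>L 'a"
  assumes "norm Y \<le> 1"
  shows "convergent (op_iter Y)"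
proof -
  have mono: "incseq scalar_iter" using scalar_iter_mono by (intro incseq_SucI)
  moreover have "bdd_above (range scalar_iter)"
    using scalar_iter_bounds by (intro bdd_aboveI[of _ 1]) auto
  ultimately have "convergent scalar_iter"
    using LIMSEQ_incseq_SUP convergentI by blast
  then have C: "Cauchy scalar_iter" by (rule convergent_Cauchy)
  have inc: "norm (op_iter Y (n + k) - op_iter Y n) \<le> scalar_iter (n + k) - scalar_iter n" for n k
  proof (induction k)
    case (Suc k)
    have "norm (op_iter Y (n + Suc k) - op_iter Y n)
      \<le> norm (op_iter Y (Suc (n + k)) - op_iter Y (n + k)) + norm (op_iter Y (n + k) - op_iter Y n)"
      by (metis add_Suc_right norm_diff_triangle_ineq norm_triangle_ineq diff_add_cancel add_diff_eq)
    then show ?case using Suc op_iter_increment[OF assms, of "n + k"]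
      by (simp del: op_iter.simps scalar_iter.simps)
  qed simp
  have "Cauchy (op_iter Y)"
  proof (rule CauchyI)
    fix e :: real assume "e > 0"
    then obtain N where N: "\<And>m n. m \<ge> N \<Longrightarrow> n \<ge> N \<Longrightarrow> norm (scalar_iter m - scalar_iter n) < e"
      using CauchyD[OF C] by blast
    have le: "norm (op_iter Y m - op_iter Y n) < e" if nm: "n \<ge> N" "m \<ge> n" for m n
    proof -
      obtain k where m: "m = n + k" using nm(2) le_Suc_ex by blast
      have "norm (op_iter Y m - op_iter Y n) \<le> scalar_iter m - scalar_iter n"
        using inc[of n k] m by simp
      also have "\<dots> < e" using N[of m n] nm by simp
      finally show ?thesis .
    qed
    have "norm (op_iter Y m - op_iter Y n) < e" if "m \<ge> N" "n \<ge> N" for m n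
      using le[of n m] le[of m n] that by (cases "m \<ge> n") (auto simp: norm_minus_commute)
    then show "\<exists>M. \<forall>m\<ge>M. \<forall>n\<ge>M. norm (op_iter Y m - op_iter Y n) < e" by blast
  qed
  then show ?thesis by (simp add: Cauchy_convergent_iff)
qed

lemma op_iter_positive:
  assumes "symmetric_op Y" "\<And>x. inner (blinfun_apply Y x) x \<ge> 0"
  shows "symmetric_op (op_iter Y n) \<and> inner (op_iter Y n x) x \<ge> 0"
proof -
  have s: "symmetric_op (op_iter Y n)" for n
  proof (induction n)
    case 0
    then show ?case by (simp add: symmetric_op_def)
  next
    case (Suc n)
    then show ?case
      by (auto intro!: symmetric_op_arith symmetric_op_scaleR symmetric_op_compose assms)
  qed
  have "inner (op_iter Y n x) x \<ge> 0"
  proof (cases n)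
    case (Suc m)
    have "inner (op_iter Y m (op_iter Y m x)) x \<ge> 0"
      using symmetric_opD[OF s[of m], of "op_iter Y m x" x] by simp
    then show ?thesis using assms(2)[of x] Suc by (simp add: blinfun.bilinear_simps inner_add_left)
  qed simp
  with s show ?thesis by simp
qed

text \<open>H is |A|, the square root of A^2. With Y = 1 - A^2 and X the limit of
  \<open>op_iter Y\<close>, it is 1 - X. As forms 0 \<le> X \<le> 1, which puts H between 0 and 1
  and so within 1/2 of the midpoint; this centring is what \<open>diagonal_approximation\<close>
  iterates.\<close>

lemma abs_op_unit_exists:
  fixes A :: "'a::{real_inner,banach} \<Rightarrow>\<^sub>L 'a"
  assumes A: "symmetric_op A" "norm A \<le> 1"
  shows "\<exists>H. symmetric_op H \<and> H \<circ>\<^sub>L H = A \<circ>\<^sub>L A \<and> norm (H - (1/2) *\<^sub>R id_blinfun) \<le> 1/2 \<and>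
    (\<forall>S. S \<circ>\<^sub>L A = A \<circ>\<^sub>L S \<longrightarrow> S \<circ>\<^sub>L H = H \<circ>\<^sub>L S)"
proof -
  define Y where "Y = id_blinfun - A \<circ>\<^sub>L A"
  have symY: "symmetric_op Y"
    unfolding Y_def by (intro symmetric_op_arith symmetric_op_scaleR symmetric_op_id symmetric_op_compose A refl)
  have Yq: "inner (Y x) x = (norm x)\<^sup>2 - (norm (A x))\<^sup>2" for x
    using A(1) by (simp add: Y_def blinfun.bilinear_simps inner_diff_left power2_norm_eq_inner symmetric_op_def)
  have Ax: "(norm (A x))\<^sup>2 \<le> (norm x)\<^sup>2" for x
  proof -
    have "norm (A x) \<le> 1 * norm x"
      using norm_blinfun[of A x] A(2) mult_right_mono[of "norm A" 1 "norm x"] by auto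
    then show ?thesis by (simp add: power_mono)
  qed
  have normY: "norm Y \<le> 1"
    by (rule symmetric_norm_le[OF symY]) (use Ax in \<open>auto simp: Yq\<close>)
  obtain X where X: "op_iter Y \<longlonglongrightarrow> X"
    using op_iter_convergent[OF normY] by (auto simp: convergent_def)
  have pos: "symmetric_op (op_iter Y n) \<and> inner (op_iter Y n x) x \<ge> 0" for n x
    by (rule op_iter_positive[OF symY]) (use Ax in \<open>simp add: Yq\<close>)
  have symX: "symmetric_op X" by (rule symmetric_op_lim[OF X]) (use pos in blast)
  have X0: "inner (X x) x \<ge> 0" for x
  proof (rule LIMSEQ_le_const)
    show "(\<lambda>n. inner (op_iter Y n x) x) \<longlonglongrightarrow> inner (X x) x" by (intro tendsto_intros X)
  qed (use pos in auto)
  have X1: "inner (X x) x \<le> (norm x)\<^sup>2" for x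
  proof (rule LIMSEQ_le_const2)
    show "(\<lambda>n. inner (op_iter Y n x) x) \<longlonglongrightarrow> inner (X x) x" by (intro tendsto_intros X)
    have "inner (op_iter Y n x) x \<le> (norm x)\<^sup>2" for n
    proof -
      have "inner (op_iter Y n x) x \<le> norm (op_iter Y n x) * norm x" by (rule norm_cauchy_schwarz)
      also have "\<dots> \<le> (1 * norm x) * norm x"
        using op_iter_norm[OF normY, of n] scalar_iter_bounds[of n]
        by (intro mult_right_mono order_trans[OF norm_blinfun]) auto
      finally show ?thesis by (simp add: power2_eq_square)
    qed
    then show "\<exists>N. \<forall>n\<ge>N. inner (op_iter Y n x) x \<le> (norm x)\<^sup>2" by blast
  qed
  have "(\<lambda>n. op_iter Y (Suc n)) \<longlonglongrightarrow> (1/2) *\<^sub>R (Y + X \<circ>\<^sub>L X)"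
    unfolding op_iter.simps by (intro tendsto_intros tendsto_compose_blinfun X)
  then have fixX: "X = (1/2) *\<^sub>R (Y + X \<circ>\<^sub>L X)"
    using LIMSEQ_Suc[OF X] LIMSEQ_unique by blast
  \<comment> \<open>Rearranged, 2X = Y + X^2 says (1 - X)^2 = 1 - Y = A^2.\<close>
  then have fix2: "X + X = Y + X \<circ>\<^sub>L X"
    by (metis scaleR_half_double scaleR_add_right)
  define H where "H = id_blinfun - X"
  have "H \<circ>\<^sub>L H = id_blinfun - (X + X) + X \<circ>\<^sub>L X"
    by (simp add: H_def compose_arith compose_id)
  also have "\<dots> = A \<circ>\<^sub>L A" unfolding fix2 Y_def by simp
  finally have HH: "H \<circ>\<^sub>L H = A \<circ>\<^sub>L A" .
  have symH: "symmetric_op H" unfolding H_def by (intro symmetric_op_arith symmetric_op_scaleR symmetric_op_id symX)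
  moreover have "norm (H - (1/2) *\<^sub>R id_blinfun) \<le> 1/2"
  proof (rule symmetric_norm_le)
    show "symmetric_op (H - (1/2) *\<^sub>R id_blinfun)"
      by (intro symmetric_op_arith symmetric_op_scaleR symmetric_op_id symH)
    fix x
    have "inner ((H - (1/2) *\<^sub>R id_blinfun) x) x = (norm x)\<^sup>2 / 2 - inner (X x) x"
      by (simp add: H_def blinfun.bilinear_simps inner_diff_left power2_norm_eq_inner)
    then show "\<bar>inner ((H - (1/2) *\<^sub>R id_blinfun) x) x\<bar> \<le> 1/2 * (norm x)\<^sup>2"
      using X0[of x] X1[of x] by linarith
  qed simp
  moreover have "S \<circ>\<^sub>L H = H \<circ>\<^sub>L S" if S: "S \<circ>\<^sub>L A = A \<circ>\<^sub>L S" for S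
  proof -
    have "S \<circ>\<^sub>L (A \<circ>\<^sub>L A) = (A \<circ>\<^sub>L A) \<circ>\<^sub>L S" by (metis S compose_assoc)
    then have "S \<circ>\<^sub>L Y = Y \<circ>\<^sub>L S" by (simp add: Y_def compose_arith compose_id)
    then have c: "S \<circ>\<^sub>L op_iter Y n = op_iter Y n \<circ>\<^sub>L S" for n by (rule op_iter_comm_gen)
    have "(\<lambda>n. S \<circ>\<^sub>L op_iter Y n) \<longlonglongrightarrow> S \<circ>\<^sub>L X" "(\<lambda>n. op_iter Y n \<circ>\<^sub>L S) \<longlonglongrightarrow> X \<circ>\<^sub>L S"
      by (intro tendsto_compose_blinfun X tendsto_const)+
    then have "S \<circ>\<^sub>L X = X \<circ>\<^sub>L S" unfolding c using LIMSEQ_unique by blast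
    then show ?thesis by (simp add: H_def compose_arith compose_id)
  qed
  ultimately show ?thesis using HH by blast
qed

text \<open>The adjoint of S is a multiple of S, so subspaces invariant under S are invariant under
  its adjoint. This covers C and the symmetric operators (\<sigma> = 1) together with multiplication
  by i (\<sigma> = -1).\<close>

definition sigma_symmetric :: "('a::real_inner \<Rightarrow>\<^sub>L 'a) \<Rightarrow> bool" where
  "sigma_symmetric S \<longleftrightarrow> (\<exists>\<sigma>. \<forall>x y. inner (S x) y = \<sigma> * inner x (S y))"

lemma sigma_symmetric_of_symmetric: "symmetric_op T \<Longrightarrow> sigma_symmetric T"
  by (auto simp: sigma_symmetric_def symmetric_op_def intro!: exI[of _ 1])

text \<open>s is the reflection that is -1 on the kernel N of H + A, where A = -H, and 1 on its
  complement. On the kernel of A, contained in N, it is -1 instead of 0, so s is an involution and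
  not just a partial isometry. S and its adjoint preserve N, hence S commutes with s.\<close>

lemma polar_decomposition:
  fixes A :: "'a::{real_inner,banach} \<Rightarrow>\<^sub>L 'a"
  assumes A: "symmetric_op A" and M: "norm A \<le> M" "M > 0"
  shows "\<exists>s H. symmetric_op s \<and> s \<circ>\<^sub>L s = id_blinfun \<and> symmetric_op H \<and> A = s \<circ>\<^sub>L H \<and>
     norm (H - (M/2) *\<^sub>R id_blinfun) \<le> M/2 \<and>
     (\<forall>S. sigma_symmetric S \<longrightarrow> S \<circ>\<^sub>L A = A \<circ>\<^sub>L S \<longrightarrow> S \<circ>\<^sub>L H = H \<circ>\<^sub>L S \<and> S \<circ>\<^sub>L s = s \<circ>\<^sub>L S)"
proof -
  define A1 where "A1 = (1/M) *\<^sub>R A"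
  have "symmetric_op A1" unfolding A1_def by (rule symmetric_op_scaleR[OF A(1)])
  moreover have "norm A1 \<le> 1" using M by (simp add: A1_def)
  ultimately obtain H1 where H1: "symmetric_op H1" "H1 \<circ>\<^sub>L H1 = A1 \<circ>\<^sub>L A1"
      "norm (H1 - (1/2) *\<^sub>R id_blinfun) \<le> 1/2" 
     and H1c: "\<And>S. S \<circ>\<^sub>L A1 = A1 \<circ>\<^sub>L S \<Longrightarrow> S \<circ>\<^sub>L H1 = H1 \<circ>\<^sub>L S"
    using abs_op_unit_exists by blast
  define H where "H = M *\<^sub>R H1"
  have A_eq: "A = M *\<^sub>R A1" using M by (simp add: A1_def)
  have symH: "symmetric_op H" unfolding H_def by (rule symmetric_op_scaleR[OF H1(1)])
  have HH: "H \<circ>\<^sub>L H = A \<circ>\<^sub>L A" by (simp add: H_def A_eq compose_arith H1(2))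
  have "H - (M/2) *\<^sub>R id_blinfun = M *\<^sub>R (H1 - (1/2) *\<^sub>R id_blinfun)"
    by (simp add: H_def scaleR_diff_right)
  then have nH: "norm (H - (M/2) *\<^sub>R id_blinfun) \<le> M/2" using H1(3) M by simp
  have Hc: "S \<circ>\<^sub>L H = H \<circ>\<^sub>L S" if "S \<circ>\<^sub>L A = A \<circ>\<^sub>L S" for S
    using H1c[of S] that M by (simp add: H_def A_eq compose_arith)
  define N where "N = {x. (H + A) x = 0}"
  have subN: "subspace N" unfolding subspace_def N_def
    by (auto simp: blinfun.add_right blinfun.scaleR_right)
  have "closed N" unfolding N_def
    by (intro closed_Collect_eq continuous_intros)
  then obtain P where P: "is_projection_onto P N" using projection_exists[OF subN] by blast
  define s where "s = id_blinfun - 2 *\<^sub>R P"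
  have symP: "symmetric_op P" by (rule symmetric_projection[OF P])
  have syms: "symmetric_op s" unfolding s_def by (intro symmetric_op_arith symmetric_op_scaleR symmetric_op_id symP)
  have ss: "s \<circ>\<^sub>L s = id_blinfun"
    by (rule blinfun_eqI) (simp add: s_def blinfun.bilinear_simps idem_projection[OF P] scaleR_2)
  have PS: "P (S x) = S (P x)" if S: "sigma_symmetric S" "S \<circ>\<^sub>L A = A \<circ>\<^sub>L S" for S x
  proof -
    obtain \<sigma> where \<sigma>: "\<And>x y. inner (S x) y = \<sigma> * inner x (S y)"
      using S(1) by (auto simp: sigma_symmetric_def)
    have "S (H x) = H (S x)" "S (A x) = A (S x)" for x
      using Hc[OF S(2)] S(2) by (metis blinfun_apply_blinfun_compose)+
    then have inv: "S w \<in> N" if "w \<in> N" for w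
      using that by (simp add: N_def blinfun.bilinear_simps) (metis blinfun.add_right blinfun.zero_right)
    show ?thesis
      by (rule projection_comm[OF P inv, where S'="\<lambda>y. \<sigma> *\<^sub>R S y"])
        (use inv subN in \<open>auto simp: \<sigma> subspace_scale\<close>)
  qed
  have sc: "S \<circ>\<^sub>L s = s \<circ>\<^sub>L S" if S: "sigma_symmetric S" "S \<circ>\<^sub>L A = A \<circ>\<^sub>L S" for S
    by (rule blinfun_eqI) (simp add: s_def blinfun.bilinear_simps PS[OF S])
  have PA: "P (A x) = A (P x)" for x by (rule PS) (auto simp: sigma_symmetric_of_symmetric A)
  have AH: "A \<circ>\<^sub>L H = H \<circ>\<^sub>L A" by (rule Hc) simp
  have PH: "P (H x) = H (P x)" for x by (rule PS) (auto simp: sigma_symmetric_of_symmetric symH AH)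
  have sH: "A x = s (H x)" for x
  proof -
    \<comment> \<open>(H + A)(H - A) = H^2 - A^2 = 0, so u lies in N and P leaves it
      unchanged.\<close>
    define u where "u = H x - A x"
    have HHx: "H (H x) = A (A x)" "A (H x) = H (A x)" for x
      using HH AH by (metis blinfun_apply_blinfun_compose)+
    have "u \<in> N" by (simp add: N_def u_def blinfun.bilinear_simps HHx)
    then have "P u = u" using P by (simp add: is_projection_onto_def)
    then have u: "u = H (P x) - A (P x)" unfolding u_def by (simp add: blinfun.bilinear_simps PH PA)
    have "P x \<in> N" using P by (simp add: is_projection_onto_def)
    then have "A (P x) = - H (P x)" by (simp add: N_def blinfun.bilinear_simps add_eq_0_iff)
    then have "H x - A x = 2 *\<^sub>R H (P x)" using u by (simp add: u_def scaleR_2)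
    then have "A x = H x - 2 *\<^sub>R H (P x)" by (simp add: algebra_simps)
    moreover have "s (H x) = H x - 2 *\<^sub>R H (P x)" by (simp add: s_def blinfun.bilinear_simps PH)
    ultimately show ?thesis by simp
  qed
  then have "A = s \<circ>\<^sub>L H" by (intro blinfun_eqI) simp
  with syms ss symH nH Hc sc show ?thesis by blast
qed

lemma norm_involution:
  assumes "symmetric_op s" "s \<circ>\<^sub>L s = id_blinfun"
  shows "norm (blinfun_apply s x) = norm x"
proof -
  have "s (s x) = x" using assms(2) by (metis blinfun_apply_blinfun_compose id_blinfun.rep_eq id_apply)
  then have "inner (s x) (s x) = inner x x" using symmetric_opD[OF assms(1), of x "s x"] by simp
  then show ?thesis by (simp add: norm_eq_sqrt_inner)
qed

text \<open>In A = s H the centred operator H - M/2 has half the norm bound, so induction applies to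
  it; D = s (M/2 + D1) is as close to A as D1 is to the centred operator, s being isometric. The
  commutation clause is carried along to give D the symmetries of A under i and C.\<close>

lemma diagonal_approximation:
  fixes A :: "'a::{real_inner,banach} \<Rightarrow>\<^sub>L 'a"
  assumes "symmetric_op A" "norm A \<le> M" "M > 0"
  shows "\<exists>D. symmetric_op D \<and> norm (A - D) \<le> M / 2 ^ n \<and> span {y. \<exists>t. D y = t *\<^sub>R y} = UNIV \<and>
     (\<forall>S. sigma_symmetric S \<longrightarrow> S \<circ>\<^sub>L A = A \<circ>\<^sub>L S \<longrightarrow> S \<circ>\<^sub>L D = D \<circ>\<^sub>L S)"
  using assms
proof (induction n arbitrary: A M)
  case 0
  show ?case
  proof (intro exI[of _ 0] conjI)
    show "symmetric_op (0::'a \<Rightarrow>\<^sub>L 'a)" by (simp add: symmetric_op_def)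
    have "{y. \<exists>t. (0::'a \<Rightarrow>\<^sub>L 'a) y = t *\<^sub>R y} = UNIV" by (auto intro: exI[of _ 0])
    then show "span {y. \<exists>t. (0::'a \<Rightarrow>\<^sub>L 'a) y = t *\<^sub>R y} = UNIV" by (simp add: span_UNIV)
    show "\<forall>S. sigma_symmetric S \<longrightarrow> S \<circ>\<^sub>L A = A \<circ>\<^sub>L S \<longrightarrow> S \<circ>\<^sub>L 0 = 0 \<circ>\<^sub>L S"
      by (auto intro!: blinfun_eqI)
  qed (use 0 in auto)
next
  case (Suc n)
  obtain s H where s: "symmetric_op s" "s \<circ>\<^sub>L s = id_blinfun" and H: "symmetric_op H" "A = s \<circ>\<^sub>L H"
     "norm (H - (M/2) *\<^sub>R id_blinfun) \<le> M/2"
    and c: "\<And>S. sigma_symmetric S \<Longrightarrow> S \<circ>\<^sub>L A = A \<circ>\<^sub>L S \<Longrightarrow> S \<circ>\<^sub>L H = H \<circ>\<^sub>L S \<and> S \<circ>\<^sub>L s = s \<circ>\<^sub>L S"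
    using polar_decomposition[OF Suc.prems] by blast
  define A1 where "A1 = H - (M/2) *\<^sub>R id_blinfun"
  have symA1: "symmetric_op A1" unfolding A1_def by (intro symmetric_op_arith symmetric_op_scaleR symmetric_op_id H)
  have "norm A1 \<le> M/2" "M/2 > 0" using H(3) Suc.prems by (simp_all add: A1_def)
  from Suc.IH[OF symA1 this] obtain D1 where D1: "symmetric_op D1" "norm (A1 - D1) \<le> M/2 / 2^n"
    "span {y. \<exists>t. D1 y = t *\<^sub>R y} = UNIV"
    and c1: "\<And>S. sigma_symmetric S \<Longrightarrow> S \<circ>\<^sub>L A1 = A1 \<circ>\<^sub>L S \<Longrightarrow> S \<circ>\<^sub>L D1 = D1 \<circ>\<^sub>L S"
    by blast
  have cA1: "S \<circ>\<^sub>L A1 = A1 \<circ>\<^sub>L S \<and> S \<circ>\<^sub>L s = s \<circ>\<^sub>L S" if "sigma_symmetric S" "S \<circ>\<^sub>L A = A \<circ>\<^sub>L S" for S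
    using c[OF that] by (simp add: A1_def compose_arith compose_id)
  have "s \<circ>\<^sub>L H = H \<circ>\<^sub>L s"
    using c[OF sigma_symmetric_of_symmetric[OF Suc.prems(1)] refl] H(2)
    by (metis compose_assoc compose_id s(2))
  then have sA1: "s \<circ>\<^sub>L A1 = A1 \<circ>\<^sub>L s" by (simp add: A1_def compose_arith compose_id)
  \<comment> \<open>s is itself one of the operators S of the induction hypothesis; that it commutes
    with D1 makes D symmetric.\<close>
  have sD1: "s \<circ>\<^sub>L D1 = D1 \<circ>\<^sub>L s"
    by (rule c1[OF sigma_symmetric_of_symmetric[OF s(1)] sA1])
  define G where "G = (M/2) *\<^sub>R id_blinfun + D1"
  define D where "D = s \<circ>\<^sub>L G"
  have symG: "symmetric_op G" unfolding G_def by (intro symmetric_op_arith symmetric_op_scaleR symmetric_op_id D1)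
  have sG: "s \<circ>\<^sub>L G = G \<circ>\<^sub>L s" by (simp add: G_def compose_arith compose_id sD1)
  have symD: "symmetric_op D" unfolding D_def by (rule symmetric_op_compose[OF s(1) symG sG])
  have "norm (A - D) \<le> M / 2 ^ Suc n"
  proof (rule norm_blinfun_bound)
    fix x
    have "(A - D) x = s ((A1 - D1) x)"
      by (simp add: H(2) D_def G_def A1_def blinfun.bilinear_simps algebra_simps)
    then have "norm ((A - D) x) = norm ((A1 - D1) x)" by (simp add: norm_involution[OF s])
    also have "\<dots> \<le> norm (A1 - D1) * norm x" by (rule norm_blinfun)
    also have "\<dots> \<le> (M/2 / 2^n) * norm x" by (intro mult_right_mono D1) simp
    finally show "norm ((A - D) x) \<le> M / 2 ^ Suc n * norm x" by simp
  qed (use Suc.prems in simp)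
  moreover have "span {y. \<exists>t. D y = t *\<^sub>R y} = UNIV"
  proof -
    have "y \<in> span {y. \<exists>t. D y = t *\<^sub>R y}" if "D1 y = t *\<^sub>R y" for y t
    proof -
      have sy: "s (s y) = y" using s(2) by (metis blinfun_apply_blinfun_compose id_blinfun.rep_eq id_apply)
      have "D1 (s y) = t *\<^sub>R s y"
        using sD1 that by (metis blinfun_apply_blinfun_compose blinfun.scaleR_right)
      \<comment> \<open>s fixes y + s y and negates y - s y, so D has there the eigenvalues M/2 + t
        and its negative; y is half the sum of the two vectors.\<close>
      then have "D (y + s y) = (M/2 + t) *\<^sub>R (y + s y)" "D (y - s y) = (- (M/2 + t)) *\<^sub>R (y - s y)"
        using that sy by (simp_all add: D_def G_def blinfun.bilinear_simps algebra_simps)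
      then have "y + s y \<in> span {y. \<exists>t. D y = t *\<^sub>R y}" "y - s y \<in> span {y. \<exists>t. D y = t *\<^sub>R y}"
        by (auto intro!: span_base)
      then have "(1/2) *\<^sub>R ((y + s y) + (y - s y)) \<in> span {y. \<exists>t. D y = t *\<^sub>R y}"
        by (blast intro: span_scale span_add)
      moreover have "(1/2) *\<^sub>R ((y + s y) + (y - s y)) = y" by (simp flip: scaleR_2)
      ultimately show ?thesis by (simp only:)
    qed
    then have "{y. \<exists>t. D1 y = t *\<^sub>R y} \<subseteq> span {y. \<exists>t. D y = t *\<^sub>R y}" by blast
    then have "span {y. \<exists>t. D1 y = t *\<^sub>R y} \<subseteq> span {y. \<exists>t. D y = t *\<^sub>R y}"
      by (rule span_minimal) simp
    with D1(3) show ?thesis by auto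
  qed
  moreover have "S \<circ>\<^sub>L D = D \<circ>\<^sub>L S" if "sigma_symmetric S" "S \<circ>\<^sub>L A = A \<circ>\<^sub>L S" for S
  proof -
    have "S \<circ>\<^sub>L D1 = D1 \<circ>\<^sub>L S" "S \<circ>\<^sub>L s = s \<circ>\<^sub>L S" using cA1[OF that] c1[OF that(1)] by auto
    moreover from this have "S \<circ>\<^sub>L G = G \<circ>\<^sub>L S" by (simp add: G_def compose_arith compose_id)
    ultimately show ?thesis by (metis D_def compose_assoc)
  qed
  ultimately show ?case using symD by blast
qed

section \<open>The complex structure\<close>

lemma norm_scaleC: "norm (c *\<^sub>C x) = cmod c * norm (x::'a::complex_inner)"
proof -
  have "inner (c *\<^sub>C x) (c *\<^sub>C x) = Re (c * (cnj c * cinner x x))"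
    by (simp add: inner_eq_Re_cinner cinner_scaleC_left cinner_scaleC_right algebra_simps)
  also have "c * (cnj c * cinner x x) = complex_of_real ((cmod c)\<^sup>2) * cinner x x"
    by (metis complex_norm_square mult.assoc of_real_power)
  also have "Re \<dots> = (cmod c)\<^sup>2 * inner x x"
    by (simp add: inner_eq_Re_cinner)
  finally show ?thesis
    by (simp add: norm_eq_sqrt_inner real_sqrt_mult)
qed

lemma scaleC_scaleR_commute: "c *\<^sub>C (r *\<^sub>R x) = r *\<^sub>R (c *\<^sub>C x)"
  for x :: "'a::complex_vector"
  by (simp add: scaleR_eq_scaleC scaleC_scaleC mult.commute)

lemma bounded_linear_scaleC: "bounded_linear (\<lambda>x::'a::complex_inner. c *\<^sub>C x)"
  by (rule bounded_linear_intro[where K="cmod c"])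
    (simp_all add: scaleC_add_right norm_scaleC scaleC_scaleR_commute)

text \<open>Multiplication by i as a member of the real operator space, so that i B can be written
  as a composition of bounded real-linear maps.\<close>

definition imag_op :: "'a::complex_inner \<Rightarrow>\<^sub>L 'a" where
  "imag_op = Blinfun (\<lambda>x. \<i> *\<^sub>C x)"

lemma imag_op_apply [simp]: "imag_op x = \<i> *\<^sub>C x"
  by (simp add: imag_op_def bounded_linear_Blinfun_apply bounded_linear_scaleC)

lemma imag_imag: "\<i> *\<^sub>C \<i> *\<^sub>C x = - (x::'a::complex_vector)"
proof -
  have "(-1::complex) *\<^sub>C x = - x" using scaleR_eq_scaleC[of "-1" x] by simp
  then show ?thesis by (simp add: scaleC_scaleC)
qed

lemma scaleC_decomp: "c *\<^sub>C x = Re c *\<^sub>R x + Im c *\<^sub>R (\<i> *\<^sub>C (x::'a::complex_vector))"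
proof -
  have "c = complex_of_real (Re c) + complex_of_real (Im c) * \<i>" by (simp add: complex_eq mult.commute)
  then have "c *\<^sub>C x = (complex_of_real (Re c) + complex_of_real (Im c) * \<i>) *\<^sub>C x" by simp
  then show ?thesis by (simp only: scaleC_add_left scaleR_eq_scaleC scaleC_scaleC)
qed

lemma bounded_ops_iff:
  fixes T :: "'a::complex_inner \<Rightarrow>\<^sub>L 'a"
  shows "T \<in> bounded_ops \<longleftrightarrow> (\<forall>x. T (\<i> *\<^sub>C x) = \<i> *\<^sub>C T x)"
proof
  assume i: "\<forall>x. T (\<i> *\<^sub>C x) = \<i> *\<^sub>C T x"
  have "T (c *\<^sub>C x) = c *\<^sub>C T x" for c x
    by (subst (1 2) scaleC_decomp) (simp add: blinfun.bilinear_simps i)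
  then show "T \<in> bounded_ops" by (simp add: bounded_ops_def)
qed (simp add: bounded_ops_def)

lemma inner_imag_left: "inner (\<i> *\<^sub>C x) y = - inner x (\<i> *\<^sub>C (y::'a::complex_inner))"
  by (simp add: inner_eq_Re_cinner cinner_scaleC_left cinner_scaleC_right)

lemma inner_imag_both: "inner (\<i> *\<^sub>C x) (\<i> *\<^sub>C y) = inner x (y::'a::complex_inner)"
  by (simp add: inner_eq_Re_cinner cinner_scaleC_left cinner_scaleC_right)

text \<open>The imaginary part of \<open>cinner x y\<close> is the real inner product of x with i y.
  Complex orthogonality to a vector is therefore written below as real orthogonality to it and to i
  times it.\<close>

lemma cinner_eq_inner: "cinner x y = Complex (inner x y) (inner x (\<i> *\<^sub>C (y::'a::complex_inner)))"
  by (rule complex_eqI) (simp_all add: inner_eq_Re_cinner cinner_scaleC_right)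

lemma sigma_symmetric_imag: "sigma_symmetric imag_op"
  by (auto simp: sigma_symmetric_def inner_imag_left intro!: exI[of _ "-1"])

text \<open>Testing against y and i y recovers the complex identity, so adjoints can be computed
  with the real inner product.\<close>

lemma adjoint_op_eqI:
  fixes T S :: "'a::complex_hilbert_space \<Rightarrow>\<^sub>L 'a"
  assumes "T \<in> bounded_ops" "S \<in> bounded_ops" "\<And>x y. inner (T x) y = inner x (S y)"
  shows "adjoint_op T = S"
proof -
  have "cinner (T x) y = cinner x (S y)" for x y
    using assms(3)[of x y] assms(3)[of x "\<i> *\<^sub>C y"] assms(2)
    by (simp add: cinner_eq_inner bounded_ops_iff)
  then show ?thesis
    using adjoint_op_exists[OF assms(1)] adjoint_op_in_bounded_ops[OF assms(1)]
      cinner_adjoint_op[OF assms(1)] assms(2) by blast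
qed

lemma inner_adjoint_op:
  fixes T :: "'a::complex_hilbert_space \<Rightarrow>\<^sub>L 'a"
  shows "T \<in> bounded_ops \<Longrightarrow> inner (T x) y = inner x (adjoint_op T y)"
  by (simp add: inner_eq_Re_cinner cinner_adjoint_op)

lemma orthogonal_projection_iff:
  fixes P :: "'a::complex_hilbert_space \<Rightarrow>\<^sub>L 'a"
  shows
  "orthogonal_projection P \<longleftrightarrow> P \<in> bounded_ops \<and> symmetric_op P \<and> (\<forall>x. P (P x) = P x)"
proof
  assume P: "orthogonal_projection P"
  then have "inner (P x) y = inner x (P y)" for x y
    using inner_adjoint_op[of P x y] by (simp add: orthogonal_projection_def)
  moreover have "P (P x) = P x" for x
    using P unfolding orthogonal_projection_def by (metis blinfun_apply_blinfun_compose)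
  ultimately show "P \<in> bounded_ops \<and> symmetric_op P \<and> (\<forall>x. P (P x) = P x)"
    using P by (simp add: orthogonal_projection_def symmetric_op_def)
next
  assume P: "P \<in> bounded_ops \<and> symmetric_op P \<and> (\<forall>x. P (P x) = P x)"
  then have "adjoint_op P = P" by (intro adjoint_op_eqI) (auto simp: symmetric_op_def)
  then show "orthogonal_projection P"
    using P by (auto simp: orthogonal_projection_def intro!: blinfun_eqI)
qed

section \<open>Conjugations as symmetric isometric involutions of the underlying real space\<close>

lemma
  assumes "conjugation C"
  shows conj_add: "C (x + y) = C x + C y"
    and conj_scaleC: "C (c *\<^sub>C x) = cnj c *\<^sub>C C x"
    and conj_scaleR: "C (r *\<^sub>R x) = r *\<^sub>R C x"
    and conj_conj: "C (C x) = x"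
    and conj_inner: "inner (C x) y = inner x (C y)"
    and conj_norm: "norm (C x) = norm x"
proof -
  have inv: "C (C x) = x" for x using assms by (auto simp: conjugation_def dest: fun_cong)
  have ii: "cinner (C x) (C y) = cinner y x" for x y using assms by (auto simp: conjugation_def)
  show "C (x + y) = C x + C y" "C (c *\<^sub>C x) = cnj c *\<^sub>C C x" "C (r *\<^sub>R x) = r *\<^sub>R C x"
    using assms by (auto simp: conjugation_def scaleR_eq_scaleC)
  show "C (C x) = x" by (rule inv)
  show "inner (C x) y = inner x (C y)"
    using ii[of x "C y"] by (simp add: inner_eq_Re_cinner inv) (metis cinner_commute cnj.simps(1))
  have "inner (C x) (C x) = inner x x" by (simp add: inner_eq_Re_cinner ii)
  then show "norm (C x) = norm x" by (simp add: norm_eq_sqrt_inner)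
qed

lemma conj_bounded_linear: "conjugation C \<Longrightarrow> bounded_linear C"
  by (rule bounded_linear_intro[where K=1]) (simp_all add: conj_add conj_scaleR conj_norm)

lemma conj_imag: "conjugation C \<Longrightarrow> C (\<i> *\<^sub>C x) = - (\<i> *\<^sub>C C x)"
  by (simp add: conj_scaleC)

lemma conj_diff: "conjugation C \<Longrightarrow> C (x - y) = C x - C y"
  using conj_bounded_linear bounded_linear.linear linear_diff by blast

text \<open>The operators that become symmetric real operators on the real Hilbert space of
  \<open>C\<close>-fixed vectors.\<close>

definition conj_real :: "('a \<Rightarrow> 'a) \<Rightarrow> ('a::complex_hilbert_space \<Rightarrow>\<^sub>L 'a) \<Rightarrow> bool" where
  "conj_real C A \<longleftrightarrow> A \<in> bounded_ops \<and> symmetric_op A \<and> (\<forall>x. A (C x) = C (A x))"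

lemma conj_realD:
  fixes A :: "'a::complex_hilbert_space \<Rightarrow>\<^sub>L 'a"
  assumes "conj_real C A"
  shows "A (\<i> *\<^sub>C x) = \<i> *\<^sub>C A x" "inner (A x) y = inner x (A y)" "A (C x) = C (A x)" "symmetric_op A"
  using assms by (auto simp: conj_real_def bounded_ops_iff symmetric_op_def)

lemma conj_realI:
  fixes A :: "'a::complex_hilbert_space \<Rightarrow>\<^sub>L 'a"
  assumes "\<And>x. A (\<i> *\<^sub>C x) = \<i> *\<^sub>C A x" "\<And>x y. inner (A x) y = inner x (A y)" "\<And>x. A (C x) = C (A x)"
  shows "conj_real C A"
  using assms by (auto simp: conj_real_def bounded_ops_iff symmetric_op_def)

lemma conj_real_add: "conjugation C \<Longrightarrow> conj_real C A \<Longrightarrow> conj_real C B \<Longrightarrow> conj_real C (A + B)"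
  by (rule conj_realI) (simp_all add: blinfun.bilinear_simps conj_realD conj_add scaleC_add_right inner_add_left inner_add_right)

lemma conj_real_scaleR: "conjugation C \<Longrightarrow> conj_real C A \<Longrightarrow> conj_real C (r *\<^sub>R A)"
  by (rule conj_realI) (simp_all add: blinfun.bilinear_simps conj_realD conj_scaleR scaleC_scaleR_commute)

lemma conj_real_0: "conjugation C \<Longrightarrow> conj_real C 0"
  using bounded_linear.linear[OF conj_bounded_linear, of C, THEN linear_0]
  by (intro conj_realI) simp_all

lemma conj_real_lim:
  assumes C: "conjugation C" and X: "X \<longlonglongrightarrow> A" and r: "\<And>n. conj_real C (X n)"
  shows "conj_real C A"
proof (rule conj_realI)
  have p: "(\<lambda>n. X n x) \<longlonglongrightarrow> A x" for x by (intro tendsto_intros X)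
  show "A (\<i> *\<^sub>C x) = \<i> *\<^sub>C A x" for x
    using p[of "\<i> *\<^sub>C x"] bounded_linear.tendsto[OF bounded_linear_scaleC p, of \<i> x]
    unfolding conj_realD(1)[OF r] by (rule LIMSEQ_unique)
  show "A (C x) = C (A x)" for x
    using p[of "C x"] bounded_linear.tendsto[OF conj_bounded_linear[OF C] p, of x]
    unfolding conj_realD(3)[OF r] by (rule LIMSEQ_unique)
  show "inner (A x) y = inner x (A y)" for x y
    using symmetric_op_lim[OF X] conj_realD(4)[OF r] by (simp add: symmetric_op_def)
qed

lemma conj_real_sum:
  "conjugation C \<Longrightarrow> (\<And>i. i \<in> I \<Longrightarrow> conj_real C (f i)) \<Longrightarrow> conj_real C (sum f I)"
  by (induction I rule: infinite_finite_induct) (auto simp: conj_real_0 conj_real_add)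

lemma adjoint_combination:
  assumes C: "conjugation C" and A: "conj_real C A" and B: "conj_real C B"
  shows "A + imag_op \<circ>\<^sub>L B \<in> bounded_ops" "adjoint_op (A + imag_op \<circ>\<^sub>L B) = A - imag_op \<circ>\<^sub>L B"
proof -
  show b: "A + imag_op \<circ>\<^sub>L B \<in> bounded_ops"
    by (simp add: bounded_ops_iff blinfun.bilinear_simps conj_realD[OF A] conj_realD[OF B] scaleC_add_right)
  show "adjoint_op (A + imag_op \<circ>\<^sub>L B) = A - imag_op \<circ>\<^sub>L B"
    by (rule adjoint_op_eqI[OF b])
     (simp_all add: bounded_ops_iff blinfun.bilinear_simps conj_realD(1)[OF A] conj_realD(1)[OF B] complex_vector.scale_right_diff_distrib
       inner_add_left inner_diff_right inner_imag_left conj_realD(2)[OF A] conj_realD(2)[OF B])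
qed

text \<open>C commutes with A and B but turns i into -i, so C (A + iB) C = A - iB, which is the
  adjoint.\<close>

lemma combination_in_CSO:
  assumes C: "conjugation C" and A: "conj_real C A" and B: "conj_real C B"
  shows "A + imag_op \<circ>\<^sub>L B \<in> CSO"
proof -
  have "C \<circ> blinfun_apply (A + imag_op \<circ>\<^sub>L B) \<circ> C = blinfun_apply (A - imag_op \<circ>\<^sub>L B)"
    by (rule ext) (simp add: blinfun.bilinear_simps conj_add conj_imag conj_realD[OF A] conj_realD[OF B] C conj_conj
      flip: conj_realD(3)[OF A] conj_realD(3)[OF B])
  with adjoint_combination[OF C A B] C show ?thesis
    unfolding CSO_def complex_symmetric_def by auto
qed

text \<open>A and B are the Cartesian parts of T. C exchanges T with its adjoint S; in B = i (S - T)
  / 2 the resulting sign is cancelled by the conjugation of i, so both parts commute with C.\<close>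

lemma CSO_decomposition:
  assumes "T \<in> CSO"
  shows "\<exists>C A B. conjugation C \<and> conj_real C A \<and> conj_real C B \<and> T = A + imag_op \<circ>\<^sub>L B"
proof -
  obtain C where C: "conjugation C" and CT: "C \<circ> blinfun_apply T \<circ> C = blinfun_apply (adjoint_op T)"
     and T: "T \<in> bounded_ops" using assms by (auto simp: CSO_def complex_symmetric_def)
  define S where "S = adjoint_op T"
  have S: "S \<in> bounded_ops" unfolding S_def by (rule adjoint_op_in_bounded_ops[OF T])
  have ad: "inner (T x) y = inner x (S y)" for x y unfolding S_def by (rule inner_adjoint_op[OF T])
  have ad': "inner (S x) y = inner x (T y)" for x y by (metis ad inner_commute)
  have Sx: "S x = C (T (C x))" for x using CT by (simp add: S_def fun_eq_iff)
  have TC: "T (C x) = C (S x)" "S (C x) = C (T x)" for x by (simp_all add: Sx conj_conj[OF C])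
  have i: "T (\<i> *\<^sub>C x) = \<i> *\<^sub>C T x" "S (\<i> *\<^sub>C x) = \<i> *\<^sub>C S x" for x using T S by (simp_all add: bounded_ops_iff)
  define A where "A = (1/2) *\<^sub>R (T + S)"
  define B where "B = (1/2) *\<^sub>R (imag_op \<circ>\<^sub>L (S - T))"
  have "conj_real C A"
    by (rule conj_realI)
      (simp_all add: A_def blinfun.bilinear_simps i scaleC_add_right scaleC_scaleR_commute ad ad' TC
        conj_add conj_scaleR C inner_add_left inner_add_right add.commute)
  moreover have "conj_real C B"
    by (rule conj_realI)
      (simp_all add: B_def blinfun.bilinear_simps i complex_vector.scale_right_diff_distrib scaleC_scaleR_commute ad ad' TC
        conj_add conj_diff conj_scaleR conj_imag C inner_diff_left inner_diff_right inner_imag_left)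
  moreover have "T = A + imag_op \<circ>\<^sub>L B"
  proof (rule blinfun_eqI)
    fix x
    have "(A + imag_op \<circ>\<^sub>L B) x = (1/2) *\<^sub>R (T x + S x) - (1/2) *\<^sub>R (S x - T x)"
      by (simp add: A_def B_def blinfun.bilinear_simps scaleC_scaleR_commute imag_imag scaleR_minus_right[symmetric]
          complex_vector.scale_right_diff_distrib del: scaleR_minus_right)
    also have "\<dots> = (1/2) *\<^sub>R (T x + T x)" by (simp add: algebra_simps)
    finally show "T x = (A + imag_op \<circ>\<^sub>L B) x" by (simp flip: scaleR_2)
  qed
  ultimately show ?thesis using C by blast
qed

lemma norm_imag_compose: "norm (imag_op \<circ>\<^sub>L (B :: 'a::complex_inner \<Rightarrow>\<^sub>L 'a)) \<le> norm B"
  by (rule norm_blinfun_bound) (auto simp: norm_scaleC norm_blinfun)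

text \<open>P is selfadjoint, so it commutes with the adjoint A - iB as well; the sum and the
  difference of the two relations separate A from B.\<close>

lemma projection_commutes_parts:
  fixes A B P :: "'a::complex_hilbert_space \<Rightarrow>\<^sub>L 'a"
  assumes C: "conjugation C" and A: "conj_real C A" and B: "conj_real C B"
    and P: "orthogonal_projection P" and PT: "P o\<^sub>L (A + imag_op \<circ>\<^sub>L B) = (A + imag_op \<circ>\<^sub>L B) o\<^sub>L P"
  shows "P (A x) = A (P x)" "P (B x) = B (P x)"
proof -
  have Pi: "P (\<i> *\<^sub>C x) = \<i> *\<^sub>C P x" and Ps: "inner (P x) y = inner x (P y)" for x y
    using P by (auto simp: orthogonal_projection_iff bounded_ops_iff symmetric_op_def)
  have 1: "P (A x) + \<i> *\<^sub>C P (B x) = A (P x) + \<i> *\<^sub>C B (P x)" for x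
    using arg_cong[OF PT, of "\<lambda>T. blinfun_apply T x"] by (simp add: blinfun.bilinear_simps Pi)
  have 2: "P (A x) - \<i> *\<^sub>C P (B x) = A (P x) - \<i> *\<^sub>C B (P x)" for x
  proof -
    have "inner y (P (A x) - \<i> *\<^sub>C P (B x)) = inner y (A (P x) - \<i> *\<^sub>C B (P x))" for y
      using arg_cong[OF 1[of y], of "\<lambda>z. inner z x"]
      by (simp add: inner_add_left inner_diff_right inner_imag_left Ps conj_realD(2)[OF A] conj_realD(2)[OF B]
          flip: Pi conj_realD(1)[OF B])
    then show ?thesis using vector_eq_ldot by blast
  qed
  have "2 *\<^sub>R P (A x) = 2 *\<^sub>R A (P x)" unfolding scaleR_2 using 1[of x] 2[of x]
    by (metis (no_types, lifting) add_diff_cancel_left' diff_add_cancel add_diff_eq diff_diff_eq2 add.commute)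
  then show *: "P (A x) = A (P x)" by simp
  have "\<i> *\<^sub>C \<i> *\<^sub>C P (B x) = \<i> *\<^sub>C \<i> *\<^sub>C B (P x)" using 1[of x] * by simp
  then show "P (B x) = B (P x)" by (simp add: imag_imag)
qed

section \<open>Density of the irreducible operators\<close>

text \<open>\<open>rank_one u v x\<close> is \<open>cinner x v *\<^sub>C u\<close>, written with the real inner product.\<close>

definition rank_one :: "'a::complex_inner \<Rightarrow> 'a \<Rightarrow> 'a \<Rightarrow>\<^sub>L 'a" where
  "rank_one u v = Blinfun (\<lambda>x. inner x v *\<^sub>R u + inner x (\<i> *\<^sub>C v) *\<^sub>R (\<i> *\<^sub>C u))"

lemma rank_one_apply: "rank_one u v x = inner x v *\<^sub>R u + inner x (\<i> *\<^sub>C v) *\<^sub>R (\<i> *\<^sub>C u)"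
  unfolding rank_one_def
  by (subst bounded_linear_Blinfun_apply) (intro bounded_linear_intros refl)+

lemma norm_rank_one: "norm (rank_one u v) \<le> 2 * norm u * norm v"
proof (rule norm_blinfun_bound)
  fix x
  have "norm (rank_one u v x) \<le> \<bar>inner x v\<bar> * norm u + \<bar>inner x (\<i> *\<^sub>C v)\<bar> * norm u"
    unfolding rank_one_apply by (rule norm_triangle_le) (simp add: norm_scaleC)
  also have "\<dots> \<le> (norm x * norm v) * norm u + (norm x * norm v) * norm u"
    using Cauchy_Schwarz_ineq2[of x v] Cauchy_Schwarz_ineq2[of x "\<i> *\<^sub>C v"]
    by (intro add_mono mult_right_mono) (simp_all add: norm_scaleC)
  finally show "norm (rank_one u v x) \<le> 2 * norm u * norm v * norm x" by (simp add: algebra_simps)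
qed simp

lemma rank_one_adjoint: "inner (rank_one u v x) y = inner x (rank_one v u y)"
  by (simp add: rank_one_apply inner_add_left inner_add_right inner_commute mult.commute)

text \<open>C is symmetric, fixes u and turns i v into -i v, so this number is its own negative:
  complex inner products of C-fixed vectors are real.\<close>

lemma conj_real_inner_imag:
  assumes C: "conjugation C" and "C u = u" "C v = v"
  shows "inner u (\<i> *\<^sub>C v) = 0"
proof -
  have "inner u (\<i> *\<^sub>C v) = inner (C u) (\<i> *\<^sub>C v)" by (simp add: assms)
  also have "\<dots> = - inner u (\<i> *\<^sub>C v)" by (simp add: conj_inner[OF C] conj_imag[OF C] assms(3))
  finally show ?thesis by simp
qed

lemma conj_real_rank_one_sym:
  assumes C: "conjugation C" and "C u = u" "C v = v"
  shows "conj_real C (rank_one u v + rank_one v u)"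
proof (rule conj_realI)
  fix x y
  show "inner ((rank_one u v + rank_one v u) x) y = inner x ((rank_one u v + rank_one v u) y)"
    by (simp add: blinfun.add_left inner_add_left inner_add_right rank_one_adjoint)
  show "(rank_one u v + rank_one v u) (\<i> *\<^sub>C x) = \<i> *\<^sub>C (rank_one u v + rank_one v u) x"
    by (simp add: blinfun.add_left rank_one_apply inner_imag_left inner_imag_both imag_imag scaleC_add_right
       scaleC_scaleR_commute algebra_simps)
  have "inner (C x) u = inner x u" "inner (C x) v = inner x v"
    "inner (C x) (\<i> *\<^sub>C u) = - inner x (\<i> *\<^sub>C u)" "inner (C x) (\<i> *\<^sub>C v) = - inner x (\<i> *\<^sub>C v)"
    by (simp_all add: conj_inner[OF C] assms conj_imag[OF C])
  then show "(rank_one u v + rank_one v u) (C x) = C ((rank_one u v + rank_one v u) x)"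
    by (simp add: blinfun.add_left rank_one_apply conj_add[OF C] conj_scaleR[OF C] conj_imag[OF C] assms)
qed

text \<open>Zero entries let the natural numbers index bases of finite-dimensional spaces too, and
  families in which some vectors degenerate.\<close>

definition orthonormal_or_zero :: "(nat \<Rightarrow> 'a::real_inner) \<Rightarrow> bool" where
  "orthonormal_or_zero e \<longleftrightarrow> (\<forall>m n. m \<noteq> n \<longrightarrow> inner (e m) (e n) = 0) \<and> (\<forall>n. e n = 0 \<or> norm (e n) = 1)"

text \<open>Distinct members are at distance sqrt 2, so points of a countable dense set chosen
  within 1/2 of them are distinct.\<close>

lemma orthonormal_countable:
  fixes E :: "'a::real_inner set"
  assumes sep: "separable_space (euclidean :: 'a topology)"
    and orth: "\<And>x y. x \<in> E \<Longrightarrow> y \<in> E \<Longrightarrow> x \<noteq> y \<Longrightarrow> inner x y = 0" and unit: "\<And>x. x \<in> E \<Longrightarrow> norm x = 1"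
  shows "countable E"
proof -
  obtain S :: "'a set" where S: "countable S" "closure S = UNIV"
    using sep by (auto simp: separable_space_def)
  have "\<exists>s\<in>S. dist s x < 1/2" for x
  proof -
    have "x \<in> closure S" using S(2) by simp
    then show ?thesis using closure_approachable[of x S] half_gt_zero[OF zero_less_one] by blast
  qed
  then obtain f where f: "\<And>x. f x \<in> S" "\<And>x. dist (f x) x < 1/2" by metis
  have "inj_on f E"
  proof (rule inj_onI, rule ccontr)
    fix x y assume xy: "x \<in> E" "y \<in> E" "f x = f y" "x \<noteq> y"
    have "dist x y < 1" using f(2)[of x] f(2)[of y] xy(3) dist_triangle2[of x y "f x"] 
      by (simp add: dist_commute)
    moreover have "(dist x y)\<^sup>2 = 2"
      using orth[OF xy(1,2,4)] unit xy
      by (simp add: dist_norm power2_norm_eq_inner inner_diff_left inner_diff_right inner_commute)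
        (simp add: flip: power2_norm_eq_inner)
    moreover have "(dist x y)\<^sup>2 \<le> 1\<^sup>2" using calculation(1) by (intro power_mono) auto
    ultimately show False by simp
  qed
  moreover have "countable (f ` E)" using S(1) f(1) countable_subset[of "f ` E" S] by blast
  ultimately show ?thesis using countable_image_inj_on by blast
qed

lemma countable_orthonormal_sequence:
  fixes E :: "'a::real_inner set"
  assumes "countable E"
    and orth: "\<And>x y. x \<in> E \<Longrightarrow> y \<in> E \<Longrightarrow> x \<noteq> y \<Longrightarrow> inner x y = 0" and unit: "\<And>x. x \<in> E \<Longrightarrow> norm x = 1"
  shows "\<exists>e. orthonormal_or_zero e \<and> range e \<subseteq> E \<union> {0} \<and> E \<subseteq> range e"
proof -
  define e where "e n = (if n \<in> to_nat_on E ` E then from_nat_into E n else 0)" for n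
  have inj: "inj_on (to_nat_on E) E" using assms(1) by (rule inj_on_to_nat_on)
  have e1: "e (to_nat_on E x) = x" if "x \<in> E" for x using that assms(1) by (simp add: e_def)
  have e2: "\<exists>x\<in>E. n = to_nat_on E x \<and> e n = x" if "e n \<noteq> 0" for n
    using that e1 by (auto simp: e_def split: if_splits)
  have "inner (e m) (e n) = 0" if "m \<noteq> n" for m n
  proof (cases "e m = 0 \<or> e n = 0")
    case False
    then obtain x y where "x \<in> E" "y \<in> E" "e m = x" "e n = y" "m = to_nat_on E x" "n = to_nat_on E y"
      using e2 by metis
    then show ?thesis using orth that by auto
  qed auto
  moreover have "e n = 0 \<or> norm (e n) = 1" for n using e2 unit by metis
  moreover have "range e \<subseteq> E \<union> {0}" using e2 by auto
  moreover have "E \<subseteq> range e" using e1 by (metis rangeI subsetI)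
  ultimately show ?thesis unfolding orthonormal_or_zero_def by blast
qed

text \<open>Zorn gives a maximal orthonormal set E of C-fixed eigenvectors. An eigenvector y in its
  complex orthogonal complement V yields y + C y and i y + C (i y), which vanish by maximality;
  hence y = 0. The projection onto V commutes with D, so it sends eigenvectors to eigenvectors in V,
  that is to 0, and the eigenvectors span the space. The case D = 0 supplies real orthonormal
  bases.\<close>

lemma real_eigenbasis_exists:
  fixes D :: "'a::complex_hilbert_space \<Rightarrow>\<^sub>L 'a"
  assumes sep: "separable_space (euclidean :: 'a topology)"
    and C: "conjugation C" and D: "conj_real C D" and eig: "span {y. \<exists>t. D y = t *\<^sub>R y} = UNIV"
  shows "\<exists>e t. orthonormal_or_zero e \<and> (\<forall>n. C (e n) = e n) \<and> (\<forall>n. D (e n) = t n *\<^sub>R e n) \<and>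
    (\<forall>x. (\<forall>n. inner x (e n) = 0 \<and> inner x (\<i> *\<^sub>C e n) = 0) \<longrightarrow> x = 0)"
proof -
  define good where "good y \<longleftrightarrow> C y = y \<and> norm y = 1 \<and> (\<exists>t. D y = t *\<^sub>R y)" for y
  define \<F> where "\<F> = {E. (\<forall>x\<in>E. good x) \<and> (\<forall>x\<in>E. \<forall>y\<in>E. x \<noteq> y \<longrightarrow> inner x y = 0)}"
  have "\<exists>E\<in>\<F>. \<forall>X\<in>\<F>. E \<subseteq> X \<longrightarrow> X = E"
  proof (rule subset_Zorn_nonempty)
    show "\<F> \<noteq> {}" unfolding \<F>_def by blast
    show "\<Union>\<C> \<in> \<F>" if "\<C> \<noteq> {}" "subset.chain \<F> \<C>" for \<C>
    proof -
      have sub: "\<C> \<subseteq> \<F>" and ch: "\<And>X Y. X \<in> \<C> \<Longrightarrow> Y \<in> \<C> \<Longrightarrow> X \<subseteq> Y \<or> Y \<subseteq> X"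
        using that(2) by (auto simp: subset_chain_def)
      have "inner x y = 0" if "X \<in> \<C>" "x \<in> X" "Y \<in> \<C>" "y \<in> Y" "x \<noteq> y" for x y X Y
        using ch[OF that(1,3)] sub that unfolding \<F>_def by blast
      then show ?thesis using sub unfolding \<F>_def by blast
    qed
  qed
  then obtain E where E: "E \<in> \<F>" and max: "\<And>X. X \<in> \<F> \<Longrightarrow> E \<subseteq> X \<Longrightarrow> X = E" by blast
  have good: "good x" if "x \<in> E" for x using E that by (simp add: \<F>_def)
  have orth: "inner x y = 0" if "x \<in> E" "y \<in> E" "x \<noteq> y" for x y using E that by (simp add: \<F>_def)
  define V where "V = {x. \<forall>e\<in>E. inner x e = 0 \<and> inner x (\<i> *\<^sub>C e) = 0}"
  have subV: "subspace V"
    by (auto simp: subspace_def V_def inner_add_left)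
  have "V = (\<Inter>e\<in>E. {x. inner x e = 0} \<inter> {x. inner x (\<i> *\<^sub>C e) = 0})" by (auto simp: V_def)
  also have "closed \<dots>"
    by (intro closed_INT ballI closed_Int closed_Collect_eq continuous_intros)
  finally obtain Q where Q: "is_projection_onto Q V" using projection_exists[OF subV] by blast
  have DV: "D x \<in> V" if "x \<in> V" for x
    unfolding V_def
  proof (intro CollectI ballI)
    fix e assume e: "e \<in> E"
    then obtain t where "D e = t *\<^sub>R e" using good by (auto simp: good_def)
    then show "inner (D x) e = 0 \<and> inner (D x) (\<i> *\<^sub>C e) = 0"
      using that e by (simp add: V_def conj_realD(2)[OF D] conj_realD(1)[OF D] scaleC_scaleR_commute)
  qed
  have CV: "C x \<in> V" if "x \<in> V" for x
    using that good by (simp add: V_def conj_inner[OF C] conj_imag[OF C] good_def)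
  have iV: "\<i> *\<^sub>C x \<in> V" if "x \<in> V" for x
    using that by (simp add: V_def inner_imag_left inner_imag_both imag_imag)
  have QD: "Q (D x) = D (Q x)" for x
    by (rule projection_comm[OF Q DV DV]) (use conj_realD(2)[OF D] in auto)
  have Qi: "Q (\<i> *\<^sub>C x) = \<i> *\<^sub>C Q x" for x
    using projection_comm[OF Q, of imag_op "\<lambda>x. - (\<i> *\<^sub>C x)" x] iV subV
    by (simp add: inner_imag_left subspace_neg)
  have real0: "y + C y = 0" if y: "y \<in> V" "D y = t *\<^sub>R y" for y t
  proof (rule ccontr)
    assume ne: "y + C y \<noteq> 0"
    define z where "z = (1 / norm (y + C y)) *\<^sub>R (y + C y)"
    have zV: "z \<in> V" unfolding z_def using y CV subV by (intro subspace_scale subspace_add)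
    have nz: "norm z = 1" using ne by (simp add: z_def)
    have "D (y + C y) = t *\<^sub>R (y + C y)"
      using y by (simp add: blinfun.add_right conj_realD(3)[OF D] conj_scaleR[OF C] scaleR_add_right)
    then have "D z = t *\<^sub>R z" by (simp add: z_def blinfun.scaleR_right)
    moreover have "C z = z"
      by (simp add: z_def conj_scaleR[OF C] conj_add[OF C] conj_conj[OF C] add.commute)
    ultimately have "good z" using nz by (auto simp: good_def)
    moreover have "inner z e = 0" if "e \<in> E" for e using zV that by (simp add: V_def)
    ultimately have "insert z E \<in> \<F>" using E by (auto simp: \<F>_def inner_commute)
    then have "z \<in> E" using max[of "insert z E"] by auto
    then have "inner z z = 0" using zV by (simp add: V_def)
    then show False using nz by auto
  qed
  have Q0: "Q y = 0" if "D y = t *\<^sub>R y" for y t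
  proof -
    have QV: "Q y \<in> V" using Q by (simp add: is_projection_onto_def)
    have e1: "D (Q y) = t *\<^sub>R Q y" using that by (simp add: blinfun.scaleR_right flip: QD)
    have e2: "D (\<i> *\<^sub>C Q y) = t *\<^sub>R (\<i> *\<^sub>C Q y)" by (simp add: conj_realD(1)[OF D] e1 scaleC_scaleR_commute)
    have 1: "Q y + C (Q y) = 0" by (rule real0[OF QV e1])
    have "\<i> *\<^sub>C Q y - \<i> *\<^sub>C C (Q y) = 0" using real0[OF iV[OF QV] e2] by (simp add: conj_imag[OF C])
    then have "\<i> *\<^sub>C \<i> *\<^sub>C Q y = \<i> *\<^sub>C \<i> *\<^sub>C C (Q y)" by simp
    then have "Q y = C (Q y)" by (simp add: imag_imag)
    with 1 have "2 *\<^sub>R Q y = 0" by (simp add: scaleR_2)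
    then show ?thesis by simp
  qed
  have "subspace {y. Q y = 0}" by (auto simp: subspace_def blinfun.add_right blinfun.scaleR_right)
  then have "span {y. \<exists>t. D y = t *\<^sub>R y} \<subseteq> {y. Q y = 0}" by (intro span_minimal) (use Q0 in auto)
  then have Qz: "Q x = 0" for x using eig by auto
  have V0: "x = 0" if "x \<in> V" for x using that Q Qz[of x] by (simp add: is_projection_onto_def)
  have "countable E" by (rule orthonormal_countable[OF sep orth]) (use good in \<open>auto simp: good_def\<close>)
  then obtain e where e: "orthonormal_or_zero e" "range e \<subseteq> E \<union> {0}" "E \<subseteq> range e"
    using countable_orthonormal_sequence[of E] orth good unfolding good_def by blast
  have "C 0 = 0" using conj_scaleR[OF C, of 0] by simp
  then have "C (e n) = e n" for n using e(2) good by (force simp: good_def)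
  moreover have "\<exists>t. D (e n) = t *\<^sub>R e n" for n
    using e(2) good[of "e n"] by (cases "e n = 0") (auto simp: good_def)
  then obtain t where "\<And>n. D (e n) = t n *\<^sub>R e n" by metis
  moreover have "x = 0" if "\<forall>n. inner x (e n) = 0 \<and> inner x (\<i> *\<^sub>C e n) = 0" for x
  proof (rule V0)
    have "\<exists>n. y = e n" if "y \<in> E" for y using e(3) that by auto
    with that show "x \<in> V" unfolding V_def by fastforce
  qed
  ultimately show ?thesis using e(1) by (intro exI[of _ e] exI[of _ t]) auto
qed

lemma orthonormal_or_zero_norm_le: "orthonormal_or_zero e \<Longrightarrow> norm (e n) \<le> 1"
  unfolding orthonormal_or_zero_def by (metis norm_zero order_refl zero_le_one)

lemma sums_orthonormal_or_zero:
  assumes "orthonormal_or_zero e"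
  shows "(\<lambda>n. w n *\<^sub>R inner (e m) (e n) *\<^sub>R e n) sums (w m *\<^sub>R e m)"
proof -
  have "w n *\<^sub>R inner (e m) (e n) *\<^sub>R e n = (if n = m then w n *\<^sub>R e n else 0)" for n
    using assms by (cases "e n = 0") (auto simp: orthonormal_or_zero_def simp flip: power2_norm_eq_inner)
  then show ?thesis using sums_single[of m "\<lambda>n. w n *\<^sub>R e n"] by simp
qed

text \<open>A small multiple of K, whose eigenvalues are pairwise distinct, will separate the
  eigenvalues of a diagonal operator. The bound 4 is the sum of the bounds
  \<open>2 * (1/2)^n\<close> of the summands.\<close>

lemma weighted_diagonal_operator:
  fixes e :: "nat \<Rightarrow> 'a::complex_hilbert_space"
  assumes C: "conjugation C" and e: "orthonormal_or_zero e" "\<And>n. C (e n) = e n"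
  shows "\<exists>K. conj_real C K \<and> norm K \<le> 4 \<and> (\<forall>m. K (e m) = (1/2)^m *\<^sub>R e m)"
proof -
  define f where "f n = (1/2::real)^n *\<^sub>R rank_one (e n) (e n)" for n
  have nf: "norm (f n) \<le> 2 * (1/2)^n" for n
  proof -
    have "norm (e n) * norm (e n) \<le> 1 * 1"
      by (intro mult_mono orthonormal_or_zero_norm_le[OF e(1)]) auto
    then have "norm (rank_one (e n) (e n)) \<le> 2" using norm_rank_one[of "e n" "e n"] by simp
    then show ?thesis by (simp add: f_def power_divide divide_right_mono)
  qed
  have sg: "summable (\<lambda>n. 2 * (1/2::real)^n)" by (intro summable_mult summable_geometric) simp
  have sf: "summable f" by (rule summable_comparison_test'[OF sg, of 0]) (use nf in auto)
  define K where "K = suminf f"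
  have K: "f sums K" using sf by (simp add: K_def summable_sums)
  have rf: "conj_real C (f n)" for n
  proof -
    have "f n = ((1/2)^n * (1/2)) *\<^sub>R (rank_one (e n) (e n) + rank_one (e n) (e n))"
      by (simp add: f_def flip: scaleR_2)
    then show ?thesis using conj_real_scaleR[OF C conj_real_rank_one_sym[OF C e(2) e(2)]] by simp
  qed
  have "conj_real C K"
    by (rule conj_real_lim[OF C K[unfolded sums_def]]) (rule conj_real_sum[OF C rf])
  moreover have "norm K \<le> (\<Sum>n. 2 * (1/2::real)^n)"
    unfolding K_def by (rule norm_suminf_le[OF nf sg])
  then have "norm K \<le> 4" by (simp add: suminf_mult suminf_geometric)
  moreover have "K (e m) = (1/2)^m *\<^sub>R e m" for m
  proof (rule sums_unique2)
    show "(\<lambda>n. f n (e m)) sums K (e m)"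
      by (rule bounded_linear.sums[OF blinfun.bounded_linear_left K])
    have "f n (e m) = (1/2)^n *\<^sub>R inner (e m) (e n) *\<^sub>R e n" for n
      by (simp add: f_def rank_one_apply blinfun.scaleR_left conj_real_inner_imag[OF C e(2) e(2)])
    then show "(\<lambda>n. f n (e m)) sums ((1/2)^m *\<^sub>R e m)"
      using sums_orthonormal_or_zero[OF e(1), of "\<lambda>n. (1/2)^n" m] by simp
  qed
  ultimately show ?thesis by blast
qed

text \<open>A C-fixed vector with a nonzero coefficient at every nonzero \<open>e m\<close>; paired
  with one basis vector it gives the rank-two perturbation of B.\<close>

lemma weighted_vector:
  fixes e :: "nat \<Rightarrow> 'a::complex_hilbert_space"
  assumes C: "conjugation C" and e: "orthonormal_or_zero e" "\<And>n. C (e n) = e n"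
  shows "\<exists>f. C f = f \<and> norm f \<le> 2 \<and> (\<forall>m. inner f (e m) = (1/2)^m * inner (e m) (e m))"
proof -
  define g where "g n = (1/2::real)^n *\<^sub>R e n" for n
  have ng: "norm (g n) \<le> (1/2)^n" for n
    using orthonormal_or_zero_norm_le[OF e(1), of n] by (simp add: g_def)
  have sg: "summable (\<lambda>n. (1/2::real)^n)" by (intro summable_geometric) simp
  have sf: "summable g" by (rule summable_comparison_test'[OF sg, of 0]) (use ng in auto)
  define f where "f = suminf g"
  have f: "g sums f" using sf by (simp add: f_def summable_sums)
  have "norm f \<le> (\<Sum>n. (1/2::real)^n)" unfolding f_def by (rule norm_suminf_le[OF ng sg])
  then have "norm f \<le> 2" by (simp add: suminf_geometric)
  moreover have "C f = f"
  proof (rule sums_unique2[OF _ f])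
    show "g sums C f" using bounded_linear.sums[OF conj_bounded_linear[OF C] f]
      by (simp add: g_def[abs_def] conj_scaleR[OF C] e(2))
  qed
  moreover have "inner f (e m) = (1/2)^m * inner (e m) (e m)" for m
  proof (rule sums_unique2)
    show "(\<lambda>n. inner (g n) (e m)) sums inner f (e m)"
      by (rule bounded_linear.sums[OF bounded_linear_inner_left f])
    have "inner (g n) (e m) = (if n = m then (1/2)^n * inner (e n) (e n) else 0)" for n
      using e(1) by (auto simp: g_def orthonormal_or_zero_def)
    then show "(\<lambda>n. inner (g n) (e m)) sums ((1/2)^m * inner (e m) (e m))"
      using sums_single[of m "\<lambda>n. (1/2)^n * inner (e n) (e n)"] by simp
  qed
  ultimately show ?thesis by blast
qed

text \<open>A' has simple eigenvalues, so a commuting P is diagonal in e. B' couples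
  \<open>e m0\<close> with every other nonzero basis vector, so all diagonal entries of P equal
  \<open>p m0\<close>, and P P = P leaves only 0 and 1 for it.\<close>

lemma irreducible_perturbation:
  fixes D B :: "'a::complex_hilbert_space \<Rightarrow>\<^sub>L 'a"
  assumes sep: "separable_space (euclidean :: 'a topology)" and C: "conjugation C"
    and D: "conj_real C D" and eig: "span {y. \<exists>t. D y = t *\<^sub>R y} = UNIV"
    and B: "conj_real C B" and \<delta>: "\<delta> > 0"
  shows "\<exists>A' B'. conj_real C A' \<and> conj_real C B' \<and> norm (A' - D) \<le> \<delta> \<and> norm (B' - B) \<le> \<delta> \<and>
     irreducible_op (A' + imag_op \<circ>\<^sub>L B')"
proof -
  obtain e t where e: "orthonormal_or_zero e" "\<And>n. C (e n) = e n" and De: "\<And>n. D (e n) = t n *\<^sub>R e n"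
    and total: "\<And>x. (\<And>n. inner x (e n) = 0 \<and> inner x (\<i> *\<^sub>C e n) = 0) \<Longrightarrow> x = 0"
    using real_eigenbasis_exists[OF sep C D eig] by metis
  have en: "inner (e n) (e n) = 1" if "e n \<noteq> 0" for n
    using e(1) that by (auto simp: orthonormal_or_zero_def simp flip: power2_norm_eq_inner)
  have eo: "inner (e m) (e n) = 0" if "m \<noteq> n" for m n using e(1) that by (auto simp: orthonormal_or_zero_def)
  have eJ: "inner (e m) (\<i> *\<^sub>C e n) = 0" for m n by (rule conj_real_inner_imag[OF C e(2) e(2)])
  obtain K where K: "conj_real C K" "norm K \<le> 4" "\<And>m. K (e m) = (1/2)^m *\<^sub>R e m"
    using weighted_diagonal_operator[OF C e] by blast
  obtain f where f: "C f = f" "norm f \<le> 2" "\<And>m. inner f (e m) = (1/2)^m * inner (e m) (e m)"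
    using weighted_vector[OF C e] by blast
  \<comment> \<open>The values of l for which \<tau> m = \<tau> n with m \<noteq> n; pairs m = n
    contribute only 0 / 0 = 0, while l is positive. The bound \<open>\<delta>/4\<close> matches
    \<open>norm K \<le> 4\<close>.\<close>
  define bad where "bad = (\<lambda>(m, n). (t n - t m) / ((1/2)^m - (1/2)^n)) ` (UNIV :: (nat \<times> nat) set)"
  have "countable bad" unfolding bad_def by (intro countable_image) simp
  then obtain l where l: "0 < l" "l < \<delta>/4" "l \<notin> bad"
    using real_interval_avoid_countable_set[of 0 "\<delta>/4" bad] \<delta> by auto
  define A' where "A' = D + l *\<^sub>R K"
  have A': "conj_real C A'" unfolding A'_def by (intro conj_real_add conj_real_scaleR C D K)
  have nA: "norm (A' - D) \<le> \<delta>"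
  proof -
    have "norm (A' - D) = l * norm K" using l by (simp add: A'_def)
    also have "\<dots> \<le> (\<delta>/4) * 4" using l K by (intro mult_mono) auto
    finally show ?thesis by simp
  qed
  define \<tau> where "\<tau> n = t n + l * (1/2)^n" for n
  have A'e: "A' (e n) = \<tau> n *\<^sub>R e n" for n
    by (simp add: A'_def \<tau>_def blinfun.add_left blinfun.scaleR_left De K(3) scaleR_add_left)
  have \<tau>: "\<tau> m \<noteq> \<tau> n" if "m \<noteq> n" for m n
  proof
    assume "\<tau> m = \<tau> n"
    then have "l * ((1/2)^m - (1/2)^n) = t n - t m" by (simp add: \<tau>_def algebra_simps)
    moreover have "(1/2::real)^m - (1/2)^n \<noteq> 0" using that by (simp add: power_one_over)
    ultimately have "l = (t n - t m) / ((1/2)^m - (1/2)^n)" by (simp add: eq_divide_eq)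
    then have "l \<in> bad" unfolding bad_def by force
    with l show False by simp
  qed
  show ?thesis
  proof (cases "\<exists>m. e m \<noteq> 0")
    \<comment> \<open>All \<open>e n\<close> vanish only in the zero space, where 0 is the only
      operator.\<close>
    case False
    then have "x = 0" for x :: 'a using total[of x] complex_vector.scale_zero_right by auto
    then have "P = 0" for P :: "'a \<Rightarrow>\<^sub>L 'a" by (intro blinfun_eqI) metis
    then show ?thesis using A' B nA \<delta>
      by (intro exI[of _ A'] exI[of _ B]) (auto simp: irreducible_op_def)
  next
    case True
    then obtain m0 where m0: "e m0 \<noteq> 0" by blast
    \<comment> \<open>Adding u R changes the n-th coefficient of \<open>B (e m0)\<close> by
      \<open>u * (1/2)^n\<close> for n \<noteq> m0, so each n excludes one value of u;
      \<open>\<delta>/8\<close> matches \<open>norm R \<le> 8\<close>.\<close>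
    define bad2 where "bad2 = range (\<lambda>n. - inner (B (e m0)) (e n) / (1/2)^n)"
    have "countable bad2" unfolding bad2_def by (intro countable_image) simp
    then obtain u where u: "0 < u" "u < \<delta>/8" "u \<notin> bad2"
      using real_interval_avoid_countable_set[of 0 "\<delta>/8" bad2] \<delta> by auto
    define R where "R = rank_one f (e m0) + rank_one (e m0) f"
    have R: "conj_real C R" unfolding R_def by (rule conj_real_rank_one_sym[OF C f(1) e(2)])
    have nR: "norm R \<le> 8"
    proof -
      have "norm (e m0) = 1" using e(1) m0 by (auto simp: orthonormal_or_zero_def)
      then show ?thesis
        using norm_rank_one[of f "e m0"] norm_rank_one[of "e m0" f] f(2)
          norm_triangle_ineq[of "rank_one f (e m0)" "rank_one (e m0) f"] by (simp add: R_def)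
    qed
    define B' where "B' = B + u *\<^sub>R R"
    have B': "conj_real C B'" unfolding B'_def by (intro conj_real_add conj_real_scaleR C B R)
    have nB: "norm (B' - B) \<le> \<delta>"
    proof -
      have "norm (B' - B) = u * norm R" using u by (simp add: B'_def)
      also have "\<dots> \<le> (\<delta>/8) * 8" using u nR by (intro mult_mono) auto
      finally show ?thesis by simp
    qed
    have B'e: "inner (B' (e m0)) (e n) \<noteq> 0" if "e n \<noteq> 0" "n \<noteq> m0" for n
    proof
      assume "inner (B' (e m0)) (e n) = 0"
      moreover have "inner (B' (e m0)) (e n) = inner (B (e m0)) (e n) + u * (1/2)^n"
        using that en[OF m0] en[OF that(1)] conj_real_inner_imag[OF C e(2) f(1)]
        by (simp add: B'_def R_def rank_one_apply blinfun.add_left blinfun.scaleR_left inner_add_left eo eJ f(3))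
      ultimately have "u = - inner (B (e m0)) (e n) / (1/2)^n" by (simp add: field_simps)
      then have "u \<in> bad2" unfolding bad2_def by blast
      with u show False by simp
    qed
    have "irreducible_op (A' + imag_op \<circ>\<^sub>L B')"
      unfolding irreducible_op_def
    proof (intro allI impI, elim conjE)
      fix P :: "'a \<Rightarrow>\<^sub>L 'a"
      assume P: "orthogonal_projection P" and comm: "P o\<^sub>L (A' + imag_op \<circ>\<^sub>L B') = (A' + imag_op \<circ>\<^sub>L B') o\<^sub>L P"
      have PA: "P (A' x) = A' (P x)" and PB: "P (B' x) = B' (P x)" for x
        using projection_commutes_parts[OF C A' B' P comm] by auto
      have Pi: "P (\<i> *\<^sub>C x) = \<i> *\<^sub>C P x" and Ps: "inner (P x) y = inner x (P y)" and PP: "P (P x) = P x" for x y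
        using P by (auto simp: orthogonal_projection_iff bounded_ops_iff symmetric_op_def)
      define p where "p m = inner (P (e m)) (e m)" for m
      \<comment> \<open>P commutes with A', so its matrix entries between different eigenvalues
        vanish, also against \<open>\<i> *\<^sub>C e n\<close>.\<close>
      have orth: "inner (P (e m)) (e n) = 0 \<and> inner (P (e m)) (\<i> *\<^sub>C e n) = 0" if "m \<noteq> n" for m n
      proof -
        have "\<tau> m * inner (P (e m)) y = inner (A' (P (e m))) y" for y
          by (simp add: A'e blinfun.scaleR_right flip: PA)
        then have "\<tau> m * inner (P (e m)) y = inner (P (e m)) (A' y)" for y
          by (simp add: conj_realD(2)[OF A'])
        from this[of "e n"] this[of "\<i> *\<^sub>C e n"] show ?thesis
          using \<tau>[OF that] by (simp add: A'e conj_realD(1)[OF A'] scaleC_scaleR_commute)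
      qed
      have Pe: "P (e m) = p m *\<^sub>R e m" for m
      proof -
        \<comment> \<open>This is the imaginary part of \<open>cinner (P (e m)) (e m)\<close>, which
          is real because P is selfadjoint.\<close>
        have JJ: "inner (P (e m)) (\<i> *\<^sub>C e m) = 0"
        proof -
          have "inner (P (e m)) (\<i> *\<^sub>C e m) = inner (e m) (\<i> *\<^sub>C P (e m))" by (simp add: Ps Pi)
          also have "\<dots> = - inner (P (e m)) (\<i> *\<^sub>C e m)"
            by (metis inner_commute inner_imag_left)
          finally show ?thesis by simp
        qed
        have "P (e m) - p m *\<^sub>R e m = 0"
        proof (rule total)
          fix n
          show "inner (P (e m) - p m *\<^sub>R e m) (e n) = 0 \<and> inner (P (e m) - p m *\<^sub>R e m) (\<i> *\<^sub>C e n) = 0"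
            using orth[of m n] en[of m] JJ by (cases "m = n"; cases "e m = 0") (auto simp: inner_diff_left eo eJ p_def)
        qed
        then show ?thesis by simp
      qed
      have pc: "P (e n) = p m0 *\<^sub>R e n" for n
      proof (cases "e n = 0 \<or> n = m0")
        case False
        have "inner (P (B' (e m0))) (e n) = p n * inner (B' (e m0)) (e n)" by (simp add: Ps Pe)
        moreover have "inner (P (B' (e m0))) (e n) = p m0 * inner (B' (e m0)) (e n)"
          by (simp add: PB Pe blinfun.scaleR_right)
        ultimately have "p n = p m0" using B'e[of n] False by simp
        then show ?thesis by (simp add: Pe)
      qed (auto simp: Pe)
      have Px: "P x = p m0 *\<^sub>R x" for x
      proof -
        have "P x - p m0 *\<^sub>R x = 0"
          by (rule total) (simp add: inner_diff_left Ps pc Pi scaleC_scaleR_commute)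
        then show ?thesis by simp
      qed
      then have "(p m0 * p m0) *\<^sub>R e m0 = p m0 *\<^sub>R e m0" using PP[of "e m0"] by simp
      then have "p m0 * p m0 = p m0" using m0 by (metis scaleR_right_imp_eq)
      then have "p m0 = 0 \<or> p m0 = 1" by simp
      then show "P = 0 \<or> P = id_blinfun" using Px by (auto intro!: blinfun_eqI)
    qed
    then show ?thesis using A' B' nA nB by blast
  qed
qed

lemma CSO_subset_closure_ICSO:
  assumes sep: "separable_space (euclidean :: 'a::complex_hilbert_space topology)"
  shows "(CSO :: ('a \<Rightarrow>\<^sub>L 'a) set) \<subseteq> closure ICSO"
proof
  fix T :: "'a \<Rightarrow>\<^sub>L 'a" assume "T \<in> CSO"
  then obtain C A B where C: "conjugation C" and A: "conj_real C A" and B: "conj_real C B"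
    and T: "T = A + imag_op \<circ>\<^sub>L B" using CSO_decomposition by blast
  show "T \<in> closure ICSO"
    unfolding closure_approachable
  proof (intro allI impI)
    fix \<epsilon> :: real assume \<epsilon>: "\<epsilon> > 0"
    define M where "M = norm A + 1"
    have M: "M > 0" "norm A \<le> M" by (simp_all add: M_def add_nonneg_pos)
    obtain n where "(1/2::real)^n < \<epsilon> / 4 / M" using real_arch_pow_inv[of "\<epsilon>/4/M" "1/2"] \<epsilon> M by auto
    then have n: "M / 2^n \<le> \<epsilon>/4" using M by (simp add: field_simps power_divide)
    obtain D where D: "symmetric_op D" "norm (A - D) \<le> M / 2 ^ n" "span {y. \<exists>t. D y = t *\<^sub>R y} = UNIV"
      and Dc: "\<And>S. sigma_symmetric S \<Longrightarrow> S o\<^sub>L A = A o\<^sub>L S \<Longrightarrow> S o\<^sub>L D = D o\<^sub>L S"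
      using diagonal_approximation[OF conj_realD(4)[OF A] M(2,1), of n] by blast
    \<comment> \<open>The commutation clause for multiplication by i and for C turns the real-linear
      D into a C-real operator.\<close>
    have "imag_op o\<^sub>L D = D o\<^sub>L imag_op"
      by (rule Dc[OF sigma_symmetric_imag]) (rule blinfun_eqI, simp add: conj_realD(1)[OF A])
    then have Di: "D (\<i> *\<^sub>C x) = \<i> *\<^sub>C D x" for x
      by (metis blinfun_apply_blinfun_compose imag_op_apply)
    define K where "K = Blinfun C"
    have K: "K x = C x" for x by (simp add: K_def bounded_linear_Blinfun_apply conj_bounded_linear[OF C])
    have "sigma_symmetric K" by (rule sigma_symmetric_of_symmetric) (simp add: symmetric_op_def K conj_inner[OF C])
    then have "K o\<^sub>L D = D o\<^sub>L K"
      by (rule Dc) (rule blinfun_eqI, simp add: K conj_realD(3)[OF A])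
    then have "D (C x) = C (D x)" for x by (metis blinfun_apply_blinfun_compose K)
    with D Di have Dr: "conj_real C D" by (intro conj_realI) (auto simp: symmetric_op_def)
    obtain A' B' where 1: "conj_real C A'" "conj_real C B'" "norm (A' - D) \<le> \<epsilon>/4" "norm (B' - B) \<le> \<epsilon>/4"
      "irreducible_op (A' + imag_op \<circ>\<^sub>L B')"
      using irreducible_perturbation[OF sep C Dr D(3) B, of "\<epsilon>/4"] \<epsilon> by auto
    have mem: "A' + imag_op \<circ>\<^sub>L B' \<in> ICSO"
      using combination_in_CSO[OF C 1(1,2)] 1(5) by (simp add: ICSO_def)
    have "A' + imag_op \<circ>\<^sub>L B' - T = (A' - D) + (D - A) + imag_op \<circ>\<^sub>L (B' - B)"
      by (simp add: T compose_arith)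
    also have "norm \<dots> \<le> norm (A' - D) + norm (D - A) + norm (B' - B)"
      by (intro norm_triangle_mono norm_imag_compose order_refl)
    also have "\<dots> \<le> \<epsilon>/4 + \<epsilon>/4 + \<epsilon>/4"
      using 1 order_trans[OF D(2) n] by (intro add_mono) (auto simp: norm_minus_commute)
    also have "\<dots> < \<epsilon>" using \<epsilon> by simp
    finally show "\<exists>S\<in>ICSO. dist S T < \<epsilon>" using mem by (auto simp: dist_norm)
  qed
qed

section \<open>Finite dimension\<close>

lemma simultaneously_convergent_subsequence:
  fixes f :: "nat \<Rightarrow> nat \<Rightarrow> real"
  assumes "\<And>k. bounded (range (\<lambda>n. f n k))"
  shows "\<exists>r. strict_mono r \<and> (\<forall>k. convergent (\<lambda>n. f (r n) k))"
proof -
  interpret subseqs "\<lambda>k s. convergent (\<lambda>n. f (s n) k)"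
  proof
    fix k and s :: "nat \<Rightarrow> nat"
    have "bounded (range (\<lambda>n. f (s n) k))" by (rule bounded_subset[OF assms[of k]]) auto
    then obtain l r where "strict_mono r" "((\<lambda>n. f (s n) k) \<circ> r) \<longlonglongrightarrow> l"
      using bounded_imp_convergent_subsequence by blast
    then show "\<exists>r'. strict_mono r' \<and> convergent (\<lambda>n. f ((s \<circ> r') n) k)"
      by (auto simp: o_def convergent_def)
  qed
  have "convergent (\<lambda>n. f (diagseq n) k)" for k
  proof -
    \<comment> \<open>Only from index Suc k on is the diagonal sequence a subsequence of the one
      chosen for k.\<close>
    have "convergent (\<lambda>n. f ((diagseq \<circ> (+) (Suc k)) n) k)"
    proof (rule diagseq_holds)
      fix r s :: "nat \<Rightarrow> nat" and n assume "strict_mono r" "convergent (\<lambda>m. f (s m) n)"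
      then show "convergent (\<lambda>m. f ((s \<circ> r) m) n)"
        using convergent_subseq_convergent[of "\<lambda>m. f (s m) n" r] by (simp add: o_def)
    qed
    then have "convergent (\<lambda>n. f (diagseq (n + Suc k)) k)" by (simp add: o_def add.commute)
    then show ?thesis using convergent_ignore_initial_segment[of "\<lambda>n. f (diagseq n) k" "Suc k"] by simp
  qed
  then show ?thesis using subseq_diagseq by blast
qed

text \<open>B together with i B spans over the reals, and orthogonalising gives real coordinates;
  they suit conjugations, which are only real-linear.\<close>

lemma finite_cdim_orthonormal:
  assumes "finite_cdim TYPE('a::complex_hilbert_space)"
  shows "\<exists>E :: 'a set. finite E \<and> (\<forall>x. x = (\<Sum>e\<in>E. inner x e *\<^sub>R e))"
proof -
  obtain B :: "'a set" where B: "finite B" "complex_vector.span B = UNIV"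
    using assms by (auto simp: finite_cdim_def)
  define B' where "B' = B \<union> (\<lambda>x. \<i> *\<^sub>C x) ` B"
  have i: "\<i> *\<^sub>C x \<in> span B'" if "x \<in> span B'" for x
    using that
  proof (induction rule: span_induct_alt)
    case base
    then show ?case by (simp add: span_zero)
  next
    case (step c x y)
    have "\<i> *\<^sub>C x \<in> span B'"
    proof (cases "x \<in> B")
      case True
      then show ?thesis by (auto simp: B'_def intro: span_base)
    next
      case False
      then obtain z where "z \<in> B" "x = \<i> *\<^sub>C z" using step by (auto simp: B'_def)
      then show ?thesis by (auto simp: B'_def imag_imag intro: span_neg span_base)
    qed
    with step show ?case by (simp add: scaleC_add_right scaleC_scaleR_commute span_add span_scale)
  qed
  have "c *\<^sub>C x \<in> span B'" if "x \<in> span B'" for c x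
    by (subst scaleC_decomp) (intro span_add span_scale i that)
  then have "complex_vector.subspace (span B')"
    by (auto simp: complex_vector.subspace_def span_zero span_add)
  then have "complex_vector.span B \<subseteq> span B'"
    by (intro complex_vector.span_minimal) (auto simp: B'_def intro: span_base)
  then have UB: "span B' = UNIV" using B by auto
  have "finite B'" using B by (simp add: B'_def)
  from basis_orthogonal[OF this]
  obtain D where "finite D \<and> card D \<le> card B' \<and> span D = span B' \<and> pairwise orthogonal D" ..
  then have D: "finite D" "span D = UNIV" "pairwise orthogonal D" using UB by simp_all
  define E where "E = (\<lambda>x. (1 / norm x) *\<^sub>R x) ` (D - {0})"
  have E1: "inner e e = 1" if "e \<in> E" for e
  proof -
    have "norm e = 1" using that by (auto simp: E_def split: if_splits)
    then show ?thesis by (simp flip: power2_norm_eq_inner)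
  qed
  have E2: "inner e f = 0" if "e \<in> E" "f \<in> E" "e \<noteq> f" for e f
  proof -
    obtain x y where xy: "x \<in> D" "y \<in> D" "e = (1 / norm x) *\<^sub>R x" "f = (1 / norm y) *\<^sub>R y"
      using \<open>e \<in> E\<close> \<open>f \<in> E\<close> by (auto simp: E_def)
    then have "inner x y = 0" using D(3) \<open>e \<noteq> f\<close> by (auto simp: pairwise_def orthogonal_def)
    then show ?thesis by (simp add: xy)
  qed
  have fE: "finite E" using D by (simp add: E_def)
  have "x = (\<Sum>e\<in>E. inner x e *\<^sub>R e)" for x
  proof -
    define p where "p = x - (\<Sum>e\<in>E. inner x e *\<^sub>R e)"
    have pe: "inner e p = 0" if "e \<in> E" for e
    proof -
      have "inner e (\<Sum>f\<in>E. inner x f *\<^sub>R f) = (\<Sum>f\<in>E. if f = e then inner x e else 0)"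
        unfolding inner_sum_right by (rule sum.cong) (use E1 E2 that in auto)
      also have "\<dots> = inner x e" using fE that by simp
      finally show ?thesis by (simp add: p_def inner_diff_right inner_commute)
    qed
    have "inner d p = 0" if "d \<in> D" for d
    proof (cases "d = 0")
      case False
      then have "inner ((1 / norm d) *\<^sub>R d) p = 0" using that by (intro pe) (auto simp: E_def)
      then show ?thesis using False by simp
    qed simp
    then have "D \<subseteq> {d. inner d p = 0}" by blast
    moreover have "subspace {d. inner d p = 0}" by (auto simp: subspace_def inner_add_left)
    ultimately have "span D \<subseteq> {d. inner d p = 0}" by (rule span_minimal)
    then have "p \<in> {d. inner d p = 0}" using D(2) by blast
    then show ?thesis by (simp add: p_def)
  qed
  with fE show ?thesis by blast
qed

text \<open>Stated for real-linear contractions so that it serves conjugations and projections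
  alike. The matrix entries are bounded, and in finite dimension their convergence is pointwise
  convergence.\<close>

lemma finite_cdim_pointwise_subsequence:
  fixes F :: "nat \<Rightarrow> 'a::complex_hilbert_space \<Rightarrow> 'a"
  assumes "finite_cdim TYPE('a)" and lin: "\<And>n. linear (F n)" and bd: "\<And>n x. norm (F n x) \<le> norm x"
  shows "\<exists>r L. strict_mono r \<and> (\<forall>x. (\<lambda>n. F (r n) x) \<longlonglongrightarrow> L x)"
proof -
  obtain E :: "'a set" where E: "finite E" "\<And>x. x = (\<Sum>e\<in>E. inner x e *\<^sub>R e)"
    using finite_cdim_orthonormal[OF assms(1)] by blast
  define f where "f n k = inner (F n (from_nat_into E (fst (prod_decode k)))) (from_nat_into E (snd (prod_decode k)))" for n k
  have "bounded (range (\<lambda>n. f n k))" for k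
    unfolding bounded_iff
  proof (intro exI ballI)
    fix y assume "y \<in> range (\<lambda>n. f n k)"
    then obtain n where "y = f n k" by blast
    then show "norm y \<le> norm (from_nat_into E (fst (prod_decode k))) * norm (from_nat_into E (snd (prod_decode k)))"
      unfolding f_def real_norm_def
      by (auto intro!: order_trans[OF Cauchy_Schwarz_ineq2] mult_right_mono bd)
  qed
  then obtain r where r: "strict_mono r" "\<And>k. convergent (\<lambda>n. f (r n) k)"
    using simultaneously_convergent_subsequence[of f] by blast
  have c: "convergent (\<lambda>n. inner (F (r n) e) e')" if ee: "e \<in> E" "e' \<in> E" for e e'
  proof -
    obtain i j where "from_nat_into E i = e" "from_nat_into E j = e'"
      using ee E(1) by (meson countable_finite from_nat_into_surj)
    then show ?thesis using r(2)[of "prod_encode (i, j)"] by (simp add: f_def)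
  qed
  have "convergent (\<lambda>n. F (r n) x)" for x
  proof -
    have "F n x = (\<Sum>e'\<in>E. (\<Sum>e\<in>E. inner x e * inner (F n e) e') *\<^sub>R e')" for n
    proof -
      have "F n x = F n (\<Sum>e\<in>E. inner x e *\<^sub>R e)" using E(2)[of x] by simp
      also have "\<dots> = (\<Sum>e\<in>E. inner x e *\<^sub>R F n e)"
        by (simp add: linear_sum[OF lin] linear_scale[OF lin])
      finally show ?thesis by (subst E(2)) (simp add: inner_sum_left)
    qed
    then show ?thesis
      by (simp only:) (intro convergent_sum bounded_linear.convergent[OF bounded_linear_scaleR_left]
         bounded_linear.convergent[OF bounded_linear_mult_right] c)
  qed
  then show ?thesis using r(1) unfolding convergent_def by metis
qed

text \<open>Uniform contractivity allows pointwise limits to be composed, as in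
  \<open>C n (T n (C n y))\<close> or \<open>P n (P n x)\<close>.\<close>

lemma tendsto_isometric_apply:
  fixes x :: "'a::real_normed_vector"
  assumes "\<And>n y z. norm (F n y - F n z) \<le> norm (y - z)" and "(\<lambda>n. F n l) \<longlonglongrightarrow> m" "X \<longlonglongrightarrow> l"
  shows "(\<lambda>n. F n (X n)) \<longlonglongrightarrow> m"
proof -
  have "(\<lambda>n. F n (X n) - F n l) \<longlonglongrightarrow> 0"
  proof (rule Lim_null_comparison)
    show "\<forall>\<^sub>F n in sequentially. norm (F n (X n) - F n l) \<le> norm (X n - l)" using assms(1) by simp
    show "(\<lambda>n. norm (X n - l)) \<longlonglongrightarrow> 0" using assms(3) by (simp add: LIM_zero tendsto_norm_zero)
  qed
  from tendsto_add[OF this assms(2)] show ?thesis by simp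
qed


text \<open>Complex symmetry as an identity of inner products, free of \<open>adjoint_op\<close>; in
  this form it passes to limits.\<close>

lemma complex_symmetricI:
  fixes T :: "'a::complex_hilbert_space \<Rightarrow>\<^sub>L 'a"
  assumes T: "T \<in> bounded_ops" and C: "conjugation C" and s: "\<And>x y. inner (T x) y = inner x (C (T (C y)))"
  shows "T \<in> CSO"
proof -
  have "C (T (C y)) = adjoint_op T y" for y
    using s[of _ y] inner_adjoint_op[OF T, of _ y] by (metis vector_eq_ldot)
  then show ?thesis using T C unfolding CSO_def complex_symmetric_def by (auto simp: fun_eq_iff)
qed

lemma CSO_symmetricD:
  fixes T :: "'a::complex_hilbert_space \<Rightarrow>\<^sub>L 'a"
  assumes "T \<in> CSO"
  shows "\<exists>C. conjugation C \<and> (\<forall>x y. inner (T x) y = inner x (C (T (C y))))"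
proof -
  obtain C where C: "conjugation C" "C \<circ> blinfun_apply T \<circ> C = blinfun_apply (adjoint_op T)"
     and T: "T \<in> bounded_ops" using assms by (auto simp: CSO_def complex_symmetric_def)
  have "C (T (C y)) = adjoint_op T y" for y using C(2) by (metis comp_apply)
  then show ?thesis using C inner_adjoint_op[OF T] by auto
qed

lemma bounded_ops_lim:
  fixes T :: "nat \<Rightarrow> 'a::complex_inner \<Rightarrow>\<^sub>L 'a"
  assumes "T \<longlonglongrightarrow> S" "\<And>n. T n \<in> bounded_ops"
  shows "S \<in> bounded_ops"
  unfolding bounded_ops_iff
proof
  fix x
  have "(\<lambda>n. T n (\<i> *\<^sub>C x)) \<longlonglongrightarrow> S (\<i> *\<^sub>C x)" by (intro tendsto_intros assms(1))
  moreover have "(\<lambda>n. \<i> *\<^sub>C T n x) \<longlonglongrightarrow> \<i> *\<^sub>C S x"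
    by (intro bounded_linear.tendsto[OF bounded_linear_scaleC] tendsto_intros assms(1))
  ultimately show "S (\<i> *\<^sub>C x) = \<i> *\<^sub>C S x"
    using assms(2) by (auto simp: bounded_ops_iff intro: LIMSEQ_unique)
qed

lemma conjugation_pointwise_limit:
  fixes C :: "nat \<Rightarrow> 'a::complex_hilbert_space \<Rightarrow> 'a"
  assumes C: "\<And>n. conjugation (C n)" and L: "\<And>x. (\<lambda>n. C n x) \<longlonglongrightarrow> L x"
  shows "conjugation L"
  unfolding conjugation_def
proof (intro conjI allI)
  have iso: "norm (C n y - C n z) \<le> norm (y - z)" for n y z
    by (simp add: conj_norm[OF C] flip: conj_diff[OF C])
  fix x y :: 'a and c :: complex
  have "(\<lambda>n. C n (x + y)) \<longlonglongrightarrow> L x + L y"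
    unfolding conj_add[OF C] by (intro tendsto_intros L)
  then show "L (x + y) = L x + L y" using L LIMSEQ_unique by blast
  have "(\<lambda>n. C n (c *\<^sub>C x)) \<longlonglongrightarrow> cnj c *\<^sub>C L x"
    unfolding conj_scaleC[OF C] by (intro bounded_linear.tendsto[OF bounded_linear_scaleC] L)
  then show "L (c *\<^sub>C x) = cnj c *\<^sub>C L x" using L LIMSEQ_unique by blast
  have ci: "cinner (L u) (L v) = cinner v u" for u v
  proof -
    have r: "inner (L u) (L v) = inner v u" for u v
    proof (rule LIMSEQ_unique)
      show "(\<lambda>n. inner (C n u) (C n v)) \<longlonglongrightarrow> inner (L u) (L v)" by (intro tendsto_intros L)
      show "(\<lambda>n. inner (C n u) (C n v)) \<longlonglongrightarrow> inner v u"
        by (simp add: conj_inner[OF C] conj_conj[OF C] inner_commute)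
    qed
    \<comment> \<open>The argument is -i v because conjugate linearity then gives i C v; this
      reduces the complex identity for L to the real one.\<close>
    have "(\<lambda>n. C n (- (\<i> *\<^sub>C v))) \<longlonglongrightarrow> \<i> *\<^sub>C L v"
    proof -
      have "C n (- (\<i> *\<^sub>C v)) = \<i> *\<^sub>C C n v" for n
        using conj_scaleC[OF C, of n "-\<i>" v] by simp
      then show ?thesis by (simp add: bounded_linear.tendsto[OF bounded_linear_scaleC] L)
    qed
    then have Li: "\<i> *\<^sub>C L v = L (- (\<i> *\<^sub>C v))" using L LIMSEQ_unique by blast
    show ?thesis
      by (simp add: cinner_eq_inner r Li) (simp add: inner_imag_left)
  qed
  show "cinner (L x) (L y) = cinner y x" by (rule ci)
  have "L (L z) = z" for z
  proof (rule LIMSEQ_unique)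
    show "(\<lambda>n. C n (C n z)) \<longlonglongrightarrow> L (L z)" by (rule tendsto_isometric_apply[of C, OF iso L L])
    show "(\<lambda>n. C n (C n z)) \<longlonglongrightarrow> z" by (simp add: conj_conj[OF C])
  qed
  then show "L \<circ> L = id" by auto
qed

lemma CSO_sequentially_closed:
  fixes T :: "nat \<Rightarrow> 'a::complex_hilbert_space \<Rightarrow>\<^sub>L 'a"
  assumes fd: "finite_cdim TYPE('a)" and T: "\<And>n. T n \<in> CSO" and S: "T \<longlonglongrightarrow> S"
  shows "S \<in> CSO"
proof -
  have "S \<in> bounded_ops" by (rule bounded_ops_lim[OF S]) (use T in \<open>auto simp: CSO_def\<close>)
  obtain C where C: "\<And>n. conjugation (C n)" and TC: "\<And>n x y. inner (T n x) y = inner x (C n (T n (C n y)))"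
    using CSO_symmetricD[OF T] by metis
  obtain r L where r: "strict_mono r" and L: "\<And>x. (\<lambda>n. C (r n) x) \<longlonglongrightarrow> L x"
    using finite_cdim_pointwise_subsequence[OF fd, of C] C
    by (auto simp: conj_norm intro: bounded_linear.linear[OF conj_bounded_linear])
  have iso: "norm (C (r n) y - C (r n) z) \<le> norm (y - z)" for n y z
    by (simp add: conj_norm[OF C] flip: conj_diff[OF C])
  have Sr: "(\<lambda>n. T (r n)) \<longlonglongrightarrow> S" using LIMSEQ_subseq_LIMSEQ[OF S r] by (simp add: o_def)
  show ?thesis
  proof (rule complex_symmetricI[OF \<open>S \<in> bounded_ops\<close>])
    show "conjugation L" by (rule conjugation_pointwise_limit[OF C L])
    show "inner (S x) y = inner x (L (S (L y)))" for x y
    proof (rule LIMSEQ_unique)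
      show "(\<lambda>n. inner (T (r n) x) y) \<longlonglongrightarrow> inner (S x) y"
        by (intro tendsto_intros Sr)
      show "(\<lambda>n. inner (T (r n) x) y) \<longlonglongrightarrow> inner x (L (S (L y)))"
        unfolding TC
        by (intro tendsto_intros tendsto_isometric_apply[of "\<lambda>n. C (r n)", OF iso L] Sr L)
    qed
  qed
qed

text \<open>For a unit vector u in the range, 1 is the sum of the squares of inner u e = inner u (P
  e), hence at most the sum of |P e|^2, the real trace. Unlike P \<noteq> 0 the inequality survives
  limits; applied to 1 - P it excludes the identity.\<close>

lemma projection_trace_ge_1:
  fixes P :: "'a::complex_hilbert_space \<Rightarrow>\<^sub>L 'a"
  assumes E: "finite E" "\<And>x. x = (\<Sum>e\<in>E. inner x e *\<^sub>R e)"
    and P: "orthogonal_projection P" "P \<noteq> 0"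
  shows "(\<Sum>e\<in>E. inner (P e) e) \<ge> 1"
proof -
  have Ps: "inner (P x) y = inner x (P y)" "P (P x) = P x" for x y
    using P by (auto simp: orthogonal_projection_iff symmetric_op_def)
  obtain x where x: "P x \<noteq> 0" using P(2) by (metis blinfun_eqI zero_blinfun.rep_eq)
  define u where "u = (1 / norm (P x)) *\<^sub>R P x"
  have u: "P u = u" "norm u = 1" using x by (simp_all add: u_def blinfun.scaleR_right Ps)
  have "1 = inner u u" using u by (simp flip: power2_norm_eq_inner)
  also have "\<dots> = inner (\<Sum>e\<in>E. inner u e *\<^sub>R e) u" using E(2)[of u] by simp
  also have "\<dots> = (\<Sum>e\<in>E. (inner u e)\<^sup>2)"
    by (simp add: inner_sum_left power2_eq_square) (simp add: inner_commute)
  also have "\<dots> \<le> (\<Sum>e\<in>E. inner (P e) e)"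
  proof (rule sum_mono)
    fix e
    have "inner u e = inner u (P e)" using u Ps(1)[of u e] by simp
    then have "\<bar>inner u e\<bar> \<le> norm (P e)" using Cauchy_Schwarz_ineq2[of u "P e"] u by simp
    then have "(inner u e)\<^sup>2 \<le> (norm (P e))\<^sup>2" by (metis abs_ge_zero power2_abs power_mono)
    also have "\<dots> = inner (P e) e" using Ps(1)[of e "P e"] Ps(2)[of e] by (simp add: power2_norm_eq_inner inner_commute)
    finally show "(inner u e)\<^sup>2 \<le> inner (P e) e" .
  qed
  finally show ?thesis .
qed

lemma orthogonal_projection_norm_le:
  fixes P :: "'a::complex_hilbert_space \<Rightarrow>\<^sub>L 'a"
  assumes "orthogonal_projection P"
  shows "norm (P x) \<le> norm x"
proof -
  have Ps: "inner (P x) y = inner x (P y)" "P (P x) = P x" for x y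
    using assms by (auto simp: orthogonal_projection_iff symmetric_op_def)
  have "(norm (P x))\<^sup>2 = inner x (P x)" by (simp add: power2_norm_eq_inner Ps)
  also have "\<dots> \<le> norm x * norm (P x)" by (rule norm_cauchy_schwarz)
  finally show ?thesis by (cases "norm (P x) = 0") (auto simp: power2_eq_square)
qed

lemma orthogonal_projection_complement:
  fixes P :: "'a::complex_hilbert_space \<Rightarrow>\<^sub>L 'a"
  shows "orthogonal_projection P \<Longrightarrow> orthogonal_projection (id_blinfun - P)"
  by (auto simp: orthogonal_projection_iff bounded_ops_iff blinfun.bilinear_simps complex_vector.scale_right_diff_distrib
     intro!: symmetric_op_arith symmetric_op_id)

lemma RCSO_sequentially_closed:
  fixes T :: "nat \<Rightarrow> 'a::complex_hilbert_space \<Rightarrow>\<^sub>L 'a"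
  assumes fd: "finite_cdim TYPE('a)" and T: "\<And>n. T n \<in> RCSO" and S: "T \<longlonglongrightarrow> S"
  shows "S \<in> RCSO"
proof -
  have SC: "S \<in> CSO" by (rule CSO_sequentially_closed[OF fd _ S]) (use T in \<open>auto simp: RCSO_def\<close>)
  have "\<exists>P. orthogonal_projection P \<and> P o\<^sub>L T n = T n o\<^sub>L P \<and> P \<noteq> 0 \<and> P \<noteq> id_blinfun" for n
    using T[of n] by (auto simp: RCSO_def irreducible_op_def)
  then obtain P where P: "\<And>n. orthogonal_projection (P n)" and PT: "\<And>n. P n o\<^sub>L T n = T n o\<^sub>L P n"
    and nt: "\<And>n. P n \<noteq> 0" "\<And>n. P n \<noteq> id_blinfun" by metis
  have PTx: "P n (T n x) = T n (P n x)" for n x using PT by (metis blinfun_apply_blinfun_compose)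
  have Pn: "norm (P n x) \<le> norm x" for n x by (rule orthogonal_projection_norm_le[OF P])
  obtain r L where r: "strict_mono r" and L: "\<And>x. (\<lambda>n. P (r n) x) \<longlonglongrightarrow> L x"
    using finite_cdim_pointwise_subsequence[OF fd, of "\<lambda>n. blinfun_apply (P n)"] Pn
    by (auto intro: bounded_linear.linear blinfun.bounded_linear_right)
  have Sr: "(\<lambda>n. T (r n)) \<longlonglongrightarrow> S" using LIMSEQ_subseq_LIMSEQ[OF S r] by (simp add: o_def)
  have Pd: "norm (P (r n) y - P (r n) z) \<le> norm (y - z)" for n y z
    using Pn[of "r n" "y - z"] by (simp add: blinfun.diff_right)
  have "bounded_linear L"
  proof (rule bounded_linear_intro[where K=1])
    show "L (x + y) = L x + L y" for x y
    proof (rule LIMSEQ_unique[OF L])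
      show "(\<lambda>n. P (r n) (x + y)) \<longlonglongrightarrow> L x + L y" unfolding blinfun.add_right by (intro tendsto_intros L)
    qed
    show "L (c *\<^sub>R x) = c *\<^sub>R L x" for c x
    proof (rule LIMSEQ_unique[OF L])
      show "(\<lambda>n. P (r n) (c *\<^sub>R x)) \<longlonglongrightarrow> c *\<^sub>R L x" unfolding blinfun.scaleR_right by (intro tendsto_intros L)
    qed
    show "norm (L x) \<le> norm x * 1" for x
      by (rule LIMSEQ_le_const2[OF tendsto_norm[OF L]]) (use Pn in auto)
  qed
  then obtain Q where Q: "\<And>x. blinfun_apply Q x = L x" by (metis bounded_linear_Blinfun_apply)
  have Pp: "inner (P n x) y = inner x (P n y)" "P n (P n x) = P n x" "P n (\<i> *\<^sub>C x) = \<i> *\<^sub>C P n x" for n x y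
    using P[of n] by (auto simp: orthogonal_projection_iff symmetric_op_def bounded_ops_iff)
  have "orthogonal_projection Q"
    unfolding orthogonal_projection_iff bounded_ops_iff symmetric_op_def Q
  proof (intro conjI allI)
    fix x y
    show "L (\<i> *\<^sub>C x) = \<i> *\<^sub>C L x"
    proof (rule LIMSEQ_unique[OF L])
      show "(\<lambda>n. P (r n) (\<i> *\<^sub>C x)) \<longlonglongrightarrow> \<i> *\<^sub>C L x"
        unfolding Pp by (intro bounded_linear.tendsto[OF bounded_linear_scaleC] L)
    qed
    show "inner (L x) y = inner x (L y)"
    proof (rule LIMSEQ_unique)
      show "(\<lambda>n. inner (P (r n) x) y) \<longlonglongrightarrow> inner (L x) y" by (intro tendsto_intros L)
      show "(\<lambda>n. inner (P (r n) x) y) \<longlonglongrightarrow> inner x (L y)" unfolding Pp by (intro tendsto_intros L)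
    qed
    show "L (L x) = L x"
    proof (rule LIMSEQ_unique)
      show "(\<lambda>n. P (r n) (P (r n) x)) \<longlonglongrightarrow> L (L x)"
        by (rule tendsto_isometric_apply[of "\<lambda>n. blinfun_apply (P (r n))", OF Pd L L])
      show "(\<lambda>n. P (r n) (P (r n) x)) \<longlonglongrightarrow> L x" unfolding Pp by (rule L)
    qed
  qed
  moreover have "Q o\<^sub>L S = S o\<^sub>L Q"
  proof (rule blinfun_eqI)
    fix x
    have "L (S x) = S (L x)"
    proof (rule LIMSEQ_unique)
      show "(\<lambda>n. P (r n) (T (r n) x)) \<longlonglongrightarrow> L (S x)"
        by (rule tendsto_isometric_apply[of "\<lambda>n. blinfun_apply (P (r n))", OF Pd L]) (intro tendsto_intros Sr)
      show "(\<lambda>n. P (r n) (T (r n) x)) \<longlonglongrightarrow> S (L x)" unfolding PTx by (intro tendsto_intros Sr L)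
    qed
    then show "(Q o\<^sub>L S) x = (S o\<^sub>L Q) x" by (simp add: Q)
  qed
  moreover obtain E :: "'a set" where E: "finite E" "\<And>x. x = (\<Sum>e\<in>E. inner x e *\<^sub>R e)"
    using finite_cdim_orthonormal[OF fd] by blast
  have "Q \<noteq> 0"
  proof
    assume "Q = 0"
    then have L0: "L x = 0" for x using Q[of x] by simp
    have "1 \<le> (\<Sum>e\<in>E. inner (L e) e)"
    proof (rule LIMSEQ_le_const)
      show "(\<lambda>n. \<Sum>e\<in>E. inner (P (r n) e) e) \<longlonglongrightarrow> (\<Sum>e\<in>E. inner (L e) e)" by (intro tendsto_intros L)
    qed (use projection_trace_ge_1[OF E P nt(1)] in auto)
    then show False by (simp add: L0)
  qed
  moreover have "Q \<noteq> id_blinfun"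
  proof
    assume "Q = id_blinfun"
    then have L0: "L x = x" for x using Q[of x] by simp
    have "1 \<le> (\<Sum>e\<in>E. inner (e - L e) e)"
    proof (rule LIMSEQ_le_const)
      show "(\<lambda>n. \<Sum>e\<in>E. inner (e - P (r n) e) e) \<longlonglongrightarrow> (\<Sum>e\<in>E. inner (e - L e) e)" by (intro tendsto_intros L)
      have "1 \<le> (\<Sum>e\<in>E. inner (e - P n e) e)" for n
        using projection_trace_ge_1[OF E orthogonal_projection_complement[OF P[of n]]] nt(2)[of n]
        by (simp add: blinfun.diff_left)
      then show "\<exists>N. \<forall>n\<ge>N. 1 \<le> (\<Sum>e\<in>E. inner (e - P (r n) e) e)" by blast
    qed
    then show False by (simp add: L0)
  qed
  ultimately show ?thesis using SC by (auto simp: RCSO_def irreducible_op_def)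
qed

section \<open>Asymptotic orthogonalisation\<close>

text \<open>\<open>f k j\<close> will be word number k applied to the j-th vector of the weakly null
  sequence. Vectors of the limit representation are modelled by such sequences in j modulo null
  sequences, so neither a quotient nor a completion is formed.\<close>

locale asymptotic_system =
  fixes f :: "nat \<Rightarrow> nat \<Rightarrow> 'a::real_inner"
  assumes convergent_base: "\<And>k l. convergent (\<lambda>j. inner (f k j) (f l j))"
begin

inductive_set V :: "nat \<Rightarrow> (nat \<Rightarrow> 'a) set" for n where
  V_base: "k < n \<Longrightarrow> f k \<in> V n"
| V_zero: "(\<lambda>_. 0) \<in> V n"
| V_add: "g \<in> V n \<Longrightarrow> h \<in> V n \<Longrightarrow> (\<lambda>j. g j + h j) \<in> V n"
| V_scale: "g \<in> V n \<Longrightarrow> (\<lambda>j. c *\<^sub>R g j) \<in> V n"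

lemma V_mono: "g \<in> V m \<Longrightarrow> m \<le> n \<Longrightarrow> g \<in> V n"
  by (induction rule: V.induct) (auto intro: V.intros)

lemma V_sum: "(\<And>l. l \<in> I \<Longrightarrow> g l \<in> V n) \<Longrightarrow> (\<lambda>j. \<Sum>l\<in>I. g l j) \<in> V n"
  by (induction I rule: infinite_finite_induct) (auto intro: V.intros)

lemma V_diff: "g \<in> V n \<Longrightarrow> h \<in> V n \<Longrightarrow> (\<lambda>j. g j - h j) \<in> V n"
  using V_add[OF _ V_scale[of h n "-1"], of g] by simp

lemma V_convergent:
  assumes "g \<in> V m" "h \<in> V n"
  shows "convergent (\<lambda>j. inner (g j) (h j))"
  using assms(1)
proof (induction rule: V.induct)
  case (V_base k)
  show ?case using assms(2)
  proof (induction rule: V.induct)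
    case (V_base l)
    show ?case by (rule convergent_base)
  qed (auto simp: inner_add_right intro: convergent_add convergent_mult convergent_const)
qed (auto simp: inner_add_left convergent_const intro: convergent_add convergent_mult)

text \<open>The semi-inner product of the limit representation; below, \<open>q\<close> is the Gram-Schmidt family of
  \<open>f\<close> for it, where residuals of length zero are replaced by the zero sequence. The value of \<open>ip\<close>
  is meaningful only on \<open>W\<close>, where the limits exist.\<close>

definition ip :: "(nat \<Rightarrow> 'a) \<Rightarrow> (nat \<Rightarrow> 'a) \<Rightarrow> real" where
  "ip g h = lim (\<lambda>j. inner (g j) (h j))"

definition W :: "(nat \<Rightarrow> 'a) set" where "W = (\<Union>n. V n)"

lemma V_W: "g \<in> V n \<Longrightarrow> g \<in> W" by (auto simp: W_def)

lemma ip_tendsto: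
  "g \<in> W \<Longrightarrow> h \<in> W \<Longrightarrow> (\<lambda>j. inner (g j) (h j)) \<longlonglongrightarrow> ip g h"
  unfolding ip_def by (auto simp: W_def intro!: convergent_LIMSEQ_iff[THEN iffD1] V_convergent)

lemma W_intros [intro]:
  "(\<lambda>_. 0) \<in> W" "f k \<in> W" "g \<in> W \<Longrightarrow> (\<lambda>j. c *\<^sub>R g j) \<in> W"
  by (auto simp: W_def intro: V.intros lessI)

lemma W_add [intro]: "g \<in> W \<Longrightarrow> h \<in> W \<Longrightarrow> (\<lambda>j. g j + h j) \<in> W"
proof -
  assume "g \<in> W" "h \<in> W"
  then obtain m n where "g \<in> V m" "h \<in> V n" by (auto simp: W_def)
  then have "g \<in> V (max m n)" "h \<in> V (max m n)" by (auto intro: V_mono)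
  then show ?thesis by (auto simp: W_def intro: V_add)
qed

lemma W_sum: "(\<And>l. l \<in> I \<Longrightarrow> g l \<in> W) \<Longrightarrow> (\<lambda>j. \<Sum>l\<in>I. g l j) \<in> W"
  by (induction I rule: infinite_finite_induct) auto

lemma W_diff [intro]: "g \<in> W \<Longrightarrow> h \<in> W \<Longrightarrow> (\<lambda>j. g j - h j) \<in> W"
  using W_add[OF _ W_intros(3)[of h "-1"], of g] by simp

lemma ip_eqI: "(\<lambda>j. inner (g j) (h j)) \<longlonglongrightarrow> a \<Longrightarrow> ip g h = a"
  unfolding ip_def by (rule limI)

lemma ip_commute: "ip g h = ip h g"
  by (simp add: ip_def inner_commute)

lemma ip_scale_left: "g \<in> W \<Longrightarrow> h \<in> W \<Longrightarrow> ip (\<lambda>j. c *\<^sub>R g j) h = c * ip g h"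
  by (rule ip_eqI) (simp add: tendsto_mult_left ip_tendsto)

lemma ip_scale_right: "g \<in> W \<Longrightarrow> h \<in> W \<Longrightarrow> ip g (\<lambda>j. c *\<^sub>R h j) = c * ip g h"
  by (metis ip_commute ip_scale_left)

lemma ip_diff_left: "g \<in> W \<Longrightarrow> h \<in> W \<Longrightarrow> k \<in> W \<Longrightarrow> ip (\<lambda>j. g j - h j) k = ip g k - ip h k"
  by (rule ip_eqI) (simp add: inner_diff_left tendsto_diff ip_tendsto)

lemma ip_add_left: "g \<in> W \<Longrightarrow> h \<in> W \<Longrightarrow> k \<in> W \<Longrightarrow> ip (\<lambda>j. g j + h j) k = ip g k + ip h k"
  by (rule ip_eqI) (simp add: inner_add_left tendsto_add ip_tendsto)

lemma ip_zero [simp]: "ip (\<lambda>_. 0) h = 0" "ip h (\<lambda>_. 0) = 0"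
  by (rule ip_eqI, simp)+

lemma ip_sum_left:
  "(\<And>l. l \<in> I \<Longrightarrow> g l \<in> W) \<Longrightarrow> k \<in> W \<Longrightarrow> ip (\<lambda>j. \<Sum>l\<in>I. g l j) k = (\<Sum>l\<in>I. ip (g l) k)"
  by (rule ip_eqI) (auto simp: inner_sum_left intro!: tendsto_sum ip_tendsto)

lemma ip_ge_0: "g \<in> W \<Longrightarrow> ip g g \<ge> 0"
  by (rule LIMSEQ_le_const[OF ip_tendsto]) auto

text \<open>Cauchy-Schwarz in the limit. With \<open>null_of_ip_0\<close> it identifies the radical
  of \<open>ip\<close> on W with the null sequences.\<close>

lemma ip_null:
  assumes "g \<in> W" "h \<in> W" "g \<longlonglongrightarrow> 0"
  shows "ip g h = 0"
proof -
  have "(\<lambda>j. (inner (g j) (h j))\<^sup>2) \<longlonglongrightarrow> (ip g h)\<^sup>2" by (intro tendsto_intros ip_tendsto assms)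
  moreover have "(\<lambda>j. inner (g j) (g j) * inner (h j) (h j)) \<longlonglongrightarrow> inner (0::'a) 0 * ip h h"
    by (rule tendsto_mult[OF tendsto_inner[OF assms(3,3)] ip_tendsto[OF assms(2,2)]])
  ultimately have "(ip g h)\<^sup>2 \<le> inner (0::'a) 0 * ip h h"
    by (rule LIMSEQ_le) (simp add: Cauchy_Schwarz_ineq)
  then show ?thesis by simp
qed

lemma null_of_ip_0:
  assumes "g \<in> W" "ip g g = 0"
  shows "g \<longlonglongrightarrow> 0"
proof -
  have "(\<lambda>j. sqrt (inner (g j) (g j))) \<longlonglongrightarrow> sqrt 0"
    by (intro tendsto_real_sqrt) (metis assms ip_tendsto)
  then show ?thesis by (simp add: tendsto_norm_zero_iff flip: norm_eq_sqrt_inner)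
qed

fun q :: "nat \<Rightarrow> nat \<Rightarrow> 'a" where
  "q k = (let r = (\<lambda>j. f k j - (\<Sum>l<k. ip (f k) (q l) *\<^sub>R q l j)) in
     if ip r r = 0 then (\<lambda>_. 0) else (\<lambda>j. (1 / sqrt (ip r r)) *\<^sub>R r j))"

declare q.simps [simp del]

definition res :: "nat \<Rightarrow> nat \<Rightarrow> 'a" where
  "res k = (\<lambda>j. f k j - (\<Sum>l<k. ip (f k) (q l) *\<^sub>R q l j))"

lemma q_res: "q k = (if ip (res k) (res k) = 0 then (\<lambda>_. 0) else (\<lambda>j. (1 / sqrt (ip (res k) (res k))) *\<^sub>R res k j))"
  by (subst q.simps) (simp add: Let_def res_def)

lemma q_V: "q k \<in> V (Suc k)"
proof (induction k rule: less_induct)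
  case (less k)
  have "res k \<in> V (Suc k)"
    unfolding res_def
  proof (intro V_diff V_base V_sum V_scale)
    fix l assume "l \<in> {..<k}"
    then show "q l \<in> V (Suc k)" using less[of l] by (auto intro: V_mono)
  qed simp
  then show ?case by (simp add: q_res V_zero V_scale)
qed

lemma q_W [intro]: "q k \<in> W" using q_V V_W by blast

lemma res_W [intro]: "res k \<in> W"
  unfolding res_def by (intro W_diff W_intros W_sum q_W)

lemma q_unit: "ip (q k) (q k) = 1 \<or> q k = (\<lambda>_. 0)"
proof (cases "ip (res k) (res k) = 0")
  case False
  then have "ip (res k) (res k) > 0" using ip_ge_0[OF res_W, of k] by simp
  then show ?thesis
    by (simp add: q_res ip_scale_left ip_scale_right res_W W_intros(3))
qed (simp add: q_res)

lemma q_orthogonal_less: "m < k \<Longrightarrow> ip (q k) (q m) = 0"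
proof (induction k arbitrary: m rule: less_induct)
  case (less k)
  have orth: "ip (q l) (q m) = 0" if "l < k" "l \<noteq> m" for l
    using less.IH[of l m] less.IH[of m l] that less.prems ip_commute[of "q l" "q m"]
    by (cases l m rule: linorder_cases) auto
  have "ip (res k) (q m) = ip (f k) (q m) - (\<Sum>l<k. ip (f k) (q l) * ip (q l) (q m))"
    unfolding res_def by (subst ip_diff_left, (intro W_intros W_sum q_W)+)
      (simp add: ip_sum_left ip_scale_left q_W W_intros)
  also have "(\<Sum>l<k. ip (f k) (q l) * ip (q l) (q m)) = (\<Sum>l<k. if l = m then ip (f k) (q m) * ip (q m) (q m) else 0)"
    by (rule sum.cong) (use orth less.prems in auto)
  also have "\<dots> = ip (f k) (q m)" using less.prems q_unit[of m] by auto
  finally have "ip (res k) (q m) = 0" by simp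
  then show ?case by (simp add: q_res[of k] ip_scale_left res_W q_W)
qed

lemma q_orthogonal: "m \<noteq> k \<Longrightarrow> ip (q k) (q m) = 0"
  using q_orthogonal_less[of m k] q_orthogonal_less[of k m] ip_commute by (cases m k rule: linorder_cases) auto

text \<open>Only an asymptotic identity: where the residual has length zero, \<open>q k\<close> is
  the zero sequence and the residual itself, a null sequence, is left over.\<close>

lemma f_expansion: "(\<lambda>j. f k j - (\<Sum>l<Suc k. ip (f k) (q l) *\<^sub>R q l j)) \<longlonglongrightarrow> 0"
proof (cases "ip (res k) (res k) = 0")
  case True
  then have "(\<lambda>j. f k j - (\<Sum>l<Suc k. ip (f k) (q l) *\<^sub>R q l j)) = res k"
    by (auto simp: res_def q_res[of k])
  then show ?thesis using null_of_ip_0[OF res_W True] by simp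
next
  case False
  then have pos: "ip (res k) (res k) > 0" using ip_ge_0[OF res_W, of k] by simp
  define S where "S = (\<lambda>j. \<Sum>l<k. ip (f k) (q l) *\<^sub>R q l j)"
  have SW: "S \<in> W" unfolding S_def by (intro W_sum W_intros q_W)
  have "ip S (q k) = 0"
    unfolding S_def by (subst ip_sum_left, (intro W_intros q_W)+)
      (auto simp: ip_scale_left q_W q_orthogonal intro!: sum.neutral)
  moreover have "res k = (\<lambda>j. f k j - S j)" by (simp add: res_def S_def)
  then have "ip (res k) (q k) = ip (f k) (q k) - ip S (q k)"
    using ip_diff_left[OF W_intros(2) SW q_W] by simp
  moreover have "ip (res k) (q k) = sqrt (ip (res k) (res k))"
    using pos by (simp add: q_res ip_scale_right res_W real_div_sqrt)
  ultimately have "ip (f k) (q k) *\<^sub>R q k j = res k j" for j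
    using pos by (simp add: q_res)
  then have "f k j - (\<Sum>l<Suc k. ip (f k) (q l) *\<^sub>R q l j) = 0" for j by (simp add: res_def)
  then show ?thesis by simp
qed

text \<open>Up to a null sequence, which \<open>ip\<close> does not see, \<open>f k\<close> is a
  combination of q 0, ..., q k.\<close>

lemma f_orthogonal: "k < l \<Longrightarrow> ip (f k) (q l) = 0"
proof -
  assume kl: "k < l"
  define S where "S = (\<lambda>j. \<Sum>i<Suc k. ip (f k) (q i) *\<^sub>R q i j)"
  have SW: "S \<in> W" unfolding S_def by (intro W_sum W_intros q_W)
  have "ip S (q l) = 0"
    unfolding S_def by (subst ip_sum_left, (intro W_intros q_W)+)
      (use kl in \<open>auto simp: ip_scale_left q_W q_orthogonal intro!: sum.neutral\<close>)
  moreover have "ip (\<lambda>j. f k j - S j) (q l) = 0"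
    by (rule ip_null) (use f_expansion[of k] SW in \<open>auto simp: S_def\<close>)
  ultimately show ?thesis using ip_diff_left[OF W_intros(2) SW q_W, of k l] by simp
qed

lemma V_orthogonal:
  assumes "g \<in> V n" "n \<le> l"
  shows "ip g (q l) = 0"
  using assms(1)
proof (induction rule: V.induct)
  case (V_base k)
  then show ?case using f_orthogonal assms(2) by simp
qed (auto simp: ip_add_left ip_scale_left V_W q_W)

lemma V_expansion:
  assumes "g \<in> V n"
  shows "(\<lambda>j. g j - (\<Sum>l<n. ip g (q l) *\<^sub>R q l j)) \<longlonglongrightarrow> 0"
  using assms
proof (induction rule: V.induct)
  case (V_base k)
  have "(\<Sum>l<n. ip (f k) (q l) *\<^sub>R q l j) = (\<Sum>l<Suc k. ip (f k) (q l) *\<^sub>R q l j)" for j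
    by (rule sum.mono_neutral_right) (use V_base f_orthogonal in \<open>auto simp: not_less\<close>)
  then show ?case using f_expansion[of k] by simp
next
  case (V_add g h)
  have eq: "g j + h j - (\<Sum>l<n. ip (\<lambda>j. g j + h j) (q l) *\<^sub>R q l j) =
    (g j - (\<Sum>l<n. ip g (q l) *\<^sub>R q l j)) + (h j - (\<Sum>l<n. ip h (q l) *\<^sub>R q l j))" for j
    using V_add.hyps by (simp add: ip_add_left V_W q_W scaleR_add_left sum.distrib)
  show ?case unfolding eq using tendsto_add[OF V_add.IH] by simp
next
  case (V_scale g c)
  have eq: "c *\<^sub>R g j - (\<Sum>l<n. ip (\<lambda>j. c *\<^sub>R g j) (q l) *\<^sub>R q l j) =
    c *\<^sub>R (g j - (\<Sum>l<n. ip g (q l) *\<^sub>R q l j))" for j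
    using V_scale.hyps by (simp add: ip_scale_left V_W q_W scaleR_sum_right scaleR_diff_right)
  show ?case unfolding eq using tendsto_scaleR[OF tendsto_const[of c] V_scale.IH] by simp
qed simp

text \<open>Pythagoras for q, as an inequality because some \<open>q i\<close> may be the zero
  sequence.\<close>

lemma ip_square_sum:
  fixes c :: "nat \<Rightarrow> real"
  assumes "finite I"
  shows "ip (\<lambda>j. \<Sum>i\<in>I. c i *\<^sub>R q i j) (\<lambda>j. \<Sum>i\<in>I. c i *\<^sub>R q i j) \<le> (\<Sum>i\<in>I. (c i)\<^sup>2)"
proof -
  let ?g = "\<lambda>j. \<Sum>i\<in>I. c i *\<^sub>R q i j"
  have gW: "?g \<in> W" by (intro W_sum W_intros q_W)
  have 1: "ip (q i) ?g = c i * ip (q i) (q i)" if "i \<in> I" for i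
  proof -
    have "ip ?g (q i) = (\<Sum>l\<in>I. c l * ip (q l) (q i))"
      by (subst ip_sum_left, (intro W_intros q_W)+) (simp add: ip_scale_left q_W)
    also have "\<dots> = (\<Sum>l\<in>I. if l = i then c i * ip (q i) (q i) else 0)"
      by (rule sum.cong) (auto simp: q_orthogonal)
    also have "\<dots> = c i * ip (q i) (q i)" using that assms by simp
    finally show ?thesis by (simp add: ip_commute)
  qed
  have "ip ?g ?g = (\<Sum>l\<in>I. c l * ip (q l) ?g)"
    by (subst ip_sum_left, (intro W_intros q_W gW)+) (simp add: ip_scale_left q_W gW)
  also have "\<dots> = (\<Sum>i\<in>I. (c i)\<^sup>2 * ip (q i) (q i))" by (rule sum.cong) (auto simp: 1 power2_eq_square)
  also have "\<dots> \<le> (\<Sum>i\<in>I. (c i)\<^sup>2)"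
  proof (rule sum_mono)
    fix i show "(c i)\<^sup>2 * ip (q i) (q i) \<le> (c i)\<^sup>2" using q_unit[of i] by auto
  qed
  finally show ?thesis .
qed

lemma ip_bessel:
  assumes "finite I" "g \<in> W"
  shows "(\<Sum>k\<in>I. (ip g (q k))\<^sup>2) \<le> ip g g"
proof -
  let ?h = "\<lambda>j. \<Sum>i\<in>I. ip g (q i) *\<^sub>R q i j"
  have hW: "?h \<in> W" by (intro W_sum W_intros q_W)
  have gh: "ip ?h g = (\<Sum>k\<in>I. (ip g (q k))\<^sup>2)"
    by (subst ip_sum_left, (intro W_intros q_W assms)+)
      (simp add: ip_scale_left q_W assms power2_eq_square ip_commute[of g])
  define d where "d = (\<lambda>j. g j - ?h j)"
  have dW: "d \<in> W" unfolding d_def by (rule W_diff[OF assms(2) hW])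
  have d: "ip d k = ip g k - ip ?h k" if "k \<in> W" for k
    unfolding d_def by (rule ip_diff_left[OF assms(2) hW that])
  have "0 \<le> ip d d" by (rule ip_ge_0[OF dW])
  also have "ip d d = ip d g - ip d ?h"
    using d[OF dW] by (simp only: ip_commute[of g d] ip_commute[of ?h d])
  finally have "0 \<le> ip d g - ip d ?h" .
  then have "2 * ip ?h g \<le> ip g g + ip ?h ?h"
    using d[OF assms(2)] d[OF hW] ip_commute[of g ?h] by linarith
  then show ?thesis using ip_square_sum[OF assms(1), of "\<lambda>i. ip g (q i)"] gh by simp
qed

end

section \<open>From asymptotic to exact orthonormality\<close>

lemma Bseq_of_null_diff:
  fixes X Y :: "nat \<Rightarrow> 'a::real_normed_vector"
  assumes "(\<lambda>n. X n - Y n) \<longlonglongrightarrow> 0" "Bseq Y"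
  shows "Bseq X"
proof -
  have "Bseq (\<lambda>n. X n - Y n)" using assms(1) by (intro convergent_imp_Bseq convergentI)
  then obtain K K' where K: "\<And>n. norm (X n - Y n) \<le> K" "\<And>n. norm (Y n) \<le> K'"
    using assms(2) by (auto simp: Bseq_def)
  have "norm (X n) \<le> K + K'" for n
    using K[of n] norm_triangle_ineq[of "X n - Y n" "Y n"] by simp
  then show ?thesis by (rule BseqI')
qed

lemma scaleR_null_Bseq:
  fixes Y :: "nat \<Rightarrow> 'a::real_normed_vector"
  assumes "a \<longlonglongrightarrow> (0::real)" "Bseq Y"
  shows "(\<lambda>n. a n *\<^sub>R Y n) \<longlonglongrightarrow> 0"
  using bounded_bilinear.Zfun_prod_Bfun[OF bounded_bilinear_scaleR, of a sequentially Y] assms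
  by (simp add: tendsto_Zfun_iff)

lemma inner_Bseq_null:
  fixes Y :: "nat \<Rightarrow> 'a::real_inner"
  assumes "Bseq X" "Y \<longlonglongrightarrow> 0"
  shows "(\<lambda>n. inner (X n) (Y n)) \<longlonglongrightarrow> 0"
  using bounded_bilinear.Bfun_prod_Zfun[OF bounded_bilinear_inner, of X sequentially Y] assms
  by (simp add: tendsto_Zfun_iff)

text \<open>Gram-Schmidt at each index j, against G and the vectors already built: all subtracted
  coefficients tend to 0, so the new vectors stay asymptotic to q, while from some j on the
  relations are exact. Zero sequences are kept at zero and never normalised.\<close>

lemma exact_orthonormalisation:
  fixes q :: "nat \<Rightarrow> nat \<Rightarrow> 'a::real_inner"
  assumes R: "subspace R" and qR: "\<And>k j. q k j \<in> R"
    and G: "finite G" "G \<subseteq> R" "\<And>g h. g \<in> G \<Longrightarrow> h \<in> G \<Longrightarrow> inner g h = (if g = h then 1 else 0)"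
    and orth: "\<And>k l. k \<noteq> l \<Longrightarrow> (\<lambda>j. inner (q k j) (q l j)) \<longlonglongrightarrow> 0"
    and unit: "\<And>k. q k = (\<lambda>_. 0) \<or> (\<lambda>j. norm (q k j)) \<longlonglongrightarrow> 1"
    and weak: "\<And>k g. g \<in> G \<Longrightarrow> (\<lambda>j. inner (q k j) g) \<longlonglongrightarrow> 0"
  shows "\<exists>y. (\<forall>k<M. (\<lambda>j. y k j - q k j) \<longlonglongrightarrow> 0) \<and>
    (\<forall>\<^sub>F j in sequentially. \<forall>k<M. y k j \<in> R \<and> (if q k = (\<lambda>_. 0) then y k j = 0 else norm (y k j) = 1) \<and>
       (\<forall>l<M. l \<noteq> k \<longrightarrow> inner (y k j) (y l j) = 0) \<and> (\<forall>g\<in>G. inner (y k j) g = 0))"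
proof (induction M)
  case 0
  show ?case by auto
next
  case (Suc M)
  obtain y where y: "\<And>k. k < M \<Longrightarrow> (\<lambda>j. y k j - q k j) \<longlonglongrightarrow> 0"
    and ev: "\<forall>\<^sub>F j in sequentially. \<forall>k<M. y k j \<in> R \<and> (if q k = (\<lambda>_. 0) then y k j = 0 else norm (y k j) = 1) \<and>
       (\<forall>l<M. l \<noteq> k \<longrightarrow> inner (y k j) (y l j) = 0) \<and> (\<forall>g\<in>G. inner (y k j) g = 0)"
    using Suc.IH by blast
  define r where "r j = q M j - (\<Sum>g\<in>G. inner (q M j) g *\<^sub>R g) - (\<Sum>l<M. inner (q M j) (y l j) *\<^sub>R y l j)" for j
  define z where "z = (if q M = (\<lambda>_. 0) then (\<lambda>_. 0) else (\<lambda>j. (1 / norm (r j)) *\<^sub>R r j))"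
  have bq: "Bseq (\<lambda>j. q k j)" for k
    using unit[of k]
  proof
    assume "(\<lambda>j. norm (q k j)) \<longlonglongrightarrow> 1"
    then have "Bseq (\<lambda>j. norm (q k j))" by (intro convergent_imp_Bseq convergentI)
    then show ?thesis by (simp add: Bseq_def)
  qed (simp add: Bseq_def)
  have by_: "Bseq (\<lambda>j. y l j)" if "l < M" for l
    by (rule Bseq_of_null_diff[OF y[OF that] bq])
  have coef: "(\<lambda>j. inner (q M j) (y l j)) \<longlonglongrightarrow> 0" if "l < M" for l
  proof -
    have a: "(\<lambda>j. inner (q M j) (y l j - q l j)) \<longlonglongrightarrow> 0"
      by (rule inner_Bseq_null[OF bq y[OF that]])
    have b: "(\<lambda>j. inner (q M j) (q l j)) \<longlonglongrightarrow> 0" by (rule orth) (use that in simp)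
    have eq: "inner (q M j) (y l j) = inner (q M j) (y l j - q l j) + inner (q M j) (q l j)" for j
      by (simp add: inner_diff_right)
    show ?thesis unfolding eq using tendsto_add[OF a b] by simp
  qed
  have term0: "(\<lambda>j. inner (q M j) (y l j) *\<^sub>R y l j) \<longlonglongrightarrow> 0" if "l < M" for l
    by (rule scaleR_null_Bseq[OF coef[OF that] by_[OF that]])
  have rq: "(\<lambda>j. r j - q M j) \<longlonglongrightarrow> 0"
  proof -
    have a: "(\<lambda>j. \<Sum>g\<in>G. inner (q M j) g *\<^sub>R g) \<longlonglongrightarrow> (\<Sum>g\<in>G. 0 *\<^sub>R g)"
      by (rule tendsto_sum) (rule tendsto_scaleR[OF weak tendsto_const])
    have b: "(\<lambda>j. \<Sum>l<M. inner (q M j) (y l j) *\<^sub>R y l j) \<longlonglongrightarrow> (\<Sum>l<M. 0)"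
      by (rule tendsto_sum) (simp add: term0)
    have eq: "r j - q M j = - (\<Sum>g\<in>G. inner (q M j) g *\<^sub>R g) - (\<Sum>l<M. inner (q M j) (y l j) *\<^sub>R y l j)" for j
      by (simp add: r_def)
    show ?thesis unfolding eq using tendsto_diff[OF tendsto_minus[OF a] b] by simp
  qed
  have nr: "(\<lambda>j. norm (r j)) \<longlonglongrightarrow> 1" if "q M \<noteq> (\<lambda>_. 0)"
  proof -
    have "(\<lambda>j. norm (r j) - norm (q M j)) \<longlonglongrightarrow> 0"
      by (rule Lim_null_comparison[OF _ tendsto_norm_zero[OF rq]]) (simp add: norm_triangle_ineq3)
    moreover have "(\<lambda>j. norm (q M j)) \<longlonglongrightarrow> 1" using unit[of M] that by simp
    ultimately have "(\<lambda>j. (norm (r j) - norm (q M j)) + norm (q M j)) \<longlonglongrightarrow> 0 + 1" by (rule tendsto_add)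
    then show ?thesis by simp
  qed
  have zq: "(\<lambda>j. z j - q M j) \<longlonglongrightarrow> 0"
  proof (cases "q M = (\<lambda>_. 0)")
    case True
    then show ?thesis by (simp add: z_def)
  next
    case False
    have "Bseq r" by (rule Bseq_of_null_diff[OF rq bq])
    moreover have "(\<lambda>j. 1 / norm (r j) - 1) \<longlonglongrightarrow> 1 / 1 - 1" by (intro tendsto_intros nr[OF False]) simp
    ultimately have "(\<lambda>j. (1 / norm (r j) - 1) *\<^sub>R r j) \<longlonglongrightarrow> 0"
      by (intro scaleR_null_Bseq) simp_all
    from tendsto_add[OF this rq] show ?thesis using False by (simp add: z_def scaleR_diff_left)
  qed
  \<comment> \<open>Normalising is meaningful only where r j is nonzero, which holds eventually
    because its norm tends to 1.\<close>
  have evn: "\<forall>\<^sub>F j in sequentially. q M \<noteq> (\<lambda>_. 0) \<longrightarrow> r j \<noteq> 0"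
  proof (cases "q M = (\<lambda>_. 0)")
    case False
    have "\<forall>\<^sub>F j in sequentially. norm (r j) > 0" by (rule order_tendstoD(1)[OF nr[OF False]]) simp
    then show ?thesis by (rule eventually_mono) auto
  qed simp
  define y' where "y' k = (if k = M then z else y k)" for k
  have "(\<lambda>j. y' k j - q k j) \<longlonglongrightarrow> 0" if "k < Suc M" for k
    using y[of k] zq that by (cases "k = M") (auto simp: y'_def)
  moreover have "\<forall>\<^sub>F j in sequentially. \<forall>k<Suc M. y' k j \<in> R \<and> (if q k = (\<lambda>_. 0) then y' k j = 0 else norm (y' k j) = 1) \<and>
       (\<forall>l<Suc M. l \<noteq> k \<longrightarrow> inner (y' k j) (y' l j) = 0) \<and> (\<forall>g\<in>G. inner (y' k j) g = 0)"
    using ev evn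
  proof eventually_elim
    case (elim j)
    have yR: "y l j \<in> R" and yu: "if q l = (\<lambda>_. 0) then y l j = 0 else norm (y l j) = 1"
      and yo: "\<And>i. i < M \<Longrightarrow> i \<noteq> l \<Longrightarrow> inner (y l j) (y i j) = 0" and yG: "\<And>g. g \<in> G \<Longrightarrow> inner (y l j) g = 0"
      if "l < M" for l using elim(1) that by auto
    have zR: "z j \<in> R"
      unfolding z_def r_def using R qR G(2) yR subspace_0[OF R]
      by (auto intro!: subspace_scale subspace_diff subspace_sum)
    have rG: "inner (r j) g = 0" if "g \<in> G" for g
    proof -
      have "(\<Sum>h\<in>G. inner (q M j) h * inner h g) = (\<Sum>h\<in>G. if h = g then inner (q M j) g else 0)"
        by (rule sum.cong) (use G(3) that in auto)
      then show ?thesis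
        using that G(1) yG by (simp add: r_def inner_diff_left inner_sum_left)
    qed
    have ry: "inner (r j) (y l j) = 0" if "l < M" for l
    proof -
      have u: "inner (q M j) (y l j) * inner (y l j) (y l j) = inner (q M j) (y l j)"
        using yu[OF that] by (auto split: if_splits simp flip: power2_norm_eq_inner)
      have "(\<Sum>i<M. inner (q M j) (y i j) * inner (y i j) (y l j)) = (\<Sum>i<M. if i = l then inner (q M j) (y l j) else 0)"
        by (rule sum.cong) (use yo that u in \<open>auto simp: inner_commute\<close>)
      moreover have "(\<Sum>g\<in>G. inner (q M j) g * inner g (y l j)) = 0"
        using yG[OF that] by (intro sum.neutral) (simp add: inner_commute)
      ultimately show ?thesis using that by (simp add: r_def inner_diff_left inner_sum_left)
    qed
    have zu: "if q M = (\<lambda>_. 0) then z j = 0 else norm (z j) = 1" using elim(2) by (auto simp: z_def)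
    have zG: "inner (z j) g = 0" if "g \<in> G" for g using rG[OF that] by (simp add: z_def)
    have zy: "inner (z j) (y l j) = 0" if "l < M" for l using ry[OF that] by (simp add: z_def)
    show ?case
      unfolding less_Suc_eq y'_def using yR yu yo yG zR zu zG zy by (auto simp: inner_commute)
  qed
  ultimately show ?case by blast
qed

section \<open>Almost reducing sequences\<close>

lemma norm_sum_orthogonal_le:
  fixes y :: "'i \<Rightarrow> 'a::real_inner"
  assumes "finite F" "\<And>p p'. p \<noteq> p' \<Longrightarrow> inner (y p) (y p') = 0" "\<And>p. norm (y p) \<le> 1"
  shows "(norm (\<Sum>p\<in>F. b p *\<^sub>R y p))\<^sup>2 \<le> (\<Sum>p\<in>F. (b p)\<^sup>2)"
proof -
  have "(norm (\<Sum>p\<in>F. b p *\<^sub>R y p))\<^sup>2 = (\<Sum>p\<in>F. \<Sum>p'\<in>F. b p * b p' * inner (y p) (y p'))"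
    by (simp add: power2_norm_eq_inner inner_sum_left inner_sum_right sum_distrib_left mult.assoc)
      (simp add: inner_commute)
  also have "\<dots> = (\<Sum>p\<in>F. \<Sum>p'\<in>F. if p' = p then (b p)\<^sup>2 * (norm (y p))\<^sup>2 else 0)"
    by (intro sum.cong refl) (auto simp: assms(2) power2_norm_eq_inner power2_eq_square[of "b _"])
  also have "\<dots> = (\<Sum>p\<in>F. (b p)\<^sup>2 * (norm (y p))\<^sup>2)" using assms(1) by simp
  also have "\<dots> \<le> (\<Sum>p\<in>F. (b p)\<^sup>2)"
  proof (rule sum_mono)
    fix p
    have "(norm (y p))\<^sup>2 \<le> 1\<^sup>2" by (intro power_mono assms(3)) simp
    then show "(b p)\<^sup>2 * (norm (y p))\<^sup>2 \<le> (b p)\<^sup>2" by (simp add: mult_left_le)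
  qed
  finally show ?thesis .
qed

text \<open>For each n the inner sums apply the commutator of the matrix a with the diagonal matrix
  of entries \<open>G n (lev k)\<close>. Only adjacent levels interact, and there the columns of G
  differ by at most \<delta> in square length; the factor 3 counts the levels adjacent or equal to a
  given one.\<close>

lemma block_tridiagonal_bound:
  fixes a :: "nat \<Rightarrow> nat \<Rightarrow> real" and G :: "nat \<Rightarrow> nat \<Rightarrow> real" and lev :: "nat \<Rightarrow> nat"
  assumes tri: "\<And>i k. a i k \<noteq> 0 \<Longrightarrow> lev k \<le> Suc (lev i) \<and> lev i \<le> Suc (lev k)"
    and bound: "\<And>I c. finite I \<Longrightarrow> (\<Sum>k<M. (\<Sum>i\<in>I. c i * a i k)\<^sup>2) \<le> B * (\<Sum>i\<in>I. (c i)\<^sup>2)"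
    and rot: "\<And>m. (\<Sum>n<K. (G n (Suc m) - G n m)\<^sup>2) \<le> \<delta>"
  shows "(\<Sum>n<K. \<Sum>k<M. (\<Sum>i<N. c i * a i k * (G n (lev i) - G n (lev k)))\<^sup>2) \<le> 3 * \<delta> * B * (\<Sum>i<N. (c i)\<^sup>2)"
proof -
  have \<delta>0: "0 \<le> \<delta>" by (rule order_trans[OF sum_nonneg rot[of 0]]) simp
  have rot': "(\<Sum>n<K. (G n m - G n l)\<^sup>2) \<le> \<delta>" if ml: "m \<le> Suc l" "l \<le> Suc m" for m l
  proof -
    consider "m = l" | "m = Suc l" | "l = Suc m" using ml by linarith
    then show ?thesis
    proof cases
      case 3
      then show ?thesis using rot[of m] by (simp add: power2_commute)
    qed (use \<delta>0 rot[of l] in auto)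
  qed
  define S where "S = lev ` {..<N}"
  define L where "L m = {i \<in> {..<N}. lev i = m}" for m
  define t where "t m k = (\<Sum>i\<in>L m. c i * a i k)" for m k
  define S' where "S' k = {m \<in> S. m \<le> Suc (lev k) \<and> lev k \<le> Suc m}" for k
  have finS: "finite S" by (simp add: S_def)
  have group: "(\<Sum>i<N. h i) = (\<Sum>m\<in>S. \<Sum>i\<in>L m. h i)" for h :: "nat \<Rightarrow> real"
    unfolding S_def L_def by (rule sum.image_gen) simp
  have card3: "card (S' k) \<le> 3" for k
  proof -
    have "S' k \<subseteq> {lev k - 1, lev k, Suc (lev k)}" by (auto simp: S'_def)
    then have "card (S' k) \<le> card {lev k - 1, lev k, Suc (lev k)}" by (intro card_mono) auto
    also have "\<dots> \<le> 3" by (simp add: card_insert_if)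
    finally show ?thesis .
  qed
  have sq: "(\<Sum>i<N. c i * a i k * (G n (lev i) - G n (lev k)))\<^sup>2
     \<le> 3 * (\<Sum>m\<in>S' k. (G n m - G n (lev k))\<^sup>2 * (t m k)\<^sup>2)" for n k
  proof -
    have "(\<Sum>i<N. c i * a i k * (G n (lev i) - G n (lev k))) = (\<Sum>m\<in>S. (G n m - G n (lev k)) * t m k)"
      unfolding group t_def sum_distrib_left by (intro sum.cong refl) (simp add: L_def mult.commute)
    also have "\<dots> = (\<Sum>m\<in>S' k. (G n m - G n (lev k)) * t m k)"
    proof (rule sum.mono_neutral_right[OF finS])
      show "\<forall>m\<in>S - S' k. (G n m - G n (lev k)) * t m k = 0"
      proof
        fix m assume m: "m \<in> S - S' k"
        have "a i k = 0" if "i \<in> L m" for i using tri[of i k] that m by (auto simp: L_def S'_def)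
        then have "t m k = 0" by (simp add: t_def)
        then show "(G n m - G n (lev k)) * t m k = 0" by simp
      qed
    qed (auto simp: S'_def)
    finally have "(\<Sum>i<N. c i * a i k * (G n (lev i) - G n (lev k)))\<^sup>2
      \<le> (\<Sum>m\<in>S' k. ((G n m - G n (lev k)) * t m k)\<^sup>2) * card (S' k)"
      using sum_squared_le_sum_of_squares[of "\<lambda>m. (G n m - G n (lev k)) * t m k" "S' k"] by simp
    also have "\<dots> \<le> (\<Sum>m\<in>S' k. ((G n m - G n (lev k)) * t m k)\<^sup>2) * 3"
      using card3[of k] by (intro mult_left_mono sum_nonneg) auto
    finally show ?thesis by (simp add: power_mult_distrib mult.commute)
  qed
  have pull: "(\<Sum>n<K. 3 * (\<Sum>m\<in>A. g n m * h m)) = 3 * (\<Sum>m\<in>A. (\<Sum>n<K. g n m) * h m)"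
    for A :: "nat set" and g :: "nat \<Rightarrow> nat \<Rightarrow> real" and h
  proof -
    have "(\<Sum>n<K. 3 * (\<Sum>m\<in>A. g n m * h m)) = 3 * (\<Sum>n<K. \<Sum>m\<in>A. g n m * h m)"
      by (rule sum_distrib_left[symmetric])
    also have "(\<Sum>n<K. \<Sum>m\<in>A. g n m * h m) = (\<Sum>m\<in>A. \<Sum>n<K. g n m * h m)" by (rule sum.swap)
    finally show ?thesis by (simp only: sum_distrib_right)
  qed
  have "(\<Sum>n<K. \<Sum>k<M. (\<Sum>i<N. c i * a i k * (G n (lev i) - G n (lev k)))\<^sup>2)
    \<le> (\<Sum>n<K. \<Sum>k<M. 3 * (\<Sum>m\<in>S' k. (G n m - G n (lev k))\<^sup>2 * (t m k)\<^sup>2))"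
    by (intro sum_mono sq)
  also have "\<dots> = (\<Sum>k<M. 3 * (\<Sum>m\<in>S' k. (\<Sum>n<K. (G n m - G n (lev k))\<^sup>2) * (t m k)\<^sup>2))"
    by (subst sum.swap) (simp only: pull)
  also have "\<dots> \<le> (\<Sum>k<M. 3 * (\<Sum>m\<in>S' k. \<delta> * (t m k)\<^sup>2))"
    by (intro sum_mono mult_left_mono mult_right_mono rot') (auto simp: S'_def)
  also have "\<dots> \<le> (\<Sum>k<M. 3 * (\<Sum>m\<in>S. \<delta> * (t m k)\<^sup>2))"
    by (intro sum_mono mult_left_mono sum_mono2 finS) (auto simp: S'_def \<delta>0)
  also have "\<dots> = (\<Sum>k<M. \<Sum>m\<in>S. 3 * \<delta> * (t m k)\<^sup>2)"
    by (simp add: sum_distrib_left mult.assoc)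
  also have "\<dots> = 3 * \<delta> * (\<Sum>m\<in>S. \<Sum>k<M. (t m k)\<^sup>2)"
    by (subst sum.swap) (simp add: sum_distrib_left mult.assoc)
  \<comment> \<open>The bound for a is applied to the coefficients of each level separately; the
    levels partition the indices below N.\<close>
  also have "\<dots> \<le> 3 * \<delta> * (\<Sum>m\<in>S. B * (\<Sum>i\<in>L m. (c i)\<^sup>2))"
    using \<delta>0 unfolding t_def by (intro mult_left_mono sum_mono bound) (auto simp: L_def)
  also have "\<dots> = 3 * \<delta> * B * (\<Sum>i<N. (c i)\<^sup>2)"
    by (subst group) (simp add: sum_distrib_left mult.assoc)
  finally show ?thesis .
qed

text \<open>Unit vectors of \<open>\<real>\<^sup>\<infinity>\<close> that turn slowly through the coordinate axes one after the other:
  column \<open>m = a L + b\<close> of \<open>G\<close> lies in the plane of the axes \<open>a\<close> and \<open>a + 1\<close>, at angle \<open>b \<pi> / (2 L)\<close>.\<close>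

lemma rotating_frame:
  assumes "\<delta> > 0"
  shows "\<exists>G :: nat \<Rightarrow> nat \<Rightarrow> real. (\<forall>n m. n \<ge> m + 2 \<longrightarrow> G n m = 0) \<and> (\<forall>m K. K \<ge> m + 2 \<longrightarrow> (\<Sum>n<K. (G n m)\<^sup>2) = 1) \<and>
    (\<forall>m K. (\<Sum>n<K. (G n (Suc m) - G n m)\<^sup>2) \<le> \<delta>) \<and> (\<forall>n. \<exists>b. \<forall>m\<ge>b. G n m = 0)"
proof -
  \<comment> \<open>One step turns by w = \<pi> / (2 L) and moves a column by at most 2 w^2 in
    square length; L \<ge> 2 \<pi>^2 / \<delta> brings that below \<delta> with room to
    spare.\<close>
  obtain L0 where "2 * pi\<^sup>2 / \<delta> < real L0" using reals_Archimedean2 by blast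
  define L where "L = Suc L0"
  have L: "L > 0" "2 * pi\<^sup>2 / \<delta> \<le> real L" using \<open>_ < real L0\<close> by (simp_all add: L_def)
  define w where "w = pi / (2 * real L)"
  have w0: "w > 0" using L by (simp add: w_def)
  have w2: "2 * w\<^sup>2 \<le> \<delta>"
  proof -
    have "2 * pi\<^sup>2 \<le> \<delta> * real L" using L(2) assms by (simp add: divide_le_eq mult.commute)
    also have "\<dots> \<le> \<delta> * (real L)\<^sup>2" using L assms by (intro mult_left_mono) (auto simp: power2_eq_square)
    finally have "2 * pi\<^sup>2 / (real L)\<^sup>2 \<le> \<delta>" using L by (simp add: divide_le_eq)
    moreover have "2 * w\<^sup>2 \<le> 2 * pi\<^sup>2 / (real L)\<^sup>2" using L by (simp add: w_def power_divide field_simps)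
    ultimately show ?thesis by linarith
  qed
  define ax where "ax a \<theta> n = (if n = a then cos \<theta> else if n = Suc a then sin \<theta> else 0)" for a n :: nat and \<theta> :: real
  define G where "G n m = ax (m div L) (real (m mod L) * w) n" for n m
  have dl: "m div L \<le> m" for m by simp
  have sum_ax: "(\<Sum>n<K. h n) = (if a < K then h a else 0) + (if Suc a < K then h (Suc a) else 0)"
    if "\<And>n. n \<noteq> a \<Longrightarrow> n \<noteq> Suc a \<Longrightarrow> h n = 0" for h :: "nat \<Rightarrow> real" and a K
  proof -
    have "h n = (if n = a then h a else 0) + (if n = Suc a then h (Suc a) else 0)" for n using that[of n] by auto
    then have "(\<Sum>n<K. h n) = (\<Sum>n<K. (if n = a then h a else 0) + (if n = Suc a then h (Suc a) else 0))" by (rule sum.cong[OF refl])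
    also have "\<dots> = (if a < K then h a else 0) + (if Suc a < K then h (Suc a) else 0)"
      unfolding sum.distrib by simp
    finally show ?thesis .
  qed
  have G0: "G n m = 0" if "n \<ge> m + 2" for n m
  proof -
    have "n \<noteq> m div L \<and> n \<noteq> Suc (m div L)" using that dl[of m] by linarith
    then show ?thesis by (simp add: G_def ax_def)
  qed
  have G1: "(\<Sum>n<K. (G n m)\<^sup>2) = 1" if "K \<ge> m + 2" for m K
  proof -
    have "m div L < K \<and> Suc (m div L) < K" using that dl[of m] by linarith
    then show ?thesis by (subst sum_ax[of "m div L"]) (auto simp: G_def ax_def)
  qed
  have G2: "(\<Sum>n<K. (G n (Suc m) - G n m)\<^sup>2) \<le> \<delta>" for m K
  proof -
    define a where "a = m div L"
    define \<theta> where "\<theta> = real (m mod L) * w"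
    have S: "G n (Suc m) = ax a (\<theta> + w) n" for n
    \<comment> \<open>At the end of a block the angle reaches \<pi>/2, that is axis a + 1, which is
      also where the next plane starts at angle 0.\<close>
    proof (cases "Suc (m mod L) = L")
      case True
      then have mL: "Suc m mod L = 0" "Suc m div L = Suc a" by (simp_all add: mod_Suc div_Suc a_def)
      have pi2: "\<theta> + w = pi / 2"
      proof -
        have "\<theta> + w = real (Suc (m mod L)) * w" by (simp add: \<theta>_def algebra_simps)
        then show ?thesis using True L by (simp add: w_def)
      qed
      show ?thesis by (simp add: G_def ax_def mL pi2)
    next
      case False
      then have "Suc m mod L = Suc (m mod L)" "Suc m div L = a" using L by (simp_all add: mod_Suc div_Suc a_def)
      then show ?thesis by (simp add: G_def \<theta>_def algebra_simps)
    qed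
    obtain x where "cos (\<theta> + w) - cos \<theta> = (\<theta> + w - \<theta>) * (- sin x)"
      using MVT2[of \<theta> "\<theta> + w" cos "\<lambda>x. - sin x"] w0 DERIV_cos by auto
    then have "\<bar>cos (\<theta> + w) - cos \<theta>\<bar> \<le> w" using w0 by (simp add: abs_mult mult_left_le)
    moreover obtain x' where "sin (\<theta> + w) - sin \<theta> = (\<theta> + w - \<theta>) * cos x'"
      using MVT2[of \<theta> "\<theta> + w" sin cos] w0 DERIV_sin by auto
    then have "\<bar>sin (\<theta> + w) - sin \<theta>\<bar> \<le> w" using w0 by (simp add: abs_mult mult_left_le)
    ultimately have "(cos (\<theta> + w) - cos \<theta>)\<^sup>2 \<le> w\<^sup>2" "(sin (\<theta> + w) - sin \<theta>)\<^sup>2 \<le> w\<^sup>2"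
      using w0 by (simp_all add: abs_le_square_iff[symmetric])
    then have "(\<Sum>n<K. (ax a (\<theta> + w) n - ax a \<theta> n)\<^sup>2) \<le> 2 * w\<^sup>2"
      by (subst sum_ax[of a]) (auto simp: ax_def intro: order_trans[where y="w\<^sup>2"])
    then show ?thesis using w2 S by (simp add: G_def \<theta>_def a_def)
  qed
  have G3: "\<exists>b. \<forall>m\<ge>b. G n m = 0" for n
  proof (intro exI allI impI)
    fix m assume "m \<ge> Suc n * L"
    then have "m div L \<ge> Suc n" using L by (simp add: less_eq_div_iff_mult_less_eq)
    then show "G n m = 0" by (auto simp: G_def ax_def)
  qed
  show ?thesis using G0 G1 G2 G3 by blast
qed

text \<open>In the application R is the set of C-fixed vectors and \<O> is {A, B}. The bound 2 k + 2
  is the larger of the numbers of the two words obtained from word k by one more letter; f 0 belongs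
  to the empty word.\<close>

locale asymptotic_model = asymptotic_system f for f :: "nat \<Rightarrow> nat \<Rightarrow> 'a::real_inner" +
  fixes R :: "'a set" and \<O> :: "('a \<Rightarrow>\<^sub>L 'a) set"
  assumes R: "subspace R" and f_R: "\<And>k j. f k j \<in> R"
    and finite_ops: "finite \<O>" and ops_symmetric: "\<And>T. T \<in> \<O> \<Longrightarrow> symmetric_op T"
    and ops_f: "\<And>T k. T \<in> \<O> \<Longrightarrow> \<exists>l\<le>2*k+2. \<forall>j. T (f k j) = f l j"
    and f_weak: "\<And>k x. (\<lambda>j. inner (f k j) x) \<longlonglongrightarrow> 0"
    and f_0: "\<And>j. norm (f 0 j) = 1"
begin

lemma V_R: "g \<in> V n \<Longrightarrow> g j \<in> R"
  by (induction rule: V.induct) (auto simp: f_R subspace_0[OF R] subspace_add[OF R] subspace_scale[OF R])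

lemma V_weak: "g \<in> V n \<Longrightarrow> (\<lambda>j. inner (g j) x) \<longlonglongrightarrow> 0"
proof (induction rule: V.induct)
  case (V_add g h)
  from tendsto_add[OF V_add.IH] show ?case by (simp add: inner_add_left)
next
  case (V_scale g c)
  from tendsto_mult_left[OF V_scale.IH, of c] show ?case by simp
qed (auto simp: f_weak)

text \<open>The generators of \<open>V n\<close> have numbers at most n - 1, and their images at
  most 2 (n - 1) + 2 = 2 n; hence the index \<open>2*n+1\<close>.\<close>

lemma V_apply:
  assumes "g \<in> V n" "T \<in> \<O>"
  shows "(\<lambda>j. T (g j)) \<in> V (2*n+1)"
  using assms(1)
proof (induction rule: V.induct)
  case (V_base k)
  obtain l where "l \<le> 2*k+2" "\<And>j. T (f k j) = f l j" using ops_f[OF assms(2)] by blast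
  then show ?case using V_base by (simp add: V.V_base)
qed (auto simp: blinfun.add_right blinfun.scaleR_right intro: V.intros)

lemma V_apply_q: "T \<in> \<O> \<Longrightarrow> (\<lambda>j. T (q i j)) \<in> V (2*i+3)"
  using V_apply[OF q_V, of T i] by (simp add: numeral_3_eq_3)

text \<open>The length of \<open>q k\<close> in the limit representation, and of its exact
  copies.\<close>

definition s :: "nat \<Rightarrow> real" where "s k = (if q k = (\<lambda>_. 0) then 0 else 1)"

text \<open>The matrix of T in the limit representation, relative to the Gram-Schmidt family
  q.\<close>

definition mat :: "('a \<Rightarrow>\<^sub>L 'a) \<Rightarrow> nat \<Rightarrow> nat \<Rightarrow> real" where
  "mat T i k = ip (\<lambda>j. T (q i j)) (q k)"

text \<open>The length of word number i: level m holds the numbers from \<open>2^m - 1\<close> to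
  \<open>2^(m+1) - 2\<close>.\<close>

definition lev :: "nat \<Rightarrow> nat" where "lev i = floor_log (Suc i)"

lemma mat_zero: "T \<in> \<O> \<Longrightarrow> 2*i+3 \<le> k \<Longrightarrow> mat T i k = 0"
  unfolding mat_def by (rule V_orthogonal[OF V_apply_q])

lemma mat_symmetric: "T \<in> \<O> \<Longrightarrow> mat T i k = mat T k i"
  unfolding mat_def ip_def by (simp add: symmetric_opD[OF ops_symmetric] inner_commute[of "q i _"])

lemma lev_mono: "i \<le> k \<Longrightarrow> lev i \<le> lev k"
  unfolding lev_def using floor_log_mono by (auto simp: mono_def)

lemma lev_step: "k < 2*i+3 \<Longrightarrow> lev k \<le> Suc (lev i)"
proof -
  assume "k < 2*i+3"
  then have "lev k \<le> lev (2*i+2)" by (intro lev_mono) simp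
  also have "lev (2*i+2) = Suc (lev i)"
    unfolding lev_def using floor_log_rec[of "Suc (2*i+2)"] by simp
  finally show ?thesis .
qed

text \<open>T lengthens words by at most one letter, and by symmetry of the matrix it lowers the
  level by at most one.\<close>

lemma mat_levels: "T \<in> \<O> \<Longrightarrow> mat T i k \<noteq> 0 \<Longrightarrow> lev k \<le> Suc (lev i) \<and> lev i \<le> Suc (lev k)"
  using mat_zero[of T i k] mat_zero[of T k i] mat_symmetric[of T i k] lev_step
  by (metis not_less)

text \<open>The limit representation does not increase norms: this is Bessel for q together with the
  limit of |T (g j)|^2 \<le> |T|^2 |g j|^2.\<close>

lemma mat_bound:
  assumes T: "T \<in> \<O>" and I: "finite I"
  shows "(\<Sum>k<M. (\<Sum>i\<in>I. c i * mat T i k)\<^sup>2) \<le> (norm T)\<^sup>2 * (\<Sum>i\<in>I. (c i)\<^sup>2)"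
proof -
  define g where "g = (\<lambda>j. \<Sum>i\<in>I. c i *\<^sub>R q i j)"
  have gW: "g \<in> W" unfolding g_def by (intro W_sum W_intros q_W)
  have hW: "(\<lambda>j. T (g j)) \<in> W" using gW V_apply[OF _ T] unfolding W_def by blast
  have TqW: "(\<lambda>j. T (q i j)) \<in> W" for i using V_W[OF V_apply[OF q_V T]] .
  have "ip (\<lambda>j. T (g j)) (q k) = (\<Sum>i\<in>I. c i * mat T i k)" for k
    unfolding g_def blinfun.sum_right blinfun.scaleR_right mat_def
    by (subst ip_sum_left, (intro W_intros TqW q_W)+) (simp add: ip_scale_left TqW q_W)
  then have "(\<Sum>k<M. (\<Sum>i\<in>I. c i * mat T i k)\<^sup>2) \<le> ip (\<lambda>j. T (g j)) (\<lambda>j. T (g j))"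
    using ip_bessel[OF finite_lessThan hW, of M] by simp
  also have "\<dots> \<le> (norm T)\<^sup>2 * ip g g"
  proof (rule LIMSEQ_le[OF ip_tendsto[OF hW hW] tendsto_mult_left[OF ip_tendsto[OF gW gW]]])
    have "inner (T x) (T x) \<le> (norm T)\<^sup>2 * inner x x" for x
      using power_mono[OF norm_blinfun[of T x], of 2] by (simp add: power_mult_distrib flip: power2_norm_eq_inner)
    then show "\<exists>N. \<forall>n\<ge>N. inner (T (g n)) (T (g n)) \<le> (norm T)\<^sup>2 * inner (g n) (g n)" by blast
  qed
  also have "\<dots> \<le> (norm T)\<^sup>2 * (\<Sum>i\<in>I. (c i)\<^sup>2)"
    using ip_square_sum[OF I, of c] by (intro mult_left_mono) (simp_all add: g_def)
  finally show ?thesis .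
qed

lemma q_norm_tendsto: "q k = (\<lambda>_. 0) \<or> (\<lambda>j. norm (q k j)) \<longlonglongrightarrow> 1"
proof (cases "q k = (\<lambda>_. 0)")
  case False
  then have "ip (q k) (q k) = 1" using q_unit by blast
  then have "(\<lambda>j. sqrt (inner (q k j) (q k j))) \<longlonglongrightarrow> sqrt 1"
    using ip_tendsto[OF q_W q_W, of k k] by (intro tendsto_real_sqrt) simp
  then show ?thesis by (simp flip: norm_eq_sqrt_inner)
qed simp

definition orthonormal_finite :: "'a set \<Rightarrow> bool" where
  "orthonormal_finite G \<longleftrightarrow> finite G \<and> G \<subseteq> R \<and> (\<forall>g\<in>G. \<forall>h\<in>G. inner g h = (if g = h then 1 else 0))"

text \<open>A large j turns the limit relations for q into an exactly orthogonal copy with error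
  \<eta>. The images of the first N vectors involve the indices below 2 N + 1, since
  \<open>2*i+3 \<le> 2*N+1\<close> for i < N.\<close>

lemma single_copy:
  assumes G: "orthonormal_finite G" and \<eta>: "\<eta> > 0"
  shows "\<exists>y. (\<forall>k. y k \<in> R) \<and> (\<forall>k l. k \<noteq> l \<longrightarrow> inner (y k) (y l) = 0) \<and> (\<forall>k. \<forall>g\<in>G. inner (y k) g = 0) \<and>
    (\<forall>k<2*N+1. norm (y k) = s k) \<and> (\<forall>k\<ge>2*N+1. y k = 0) \<and>
    (\<forall>i<N. \<forall>T\<in>\<O>. norm (blinfun_apply T (y i) - (\<Sum>k<2*i+3. mat T i k *\<^sub>R y k)) \<le> \<eta>)"
proof -
  have o: "(\<lambda>j. inner (q k j) (q l j)) \<longlonglongrightarrow> 0" if "k \<noteq> l" for k l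
    using ip_tendsto[OF q_W q_W, of k l] q_orthogonal[of l k] that by simp
  obtain y where y: "\<And>k. k < 2*N+1 \<Longrightarrow> (\<lambda>j. y k j - q k j) \<longlonglongrightarrow> 0" and
    ev: "\<forall>\<^sub>F j in sequentially. \<forall>k<2*N+1. y k j \<in> R \<and> (if q k = (\<lambda>_. 0) then y k j = 0 else norm (y k j) = 1) \<and>
       (\<forall>l<2*N+1. l \<noteq> k \<longrightarrow> inner (y k j) (y l j) = 0) \<and> (\<forall>g\<in>G. inner (y k j) g = 0)"
    using exact_orthonormalisation[OF R, of q G "2*N+1"] V_R[OF q_V] G o q_norm_tendsto V_weak[OF q_V]
    unfolding orthonormal_finite_def by blast
  have lim: "(\<lambda>j. T (y i j) - (\<Sum>k<2*i+3. mat T i k *\<^sub>R y k j)) \<longlonglongrightarrow> 0" if "i < N" "T \<in> \<O>" for i T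
  proof -
    have 1: "(\<lambda>j. T (y i j - q i j)) \<longlonglongrightarrow> T 0"
      by (intro tendsto_intros y) (use that in simp)
    have 2: "(\<lambda>j. T (q i j) - (\<Sum>k<2*i+3. mat T i k *\<^sub>R q k j)) \<longlonglongrightarrow> 0"
      using V_expansion[OF V_apply_q[OF that(2)], of i] by (simp add: mat_def)
    have 3: "(\<lambda>j. \<Sum>k<2*i+3. mat T i k *\<^sub>R (y k j - q k j)) \<longlonglongrightarrow> (\<Sum>k<2*i+3. mat T i k *\<^sub>R 0)"
      by (rule tendsto_sum) (intro tendsto_scaleR tendsto_const y, use that in auto)
    have eq: "T (y i j) - (\<Sum>k<2*i+3. mat T i k *\<^sub>R y k j) = T (y i j - q i j)
        + (T (q i j) - (\<Sum>k<2*i+3. mat T i k *\<^sub>R q k j)) - (\<Sum>k<2*i+3. mat T i k *\<^sub>R (y k j - q k j))" for j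
      by (simp add: blinfun.diff_right scaleR_diff_right sum_subtractf)
    show ?thesis unfolding eq using tendsto_diff[OF tendsto_add[OF 1 2] 3] by simp
  qed
  have "\<forall>\<^sub>F j in sequentially. norm (T (y i j) - (\<Sum>k<2*i+3. mat T i k *\<^sub>R y k j)) \<le> \<eta>"
    if "i < N" "T \<in> \<O>" for i T
    using order_tendstoD(2)[OF tendsto_norm_zero[OF lim[OF that]] \<eta>] by (rule eventually_mono) simp
  then have "\<forall>\<^sub>F j in sequentially. \<forall>p\<in>{..<N} \<times> \<O>. norm (blinfun_apply (snd p) (y (fst p) j) - (\<Sum>k<2*fst p+3. mat (snd p) (fst p) k *\<^sub>R y k j)) \<le> \<eta>"
    using finite_ops by (intro eventually_ball_finite) auto
  from eventually_conj[OF ev this] obtain j where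
    j: "\<And>k. k<2*N+1 \<Longrightarrow> y k j \<in> R \<and> (if q k = (\<lambda>_. 0) then y k j = 0 else norm (y k j) = 1) \<and>
       (\<forall>l<2*N+1. l \<noteq> k \<longrightarrow> inner (y k j) (y l j) = 0) \<and> (\<forall>g\<in>G. inner (y k j) g = 0)"
    and e: "\<And>i T. i < N \<Longrightarrow> T \<in> \<O> \<Longrightarrow> norm (T (y i j) - (\<Sum>k<2*i+3. mat T i k *\<^sub>R y k j)) \<le> \<eta>"
    unfolding eventually_sequentially by fastforce
  define z where "z k = (if k < 2*N+1 then y k j else 0)" for k
  have "norm (T (z i) - (\<Sum>k<2*i+3. mat T i k *\<^sub>R z k)) \<le> \<eta>" if "i < N" "T \<in> \<O>" for i T
  proof -
    have "(\<Sum>k<2*i+3. mat T i k *\<^sub>R z k) = (\<Sum>k<2*i+3. mat T i k *\<^sub>R y k j)"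
      by (intro sum.cong) (use that in \<open>auto simp: z_def\<close>)
    then show ?thesis using e[OF that] that by (simp add: z_def)
  qed
  moreover have "norm (z k) = s k" if "k < 2*N+1" for k
    using j[OF that] that by (auto simp: s_def z_def)
  ultimately show ?thesis using j subspace_0[OF R] by (intro exI[of _ z]) (auto simp: z_def)
qed

text \<open>Each copy is taken orthogonal to e0 and to the unit vectors of all earlier copies.
  Beyond its finite size a copy is filled up with zeros, so orthogonality can be stated for all
  indices.\<close>

lemma copies_exist:
  fixes N :: "nat \<Rightarrow> nat" and \<eta> :: "nat \<Rightarrow> real"
  assumes e0: "e0 \<in> R" "norm e0 = 1" and \<eta>: "\<And>n. \<eta> n > 0"
  shows "\<exists>Y. (\<forall>n k. Y n k \<in> R) \<and> (\<forall>p p'. p \<noteq> p' \<longrightarrow> inner (Y (fst p) (snd p)) (Y (fst p') (snd p')) = 0) \<and>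
    (\<forall>n k. inner (Y n k) e0 = 0) \<and> (\<forall>n k. norm (Y n k) \<le> 1) \<and> (\<forall>n. \<forall>k<2*N n+1. norm (Y n k) = s k) \<and>
    (\<forall>n k. q k = (\<lambda>_. 0) \<longrightarrow> Y n k = 0) \<and>
    (\<forall>n. \<forall>i<N n. \<forall>T\<in>\<O>. norm (blinfun_apply T (Y n i) - (\<Sum>k<2*i+3. mat T i k *\<^sub>R Y n k)) \<le> \<eta> n)"
proof -
  define good where "good G M h y \<longleftrightarrow> (\<forall>k. y k \<in> R) \<and> (\<forall>k l. k \<noteq> l \<longrightarrow> inner (y k) (y l) = 0) \<and> (\<forall>k. \<forall>g\<in>G. inner (y k) g = 0) \<and>
    (\<forall>k<2*M+1. norm (y k) = s k) \<and> (\<forall>k\<ge>2*M+1. y k = 0) \<and>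
    (\<forall>i<M. \<forall>T\<in>\<O>. norm (blinfun_apply T (y i) - (\<Sum>k<2*i+3. mat T i k *\<^sub>R y k)) \<le> h)" for G M h and y :: "nat \<Rightarrow> 'a"
  define yf where "yf G M h = (SOME y. good G M h y)" for G M h
  have yf: "good G M h (yf G M h)" if "orthonormal_finite G" "h > 0" for G M h
  proof -
    have "\<exists>y. good G M h y" using single_copy[OF that, of M] by (simp add: good_def)
    then show ?thesis unfolding yf_def by (rule someI_ex[of "good G M h"])
  qed
  \<comment> \<open>Only vectors with s k = 1 are collected: \<open>orthonormal_finite\<close>
    demands unit vectors, and the other vectors of the copy are zero.\<close>
  define next_set where "next_set n G = G \<union> (yf G (N n) (\<eta> n) ` {k. k < 2 * N n + 1 \<and> s k = 1})" for n G
  define Gs where "Gs = rec_nat {e0} next_set"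
  have Gs0: "Gs 0 = {e0}" and GsS: "Gs (Suc n) = next_set n (Gs n)" for n by (simp_all add: Gs_def)
  define Y where "Y n = yf (Gs n) (N n) (\<eta> n)" for n
  have G: "orthonormal_finite (Gs n)" for n
  proof (induction n)
    case 0
    then show ?case using e0 by (simp add: orthonormal_finite_def Gs0 flip: power2_norm_eq_inner)
  next
    case (Suc n)
    have g: "good (Gs n) (N n) (\<eta> n) (Y n)" unfolding Y_def by (rule yf[OF Suc \<eta>])
    define A where "A = Y n ` {k. k < 2 * N n + 1 \<and> s k = 1}"
    have GA: "Gs (Suc n) = Gs n \<union> A" by (simp add: GsS next_set_def A_def Y_def)
    have "finite A" by (simp add: A_def)
    moreover have "A \<subseteq> R" using g by (auto simp: A_def good_def)
    moreover have AA: "inner x y = (if x = y then 1 else 0)" if xy: "x \<in> A" "y \<in> A" for x y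
    proof -
      obtain k l where kl: "x = Y n k" "y = Y n l" "k < 2 * N n + 1" "s k = 1" using xy by (auto simp: A_def)
      then have "norm x = 1" using g by (simp add: good_def)
      then have xx: "inner x x = 1" by (simp flip: power2_norm_eq_inner)
      show ?thesis
      proof (cases "k = l")
        case True
        then show ?thesis using xx kl by simp
      next
        case False
        then have "inner x y = 0" using g kl by (simp add: good_def)
        then show ?thesis using xx by auto
      qed
    qed
    moreover have AG: "inner x y = 0 \<and> inner y x = 0 \<and> x \<noteq> y" if "x \<in> A" "y \<in> Gs n" for x y
    proof -
      have "inner x y = 0" using that g by (auto simp: A_def good_def)
      then show ?thesis using AA[OF that(1) that(1)] by (auto simp: inner_commute)
    qed
    moreover have GG: "finite (Gs n)" "Gs n \<subseteq> R" "\<And>x y. x \<in> Gs n \<Longrightarrow> y \<in> Gs n \<Longrightarrow> inner x y = (if x = y then 1 else 0)"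
      using Suc by (auto simp: orthonormal_finite_def)
    have "inner x y = (if x = y then 1 else 0)" if "x \<in> Gs n \<union> A" "y \<in> Gs n \<union> A" for x y
      using that AA[of x y] AG[of x y] AG[of y x] GG(3)[of x y] by (elim UnE) auto
    ultimately show ?case using GG unfolding GA orthonormal_finite_def by simp
  qed
  have g: "good (Gs n) (N n) (\<eta> n) (Y n)" for n unfolding Y_def by (rule yf[OF G \<eta>])
  have gR: "Y n k \<in> R" and go: "k \<noteq> l \<Longrightarrow> inner (Y n k) (Y n l) = 0" and gG: "h \<in> Gs n \<Longrightarrow> inner (Y n k) h = 0"
    and gs: "k < 2 * N n + 1 \<Longrightarrow> norm (Y n k) = s k" and gz: "k \<ge> 2 * N n + 1 \<Longrightarrow> Y n k = 0"
    and ge: "i < N n \<Longrightarrow> T \<in> \<O> \<Longrightarrow> norm (blinfun_apply T (Y n i) - (\<Sum>k<2*i+3. mat T i k *\<^sub>R Y n k)) \<le> \<eta> n"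
    for n k l h i T
    using g[of n] unfolding good_def by auto
  have s01: "s k = 0 \<or> s k = 1" for k by (simp add: s_def)
  have mono: "Gs m \<subseteq> Gs n" if "m \<le> n" for m n
    using that by (induction rule: dec_induct) (auto simp: GsS next_set_def)
  have YG: "Y n k = 0 \<or> Y n k \<in> Gs (Suc n)" for n k
  proof (cases "k < 2 * N n + 1 \<and> s k = 1")
    case True
    then show ?thesis by (auto simp: GsS next_set_def Y_def)
  next
    case False
    then show ?thesis using gs[of k n] gz[of n k] s01[of k] by fastforce
  qed
  have cross: "inner (Y n k) (Y m l) = 0" if "m < n" for m n k l
    using YG[of m l] mono[of "Suc m" n] that gG[of "Y m l" n k] by auto
  have Yo: "inner (Y (fst p) (snd p)) (Y (fst p') (snd p')) = 0" if "p \<noteq> p'" for p p'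
  proof (cases "fst p = fst p'")
    case True
    then show ?thesis using go[of "snd p" "snd p'"] that by (simp add: prod_eq_iff)
  next
    case False
    then show ?thesis
      using cross[of "fst p" "fst p'"] cross[of "fst p'" "fst p"] inner_commute by (metis nat_neq_iff)
  qed
  have Ye: "inner (Y n k) e0 = 0" for n k using gG[of e0 n k] mono[of 0 n] Gs0 by auto
  have Y1: "norm (Y n k) \<le> 1" for n k
    using gs[of k n] gz[of n k] s01[of k] by (cases "k < 2 * N n + 1") auto
  have Y0: "Y n k = 0" if "q k = (\<lambda>_. 0)" for n k
    using gs[of k n] gz[of n k] that by (cases "k < 2 * N n + 1") (auto simp: s_def)
  show ?thesis
    by (intro exI[of _ Y] conjI allI impI ballI) (simp_all add: gR Yo Ye Y1 Y0 gs ge)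
qed

text \<open>The empty word yields unit vectors, so the limit representation is not zero; this gives
  v 0 \<noteq> 0 and later P \<noteq> 0.\<close>

lemma q_0_nonzero: "q 0 \<noteq> (\<lambda>_. 0)"
proof -
  have r: "res 0 = f 0" by (simp add: res_def)
  have "ip (f 0) (f 0) = 1" by (rule ip_eqI) (simp add: f_0 flip: power2_norm_eq_inner)
  then have "q 0 = f 0" by (simp add: q_res r)
  then show ?thesis using f_0 by (metis norm_zero zero_neq_one)
qed

text \<open>\<open>v i\<close> combines vector number i of all copies with the weights that the
  turning frame has at the level of i. T v deviates from the combination of v prescribed by the
  matrix in two ways: the copies are inexact (E1), and the weights change between adjacent levels
  (E2). Each costs \<open>\<epsilon>/2\<close>.\<close>

lemma almost_reducing_sequence:
  assumes e0: "e0 \<in> R" "norm e0 = 1" and \<epsilon>: "\<epsilon> > 0"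
  shows "\<exists>v. (\<forall>i. v i \<in> R) \<and> orthonormal_or_zero v \<and> v 0 \<noteq> 0 \<and> (\<forall>i. inner (v i) e0 = 0) \<and>
    (\<forall>T\<in>\<O>. \<forall>c N. \<exists>d M. norm (blinfun_apply T (\<Sum>i<N. c i *\<^sub>R v i) - (\<Sum>k<M. d k *\<^sub>R v k))
       \<le> \<epsilon> * norm (\<Sum>i<N. c i *\<^sub>R v i))"
proof -
  define B where "B = (\<Sum>T\<in>\<O>. (norm T)\<^sup>2) + 1"
  have B: "(norm T)\<^sup>2 \<le> B" if "T \<in> \<O>" for T
    using member_le_sum[of T \<O> "\<lambda>T. (norm T)\<^sup>2"] that finite_ops by (simp add: B_def)
  have B0: "B > 0" unfolding B_def by (intro add_nonneg_pos sum_nonneg) auto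
  \<comment> \<open>Makes the constant \<open>3 * \<delta> * B\<close> of
    \<open>block_tridiagonal_bound\<close> equal to \<open>(\<epsilon>/2)^2\<close>.\<close>
  define \<delta> where "\<delta> = (\<epsilon>/2)\<^sup>2 / (3 * B)"
  have \<delta>: "\<delta> > 0" "3 * \<delta> * B = (\<epsilon>/2)\<^sup>2" using \<epsilon> B0 by (simp_all add: \<delta>_def)
  obtain G :: "nat \<Rightarrow> nat \<Rightarrow> real" where
    "(\<forall>n m. n \<ge> m + 2 \<longrightarrow> G n m = 0) \<and> (\<forall>m K. K \<ge> m + 2 \<longrightarrow> (\<Sum>n<K. (G n m)\<^sup>2) = 1) \<and>
     (\<forall>m K. (\<Sum>n<K. (G n (Suc m) - G n m)\<^sup>2) \<le> \<delta>) \<and> (\<forall>n. \<exists>b. \<forall>m\<ge>b. G n m = 0)"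
    using rotating_frame[OF \<delta>(1)] ..
  then have G0: "n \<ge> m + 2 \<Longrightarrow> G n m = 0" and G1: "K \<ge> m + 2 \<Longrightarrow> (\<Sum>n<K. (G n m)\<^sup>2) = 1"
    and G2: "(\<Sum>n<K. (G n (Suc m) - G n m)\<^sup>2) \<le> \<delta>" and G3: "\<exists>b. \<forall>m\<ge>b. G n m = 0" for n m K
    by blast+
  obtain b where b: "\<And>n m. m \<ge> b n \<Longrightarrow> G n m = 0" using G3 by metis
  \<comment> \<open>Level b n begins at index \<open>2^(b n) - 1\<close>, so copy n has weight 0
    from index N n on and must be accurate only on its first N n vectors.\<close>
  define N where "N n = (2::nat) ^ b n" for n
  have N: "G n (lev i) = 0" if "i \<ge> N n" for n i
  proof (rule b)
    have "lev (2 ^ b n - 1) = b n" by (simp add: lev_def)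
    then show "b n \<le> lev i" using lev_mono[of "2 ^ b n - 1" i] that by (simp add: N_def)
  qed
  have G_le_1: "\<bar>G n m\<bar> \<le> 1" for n m
  proof -
    have "(G n m)\<^sup>2 \<le> (\<Sum>n<n+m+2. (G n m)\<^sup>2)" by (rule member_le_sum) auto
    then have "(G n m)\<^sup>2 \<le> 1\<^sup>2" using G1[of m "n+m+2"] by simp
    then show ?thesis using abs_le_square_iff[of "G n m" 1] by simp
  qed
  \<comment> \<open>The N n errors of copy n add up to \<open>(\<epsilon>/4) * (1/2)^n\<close>, and
    over all copies to at most \<open>\<epsilon>/2\<close>.\<close>
  define \<eta> where "\<eta> n = (\<epsilon>/4) * (1/2)^n / real (N n)" for n
  have N_pos: "N n > 0" for n by (simp add: N_def)
  have \<eta>: "\<eta> n > 0" "real (N n) * \<eta> n = (\<epsilon>/4) * (1/2)^n" for n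
    using \<epsilon> N_pos[of n] by (simp_all add: \<eta>_def)
  obtain Y where "(\<forall>n k. Y n k \<in> R) \<and> (\<forall>p p'. p \<noteq> p' \<longrightarrow> inner (Y (fst p) (snd p)) (Y (fst p') (snd p')) = 0) \<and>
    (\<forall>n k. inner (Y n k) e0 = 0) \<and> (\<forall>n k. norm (Y n k) \<le> 1) \<and> (\<forall>n. \<forall>k<2*N n+1. norm (Y n k) = s k) \<and>
    (\<forall>n k. q k = (\<lambda>_. 0) \<longrightarrow> Y n k = 0) \<and>
    (\<forall>n. \<forall>i<N n. \<forall>T\<in>\<O>. norm (blinfun_apply T (Y n i) - (\<Sum>k<2*i+3. mat T i k *\<^sub>R Y n k)) \<le> \<eta> n)"
    using copies_exist[OF e0 \<eta>(1), of N] ..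
  then have YR: "Y n k \<in> R"
    and Yo: "p \<noteq> p' \<Longrightarrow> inner (Y (fst p) (snd p)) (Y (fst p') (snd p')) = 0"
    and Ye: "inner (Y n k) e0 = 0" and Y1: "norm (Y n k) \<le> 1"
    and Ys: "k < 2 * N n + 1 \<Longrightarrow> norm (Y n k) = s k"
    and Yq: "q k = (\<lambda>_. 0) \<Longrightarrow> Y n k = 0"
    and Yerr: "i < N n \<Longrightarrow> T \<in> \<O> \<Longrightarrow>
      norm (blinfun_apply T (Y n i) - (\<Sum>k<2*i+3. mat T i k *\<^sub>R Y n k)) \<le> \<eta> n" for n k p p' i T
    by (simp_all add: prod_eq_iff)
  have Yo': "inner (Y n k) (Y n' k') = 0" if "n \<noteq> n' \<or> k \<noteq> k'" for n k n' k'
    using Yo[of "(n, k)" "(n', k')"] that by auto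
  define bd where "bd i = lev i + 2" for i
  define v where "v i = (\<Sum>n<bd i. G n (lev i) *\<^sub>R Y n i)" for i
  have v_eq: "v i = (\<Sum>n<K. G n (lev i) *\<^sub>R Y n i)" if "K \<ge> bd i" for i K
    unfolding v_def by (rule sum.mono_neutral_left) (use that G0 in \<open>auto simp: bd_def\<close>)
  have vR: "v i \<in> R" for i unfolding v_def by (intro subspace_sum[OF R] subspace_scale[OF R] YR)
  have v0: "v i = 0" if "q i = (\<lambda>_. 0)" for i unfolding v_def by (simp add: Yq[OF that])
  have ve: "inner (v i) e0 = 0" for i by (simp add: v_def inner_sum_left Ye)
  have vo: "inner (v i) (v l) = 0" if "i \<noteq> l" for i l
    unfolding v_def inner_sum_left inner_sum_right using that by (simp add: Yo')
  have vs: "inner (v i) (v i) = s i" for i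
  proof -
    have "inner (v i) (v i) = (\<Sum>n<bd i. \<Sum>n'<bd i. if n' = n then (G n (lev i))\<^sup>2 * inner (Y n i) (Y n i) else 0)"
      unfolding v_def inner_sum_left inner_sum_right
      by (subst sum.swap) (intro sum.cong refl, auto simp: Yo' power2_eq_square)
    also have "\<dots> = (\<Sum>n<bd i. (G n (lev i))\<^sup>2 * inner (Y n i) (Y n i))" by simp
    also have "\<dots> = (\<Sum>n<bd i. (G n (lev i))\<^sup>2 * s i)"
    proof (intro sum.cong refl)
      fix n
      show "(G n (lev i))\<^sup>2 * inner (Y n i) (Y n i) = (G n (lev i))\<^sup>2 * s i"
      proof (cases "i < N n")
        case True
        then have "norm (Y n i) = s i" using Ys by simp
        then have "inner (Y n i) (Y n i) = (s i)\<^sup>2" by (simp flip: power2_norm_eq_inner)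
        then show ?thesis by (simp add: s_def)
      qed (simp add: N)
    qed
    also have "\<dots> = s i" using G1[of "lev i" "bd i"] by (simp add: bd_def flip: sum_distrib_right)
    finally show ?thesis .
  qed
  have onz: "orthonormal_or_zero v"
    unfolding orthonormal_or_zero_def
  proof (intro conjI allI impI)
    show "v n = 0 \<or> norm (v n) = 1" for n
      using vs[of n] v0[of n] by (cases "q n = (\<lambda>_. 0)") (auto simp: s_def norm_eq_sqrt_inner)
  qed (rule vo)
  have v0nz: "v 0 \<noteq> 0" using vs[of 0] q_0_nonzero by (auto simp: s_def)
  have main: "\<exists>d M. norm (blinfun_apply T (\<Sum>i<N'. c i *\<^sub>R v i) - (\<Sum>k<M. d k *\<^sub>R v k))
       \<le> \<epsilon> * norm (\<Sum>i<N'. c i *\<^sub>R v i)" if T: "T \<in> \<O>" for T c N'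
  proof -
    \<comment> \<open>Coefficients of vanishing \<open>v i\<close> are replaced by 0, so that the
      norm of w is the euclidean norm of c'.\<close>
    define c' where "c' i = (if q i = (\<lambda>_. 0) then 0 else c i)" for i
    define w where "w = (\<Sum>i<N'. c i *\<^sub>R v i)"
    \<comment> \<open>M exceeds every k with a nonzero entry \<open>mat T i k\<close>, i < N', and K
      takes in every copy with nonzero weight on the levels up to that of M.\<close>
    define M where "M = 2 * N' + 1"
    define K where "K = lev M + 2"
    have K: "K \<ge> bd i" if "i \<le> M" for i using lev_mono[OF that] by (simp add: K_def bd_def)
    have w': "w = (\<Sum>i<N'. c' i *\<^sub>R v i)"
      unfolding w_def c'_def by (intro sum.cong refl) (simp add: v0)
    have nw: "(norm w)\<^sup>2 = (\<Sum>i<N'. (c' i)\<^sup>2)"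
    proof -
      have "(norm w)\<^sup>2 = (\<Sum>i<N'. \<Sum>l<N'. if l = i then (c' i)\<^sup>2 * s i else 0)"
        unfolding w' power2_norm_eq_inner inner_sum_left inner_sum_right
        by (subst sum.swap) (intro sum.cong refl, auto simp: vo vs power2_eq_square)
      also have "\<dots> = (\<Sum>i<N'. (c' i)\<^sup>2)" by (auto simp: s_def c'_def intro!: sum.cong)
      finally show ?thesis .
    qed
    have c'_le: "\<bar>c' i\<bar> \<le> norm w" if "i < N'" for i
    proof -
      have "(c' i)\<^sup>2 \<le> (norm w)\<^sup>2" unfolding nw by (rule member_le_sum) (use that in auto)
      then show ?thesis using abs_le_square_iff[of "c' i" "norm w"] by simp
    qed
    define d where "d k = (\<Sum>i<N'. c' i * mat T i k)" for k
    define err where "err n i = blinfun_apply T (Y n i) - (\<Sum>k<M. mat T i k *\<^sub>R Y n k)" for n i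
    define \<beta> where "\<beta> n k = (\<Sum>i<N'. c' i * mat T i k * (G n (lev i) - G n (lev k)))" for n k
    have err: "norm (err n i) \<le> \<eta> n" if "i < N'" "i < N n" for n i
    proof -
      have "(\<Sum>k<M. mat T i k *\<^sub>R Y n k) = (\<Sum>k<2*i+3. mat T i k *\<^sub>R Y n k)"
        by (rule sum.mono_neutral_right) (use that mat_zero[OF T] in \<open>auto simp: M_def\<close>)
      then show ?thesis using Yerr[OF that(2) T] by (simp add: err_def)
    qed
    define E1 where "E1 = (\<Sum>n<K. \<Sum>i<N'. (c' i * G n (lev i)) *\<^sub>R err n i)"
    define E2 where "E2 = (\<Sum>n<K. \<Sum>k<M. \<beta> n k *\<^sub>R Y n k)"
    have split: "T w - (\<Sum>k<M. d k *\<^sub>R v k) = E1 + E2"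
    proof -
      have 1: "T w = (\<Sum>n<K. \<Sum>i<N'. (c' i * G n (lev i)) *\<^sub>R T (Y n i))"
      proof -
        have "w = (\<Sum>i<N'. c' i *\<^sub>R (\<Sum>n<K. G n (lev i) *\<^sub>R Y n i))"
          unfolding w' by (intro sum.cong refl) (simp add: v_eq[OF K] M_def)
        then have "T w = (\<Sum>i<N'. \<Sum>n<K. (c' i * G n (lev i)) *\<^sub>R T (Y n i))"
          by (simp add: blinfun.sum_right blinfun.scaleR_right scaleR_sum_right)
        then show ?thesis by (simp only: sum.swap[of _ "{..<K}"])
      qed
      have 2: "(\<Sum>k<M. d k *\<^sub>R v k) = (\<Sum>n<K. \<Sum>k<M. (\<Sum>i<N'. c' i * mat T i k * G n (lev k)) *\<^sub>R Y n k)"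
      proof -
        have "(\<Sum>k<M. d k *\<^sub>R v k) = (\<Sum>k<M. \<Sum>n<K. (\<Sum>i<N'. c' i * mat T i k * G n (lev k)) *\<^sub>R Y n k)"
          by (intro sum.cong refl) (simp add: v_eq[OF K] d_def scaleR_sum_right sum_distrib_right)
        then show ?thesis by (simp only: sum.swap[of _ "{..<K}"])
      qed
      have 3: "(\<Sum>i<N'. (c' i * G n (lev i)) *\<^sub>R (\<Sum>k<M. mat T i k *\<^sub>R Y n k))
          = (\<Sum>k<M. (\<Sum>i<N'. c' i * mat T i k * G n (lev i)) *\<^sub>R Y n k)" for n
      proof -
        have "(\<Sum>i<N'. (c' i * G n (lev i)) *\<^sub>R (\<Sum>k<M. mat T i k *\<^sub>R Y n k))
          = (\<Sum>i<N'. \<Sum>k<M. (c' i * mat T i k * G n (lev i)) *\<^sub>R Y n k)"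
          by (simp add: scaleR_sum_right mult_ac)
        also have "\<dots> = (\<Sum>k<M. \<Sum>i<N'. (c' i * mat T i k * G n (lev i)) *\<^sub>R Y n k)" by (rule sum.swap)
        finally show ?thesis by (simp add: scaleR_sum_left)
      qed
      have "E1 = T w - (\<Sum>n<K. \<Sum>k<M. (\<Sum>i<N'. c' i * mat T i k * G n (lev i)) *\<^sub>R Y n k)"
        unfolding E1_def err_def 1 scaleR_diff_right sum_subtractf 3 ..
      moreover have "E2 = (\<Sum>n<K. \<Sum>k<M. (\<Sum>i<N'. c' i * mat T i k * G n (lev i)) *\<^sub>R Y n k) - (\<Sum>k<M. d k *\<^sub>R v k)"
        unfolding 2 E2_def \<beta>_def by (simp add: right_diff_distrib sum_subtractf scaleR_diff_left)
      ultimately show ?thesis by simp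
    qed
    have E1: "norm E1 \<le> \<epsilon>/2 * norm w"
    proof -
      have "norm (\<Sum>i<N'. (c' i * G n (lev i)) *\<^sub>R err n i) \<le> norm w * ((\<epsilon>/4) * (1/2)^n)" for n
      proof -
        have t: "norm ((c' i * G n (lev i)) *\<^sub>R err n i) \<le> (if i < N n then norm w * \<eta> n else 0)" if "i < N'" for i
        proof (cases "i < N n")
          case True
          have "norm ((c' i * G n (lev i)) *\<^sub>R err n i) = \<bar>c' i\<bar> * \<bar>G n (lev i)\<bar> * norm (err n i)"
            by (simp add: abs_mult)
          also have "\<dots> \<le> norm w * 1 * \<eta> n"
            using c'_le[OF that] G_le_1 err[OF that True] by (intro mult_mono) auto
          finally show ?thesis using True by simp
        qed (simp add: N)
        have "norm (\<Sum>i<N'. (c' i * G n (lev i)) *\<^sub>R err n i) \<le> (\<Sum>i<N'. if i < N n then norm w * \<eta> n else 0)"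
          by (rule order_trans[OF norm_sum sum_mono]) (use t in auto)
        also have "\<dots> = (\<Sum>i\<in>{..<N'} \<inter> {..<N n}. norm w * \<eta> n)"
          by (subst sum.inter_restrict) (auto intro!: sum.cong)
        also have "\<dots> \<le> (\<Sum>i<N n. norm w * \<eta> n)"
          using less_imp_le[OF \<eta>(1)] by (intro sum_mono2) auto
        also have "\<dots> = norm w * (real (N n) * \<eta> n)" by simp
        also have "\<dots> = norm w * ((\<epsilon>/4) * (1/2)^n)" unfolding \<eta>(2) ..
        finally show ?thesis .
      qed
      then have "norm E1 \<le> (\<Sum>n<K. norm w * ((\<epsilon>/4) * (1/2)^n))"
        unfolding E1_def by (intro order_trans[OF norm_sum sum_mono])
      also have "\<dots> = norm w * (\<epsilon>/4) * (\<Sum>n<K. (1/2)^n)" by (simp add: sum_distrib_left mult.assoc)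
      also have "\<dots> \<le> norm w * (\<epsilon>/4) * 2"
        using \<epsilon> by (intro mult_left_mono) (auto simp: sum_gp_strict)
      finally show ?thesis by simp
    qed
    have E2: "norm E2 \<le> \<epsilon>/2 * norm w"
    proof -
      have "E2 = (\<Sum>p\<in>{..<K}\<times>{..<M}. \<beta> (fst p) (snd p) *\<^sub>R Y (fst p) (snd p))"
        by (simp add: E2_def sum.cartesian_product split_def)
      then have "(norm E2)\<^sup>2 \<le> (\<Sum>p\<in>{..<K}\<times>{..<M}. (\<beta> (fst p) (snd p))\<^sup>2)"
        using norm_sum_orthogonal_le[of "{..<K}\<times>{..<M}" "\<lambda>p. Y (fst p) (snd p)" "\<lambda>p. \<beta> (fst p) (snd p)"] Yo Y1
        by simp
      also have "\<dots> = (\<Sum>n<K. \<Sum>k<M. (\<beta> n k)\<^sup>2)" by (simp add: sum.cartesian_product split_def)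
      also have "\<dots> \<le> 3 * \<delta> * B * (\<Sum>i<N'. (c' i)\<^sup>2)"
        unfolding \<beta>_def
      proof (rule block_tridiagonal_bound[where a="mat T" and lev=lev and G=G and K=K and \<delta>=\<delta>, OF mat_levels[OF T] _ G2])
        fix I :: "nat set" and c :: "nat \<Rightarrow> real" assume "finite I"
        have "(norm T)\<^sup>2 * (\<Sum>i\<in>I. (c i)\<^sup>2) \<le> B * (\<Sum>i\<in>I. (c i)\<^sup>2)"
          by (intro mult_right_mono B T sum_nonneg) auto
        then show "(\<Sum>k<M. (\<Sum>i\<in>I. c i * mat T i k)\<^sup>2) \<le> B * (\<Sum>i\<in>I. (c i)\<^sup>2)"
          using mat_bound[OF T \<open>finite I\<close>, of c M] by linarith
      qed
      also have "\<dots> = (\<epsilon>/2 * norm w)\<^sup>2" unfolding \<delta>(2) by (simp only: nw[symmetric] power_mult_distrib)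
      finally show ?thesis using \<epsilon> by (intro power2_le_imp_le[of "norm E2"]) auto
    qed
    have "norm (T w - (\<Sum>k<M. d k *\<^sub>R v k)) \<le> \<epsilon> * norm w"
      unfolding split using norm_triangle_ineq[of E1 E2] E1 E2 by simp
    then show ?thesis unfolding w_def by blast
  qed
  show ?thesis using vR onz v0nz ve main by (intro exI[of _ v]) auto
qed

end

section \<open>Density of the reducible operators\<close>

lemma orthonormal_weakly_null:
  fixes x :: "nat \<Rightarrow> 'a::real_inner"
  assumes "\<And>m n. inner (x m) (x n) = (if m = n then 1 else 0)"
  shows "(\<lambda>n. inner (x n) y) \<longlonglongrightarrow> 0"
proof -
  have n1: "norm (x n) = 1" for n using assms[of n n] by (simp add: norm_eq_sqrt_inner)
  have bessel: "(\<Sum>i<n. (inner (x i) y)\<^sup>2) \<le> (norm y)\<^sup>2" for n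
  proof -
    define S where "S = (\<Sum>i<n. (inner (x i) y)\<^sup>2)"
    define z where "z = (\<Sum>i<n. inner (x i) y *\<^sub>R x i)"
    have S0: "S \<ge> 0" unfolding S_def by (intro sum_nonneg) simp
    have "(norm z)\<^sup>2 \<le> S"
      unfolding z_def S_def by (rule norm_sum_orthogonal_le) (simp_all add: assms n1)
    moreover have "inner z y = S" by (simp add: z_def S_def inner_sum_left power2_eq_square)
    then have "S \<le> norm z * norm y" using norm_cauchy_schwarz[of z y] by simp
    then have "S\<^sup>2 \<le> (norm z)\<^sup>2 * (norm y)\<^sup>2" using S0 by (metis power_mono power_mult_distrib)
    ultimately have "S * S \<le> S * (norm y)\<^sup>2"
      by (metis mult_right_mono order_trans power2_eq_square zero_le_power2)
    then show ?thesis using S0 unfolding S_def[symmetric] by (cases "S = 0") (auto simp: mult_le_cancel_left)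
  qed
  have "summable (\<lambda>i. (inner (x i) y)\<^sup>2)"
    by (rule summableI_nonneg_bounded[OF _ bessel]) simp
  then have "(\<lambda>i. sqrt ((inner (x i) y)\<^sup>2)) \<longlonglongrightarrow> sqrt 0"
    by (intro tendsto_real_sqrt summable_LIMSEQ_zero)
  then show ?thesis by (simp add: tendsto_rabs_zero_iff)
qed

text \<open>Every vector is an eigenvector of D = 0, so \<open>real_eigenbasis_exists\<close> gives
  a basis of C-fixed vectors. If only finitely many were nonzero, they would span the space over the
  complex numbers.\<close>

lemma infinite_real_orthonormal_sequence:
  fixes C :: "'a::complex_hilbert_space \<Rightarrow> 'a"
  assumes sep: "separable_space (euclidean :: 'a topology)"
    and C: "conjugation C" and inf: "\<not> finite_cdim TYPE('a)"
  shows "\<exists>x :: nat \<Rightarrow> 'a. (\<forall>n. C (x n) = x n) \<and> (\<forall>m n. inner (x m) (x n) = (if m = n then 1 else 0))"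
proof -
  have "{y. \<exists>t. (0::'a \<Rightarrow>\<^sub>L 'a) y = t *\<^sub>R y} = UNIV" by (auto intro: exI[of _ 0])
  then have "span {y. \<exists>t. (0::'a \<Rightarrow>\<^sub>L 'a) y = t *\<^sub>R y} = UNIV" by (simp add: span_UNIV)
  from real_eigenbasis_exists[OF sep C conj_real_0[OF C] this]
  obtain e where e: "orthonormal_or_zero e" "\<And>n. C (e n) = e n"
    and total: "\<And>x. (\<And>n. inner x (e n) = 0 \<and> inner x (\<i> *\<^sub>C e n) = 0) \<Longrightarrow> x = 0"
    by auto
  have eo: "inner (e m) (e n) = 0" if "m \<noteq> n" for m n using e(1) that by (auto simp: orthonormal_or_zero_def)
  have en: "inner (e n) (e n) = 1" if "e n \<noteq> 0" for n
    using e(1) that by (auto simp: orthonormal_or_zero_def simp flip: power2_norm_eq_inner)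
  have eJ: "inner (e m) (\<i> *\<^sub>C e n) = 0" for m n by (rule conj_real_inner_imag[OF C e(2) e(2)])
  define I where "I = {n. e n \<noteq> 0}"
  have "infinite I"
  proof
    assume fin: "finite I"
    have "x \<in> complex_vector.span (e ` I)" for x
    proof -
      define p where "p = (\<Sum>n\<in>I. inner x (e n) *\<^sub>R e n + inner x (\<i> *\<^sub>C e n) *\<^sub>R (\<i> *\<^sub>C e n))"
      have "x - p = 0"
      proof (rule total)
        fix m
        have p1: "inner p (e m) = (\<Sum>n\<in>I. if n = m then inner x (e m) else 0)"
          unfolding p_def inner_sum_left
          by (intro sum.cong refl) (auto simp: inner_add_left inner_imag_left eJ eo en I_def)
        have p2: "inner p (\<i> *\<^sub>C e m) = (\<Sum>n\<in>I. if n = m then inner x (\<i> *\<^sub>C e m) else 0)"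
          unfolding p_def inner_sum_left
          by (intro sum.cong refl) (auto simp: inner_add_left inner_imag_both eJ eo en I_def)
        show "inner (x - p) (e m) = 0 \<and> inner (x - p) (\<i> *\<^sub>C e m) = 0"
          using fin by (cases "e m = 0") (auto simp: inner_diff_left p1 p2 I_def complex_vector.scale_zero_right)
      qed
      moreover have "p \<in> complex_vector.span (e ` I)"
        unfolding p_def scaleR_eq_scaleC
        by (intro complex_vector.span_sum complex_vector.span_add complex_vector.span_scale complex_vector.span_base) auto
      ultimately show ?thesis by simp
    qed
    then have "finite_cdim TYPE('a)" unfolding finite_cdim_def using fin by (intro exI[of _ "e ` I"]) auto
    with inf show False by simp
  qed
  define x where "x n = e (enumerate I n)" for n
  have "inner (x m) (x n) = (if m = n then 1 else 0)" for m n
  proof (cases "m = n")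
    case True
    then show ?thesis using enumerate_in_set[OF \<open>infinite I\<close>, of n] by (simp add: x_def I_def en)
  next
    case False
    then have "enumerate I m \<noteq> enumerate I n"
      using strict_mono_enumerate[OF \<open>infinite I\<close>] by (simp add: strict_mono_eq)
    then show ?thesis using False by (simp add: x_def eo)
  qed
  then show ?thesis using e(2) by (intro exI[of _ x]) (auto simp: x_def)
qed

text \<open>Words in \<open>A\<close> and \<open>B\<close>, enumerated in the order of a binary heap: the word number \<open>k\<close> has
  length \<open>floor_log (k + 1)\<close>.\<close>

fun word_op :: "('a::real_normed_vector \<Rightarrow>\<^sub>L 'a) \<Rightarrow> ('a \<Rightarrow>\<^sub>L 'a) \<Rightarrow> nat \<Rightarrow> 'a \<Rightarrow>\<^sub>L 'a" where
  "word_op A B 0 = id_blinfun"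
| "word_op A B (Suc n) = (if even n then A else B) o\<^sub>L word_op A B (n div 2)"

lemma word_op_step: "word_op A B (2*k+1) = A o\<^sub>L word_op A B k" "word_op A B (2*k+2) = B o\<^sub>L word_op A B k"
  by simp_all

lemma word_op_real:
  assumes "conj_real C A" "conj_real C B" "C x = x"
  shows "C (word_op A B k x) = word_op A B k x"
proof (induction k rule: less_induct)
  case (less k)
  show ?case
  proof (cases k)
    case (Suc n)
    then have "n div 2 < k" by simp
    from less[OF this] show ?thesis using Suc assms(1,2) by (simp flip: conj_realD(3))
  qed (simp add: assms)
qed

text \<open>Just enough of an adjoint to carry weak convergence to 0 from the vectors over to their
  images under a word.\<close>

lemma word_op_adjoint:
  assumes "symmetric_op A" "symmetric_op B"
  shows "\<exists>z. \<forall>x. inner (word_op A B k x) y = inner x z"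
proof (induction k arbitrary: y rule: less_induct)
  case (less k)
  show ?case
  proof (cases k)
    case (Suc n)
    then have "n div 2 < k" by simp
    from less[OF this] show ?thesis using Suc assms by (auto simp: symmetric_opD)
  qed auto
qed

lemma almost_reducing_sequence_exists:
  fixes A B :: "'a::complex_hilbert_space \<Rightarrow>\<^sub>L 'a"
  assumes sep: "separable_space (euclidean :: 'a topology)"
    and C: "conjugation C" and inf: "\<not> finite_cdim TYPE('a)"
    and A: "conj_real C A" and B: "conj_real C B" and \<epsilon>: "\<epsilon> > 0"
  obtains v e0 where "\<And>i. C (v i) = v i" "C e0 = e0" "norm e0 = 1" "v 0 \<noteq> 0" "\<And>i. inner (v i) e0 = 0"
    "\<And>T c N. T \<in> {A, B} \<Longrightarrow> \<exists>d M. norm (blinfun_apply T (\<Sum>i<N. c i *\<^sub>R v i) - (\<Sum>k<M. d k *\<^sub>R v k))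
       \<le> \<epsilon> * norm (\<Sum>i<(N::nat). c i *\<^sub>R v i)"
proof -
  obtain x :: "nat \<Rightarrow> 'a" where xC: "\<And>n. C (x n) = x n"
    and xo: "\<And>m n. inner (x m) (x n) = (if m = n then 1 else 0)"
    using infinite_real_orthonormal_sequence[OF sep C inf] by blast
  have x1: "norm (x n) = 1" for n using xo[of n n] by (simp add: norm_eq_sqrt_inner)
  define U where "U = word_op A B"
  \<comment> \<open>Pairs of words are coded as single numbers, so that one diagonal subsequence
    makes all their inner products converge.\<close>
  define g where "g n p = inner (U (fst (prod_decode p)) (x n)) (U (snd (prod_decode p)) (x n))" for n p
  have "bounded (range (\<lambda>n. g n p))" for p
    unfolding bounded_iff
  proof (intro exI ballI)
    fix y assume "y \<in> range (\<lambda>n. g n p)"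
    then obtain n where y: "y = g n p" by blast
    show "norm y \<le> norm (U (fst (prod_decode p))) * norm (U (snd (prod_decode p)))"
      unfolding y g_def real_norm_def
      using norm_blinfun[of "U (fst (prod_decode p))" "x n"] norm_blinfun[of "U (snd (prod_decode p))" "x n"] x1[of n]
      by (intro order_trans[OF Cauchy_Schwarz_ineq2] mult_mono) auto
  qed
  then obtain r where r: "strict_mono r" "\<And>p. convergent (\<lambda>n. g (r n) p)"
    using simultaneously_convergent_subsequence[of g] by blast
  define f where "f k j = U k (x (r j))" for k j
  have sA: "symmetric_op A" "symmetric_op B" using conj_realD(4)[OF A] conj_realD(4)[OF B] by auto
  define R where "R = {x. C x = x}"
  interpret asymptotic_model f R "{A, B}"
  proof
    show "convergent (\<lambda>j. inner (f k j) (f l j))" for k l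
      using r(2)[of "prod_encode (k, l)"] by (simp add: g_def f_def)
    show "subspace R"
      using conj_scaleR[OF C, of 0] by (auto simp: subspace_def R_def conj_add[OF C] conj_scaleR[OF C])
    show "f k j \<in> R" for k j
      unfolding R_def f_def U_def using word_op_real[OF A B xC] by simp
    show "symmetric_op T" if "T \<in> {A, B}" for T using that sA by auto
    show "\<exists>l\<le>2*k+2. \<forall>j. T (f k j) = f l j" if "T \<in> {A, B}" for T k
    proof (cases "T = A")
      case True
      then show ?thesis unfolding f_def U_def
        by (intro exI[of _ "2*k+1"]) (simp only: word_op_step, simp)
    next
      case False
      then show ?thesis using that unfolding f_def U_def
        by (intro exI[of _ "2*k+2"]) (simp only: word_op_step, simp)
    qed
    show "(\<lambda>j. inner (f k j) y) \<longlonglongrightarrow> 0" for k y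
    proof -
      obtain z where z: "\<And>x. inner (U k x) y = inner x z"
        using word_op_adjoint[OF sA, of k y] unfolding U_def by blast
      have "(\<lambda>j. inner (x (r j)) z) \<longlonglongrightarrow> 0"
        using LIMSEQ_subseq_LIMSEQ[OF orthonormal_weakly_null[of x z, OF xo] r(1)] by (simp add: o_def)
      then show ?thesis by (simp add: f_def z)
    qed
    show "norm (f 0 j) = 1" for j by (simp add: f_def U_def x1)
  qed auto
  \<comment> \<open>x 0 is the vector that all copies avoid, which keeps the final projection
    different from the identity.\<close>
  have "x 0 \<in> R" by (simp add: R_def xC)
  from almost_reducing_sequence[OF this x1 \<epsilon>]
  obtain v where "(\<forall>i. v i \<in> R) \<and> orthonormal_or_zero v \<and> v 0 \<noteq> 0 \<and> (\<forall>i. inner (v i) (x 0) = 0) \<and>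
    (\<forall>T\<in>{A, B}. \<forall>c N. \<exists>d M. norm (blinfun_apply T (\<Sum>i<N. c i *\<^sub>R v i) - (\<Sum>k<M. d k *\<^sub>R v k))
       \<le> \<epsilon> * norm (\<Sum>i<N. c i *\<^sub>R v i))" ..
  then show thesis using xC x1 by (intro that[of v "x 0"]) (auto simp: R_def)
qed

lemma span_range_finite_sum:
  fixes v :: "nat \<Rightarrow> 'a::real_vector"
  assumes "a \<in> span (range v)"
  shows "\<exists>N c. a = (\<Sum>i<(N::nat). c i *\<^sub>R v i)"
  using assms
proof (induction rule: span_induct_alt)
  case base
  show ?case by (rule exI[of _ 0]) simp
next
  case (step r x y)
  then obtain N c k where y: "y = (\<Sum>i<N. c i *\<^sub>R v i)" and x: "x = v k" by blast
  define M where "M = max N (Suc k)"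
  have "y = (\<Sum>i<M. (if i < N then c i else 0) *\<^sub>R v i)"
    unfolding y by (rule sum.mono_neutral_cong_left) (auto simp: M_def)
  moreover have "k < M" by (simp add: M_def)
  then have "r *\<^sub>R x = (\<Sum>i<M. if i = k then r *\<^sub>R v i else 0)" by (simp add: x)
  then have "r *\<^sub>R x = (\<Sum>i<M. (if i = k then r else 0) *\<^sub>R v i)"
    by (simp only: if_distrib[of "\<lambda>t. t *\<^sub>R _"] scaleR_zero_left)
  ultimately have "r *\<^sub>R x + y = (\<Sum>i<M. ((if i = k then r else 0) + (if i < N then c i else 0)) *\<^sub>R v i)"
    by (simp only: scaleR_add_left sum.distrib)
  then show ?case by (intro exI[of _ M] exI)
qed

lemma subspace_closure:
  fixes S :: "'a::real_normed_vector set"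
  assumes S: "subspace S"
  shows "subspace (closure S)"
  unfolding subspace_def
proof (intro conjI ballI allI)
  show "0 \<in> closure S" using subspace_0[OF S] closure_subset by blast
next
  fix x y assume "x \<in> closure S" "y \<in> closure S"
  then obtain X Y where "\<And>n. X n \<in> S" "X \<longlonglongrightarrow> x" "\<And>n. Y n \<in> S" "Y \<longlonglongrightarrow> y"
    by (auto simp: closure_sequential)
  then have "\<forall>n. X n + Y n \<in> S" "(\<lambda>n. X n + Y n) \<longlonglongrightarrow> x + y"
    using subspace_add[OF S] by (auto intro: tendsto_add)
  then show "x + y \<in> closure S" unfolding closure_sequential by (intro exI[of _ "\<lambda>n. X n + Y n"]) simp
next
  fix c x assume "x \<in> closure S"
  then obtain X where "\<And>n. X n \<in> S" "X \<longlonglongrightarrow> x" by (auto simp: closure_sequential)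
  then have "\<forall>n. c *\<^sub>R X n \<in> S" "(\<lambda>n. c *\<^sub>R X n) \<longlonglongrightarrow> c *\<^sub>R x"
    using subspace_scale[OF S] by (auto intro: tendsto_scaleR)
  then show "c *\<^sub>R x \<in> closure S" unfolding closure_sequential by (intro exI[of _ "\<lambda>n. c *\<^sub>R X n"]) simp
qed

text \<open>P projects onto the closed complex span W of v. W is invariant under i and C, so P is
  complex linear and C-real; W contains v 0 and is orthogonal to e0, so P is nontrivial. The
  estimate for v bounds (1 - P) T P; complex combinations have two real parts, hence the start with
  \<epsilon> / 2.\<close>

lemma almost_commuting_projection:
  fixes A B :: "'a::complex_hilbert_space \<Rightarrow>\<^sub>L 'a"
  assumes sep: "separable_space (euclidean :: 'a topology)"
    and C: "conjugation C" and inf: "\<not> finite_cdim TYPE('a)"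
    and A: "conj_real C A" and B: "conj_real C B" and \<epsilon>: "\<epsilon> > 0"
  shows "\<exists>P. conj_real C P \<and> orthogonal_projection P \<and> P \<noteq> 0 \<and> P \<noteq> id_blinfun \<and>
    (\<forall>T\<in>{A, B}. \<forall>x. norm (T (P x) - P (T (P x))) \<le> \<epsilon> * norm x)"
proof (rule almost_reducing_sequence_exists[OF sep C inf A B half_gt_zero[OF \<epsilon>]])
  fix v e0
  assume vC: "\<And>i. C (v i) = v i" and e0: "C e0 = e0" "norm e0 = 1" and v0: "v 0 \<noteq> 0"
    and ve: "\<And>i. inner (v i) e0 = 0"
    and ar: "\<And>T c N. T \<in> {A, B} \<Longrightarrow> \<exists>d M. norm (blinfun_apply T (\<Sum>i<N. c i *\<^sub>R v i) - (\<Sum>k<M. d k *\<^sub>R v k))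
       \<le> \<epsilon>/2 * norm (\<Sum>i<(N::nat). c i *\<^sub>R v i)"
  define S where "S = span (range v \<union> range (\<lambda>n. \<i> *\<^sub>C v n))"
  define W where "W = closure S"
  have subS: "subspace S" and subW: "subspace W" and clW: "closed W" and SW: "S \<subseteq> W"
    by (simp_all add: S_def W_def closure_subset subspace_closure)
  obtain P where P: "is_projection_onto P W" using projection_exists[OF subW clW] by blast
  have vS: "v n \<in> S" "\<i> *\<^sub>C v n \<in> S" for n unfolding S_def by (auto intro: span_base)
  have inS: "h x \<in> S" if h: "bounded_linear h" "\<And>n. h (v n) \<in> S" "\<And>n. h (\<i> *\<^sub>C v n) \<in> S" and "x \<in> S" for h x
  proof -
    have lin: "linear h" by (rule bounded_linear.linear[OF h(1)])
    have "S \<subseteq> h -` S" unfolding S_def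
      by (rule span_minimal) (use h(2,3) linear_subspace_vimage[OF lin] in \<open>auto simp: S_def\<close>)
    then show ?thesis using \<open>x \<in> S\<close> by blast
  qed
  have inW: "h x \<in> W" if h: "bounded_linear h" "\<And>n. h (v n) \<in> S" "\<And>n. h (\<i> *\<^sub>C v n) \<in> S" and "x \<in> W" for h x
  proof -
    have "continuous_on (closure S) h" by (rule linear_continuous_on[OF h(1)])
    moreover have "h ` S \<subseteq> W" using inS[OF h] SW by blast
    ultimately have "h ` closure S \<subseteq> W" using clW image_closure_subset by blast
    then show ?thesis using \<open>x \<in> W\<close> by (auto simp: W_def)
  qed
  have iW: "\<i> *\<^sub>C x \<in> W" if "x \<in> W" for x
    by (rule inW[OF bounded_linear_scaleC _ _ that]) (use vS subspace_neg[OF subS] in \<open>auto simp: imag_imag\<close>)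
  have CW: "C x \<in> W" if "x \<in> W" for x
    by (rule inW[OF conj_bounded_linear[OF C] _ _ that])
      (use vS subspace_neg[OF subS] in \<open>auto simp: vC conj_imag[OF C]\<close>)
  have Ps: "inner (P x) y = inner x (P y)" for x y by (rule symmetric_opD[OF symmetric_projection[OF P]])
  have PP: "P (P x) = P x" for x by (rule idem_projection[OF P])
  have PW: "P x \<in> W" for x using P by (simp add: is_projection_onto_def)
  have Pid: "P x = x" if "x \<in> W" for x using P that by (simp add: is_projection_onto_def)
  have Pi: "P (\<i> *\<^sub>C x) = \<i> *\<^sub>C P x" for x
    using projection_comm[OF P, of imag_op "\<lambda>x. - (\<i> *\<^sub>C x)" x] iW subW
    by (simp add: inner_imag_left subspace_neg)
  define K where "K = Blinfun C"
  have K: "K x = C x" for x by (simp add: K_def bounded_linear_Blinfun_apply conj_bounded_linear[OF C])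
  have "P (K x) = K (P x)" for x
    by (rule projection_comm[OF P, where S'=C]) (auto simp: K CW conj_inner[OF C])
  then have Pr: "conj_real C P" by (intro conj_realI) (auto simp: Pi Ps K)
  then have Po: "orthogonal_projection P"
    by (simp add: orthogonal_projection_iff PP conj_real_def)
  have "P (v 0) = v 0" using Pid SW vS(1) by blast
  then have "P \<noteq> 0" using v0 by auto
  have eW: "inner w e0 = 0" if "w \<in> W" for w
  proof -
    have "S \<subseteq> {w. inner w e0 = 0}" unfolding S_def
      by (rule span_minimal)
        (use ve conj_real_inner_imag[OF C vC e0(1)] in \<open>auto simp: subspace_def inner_add_left inner_imag_left\<close>)
    moreover have "closed {w. inner w e0 = 0}" by (intro closed_Collect_eq continuous_intros)
    ultimately have "W \<subseteq> {w. inner w e0 = 0}" unfolding W_def by (rule closure_minimal)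
    then show ?thesis using that by blast
  qed
  have "P \<noteq> id_blinfun"
  proof
    assume "P = id_blinfun"
    then have "inner e0 e0 = 0" using eW[OF PW[of e0]] by simp
    then show False using e0 by auto
  qed
  have Qn: "norm (y - P y) \<le> norm y" for y
    using orthogonal_projection_norm_le[OF orthogonal_projection_complement[OF Po], of y] by (simp add: blinfun.diff_left)
  have key: "norm (T w - P (T w)) \<le> \<epsilon> * norm w" if T: "T \<in> {A, B}" and w: "w \<in> W" for T w
  proof -
    have TC: "conj_real C T" using T A B by auto
    have real_part: "norm (T a - P (T a)) \<le> \<epsilon>/2 * norm a" if a: "a \<in> span (range v)" for a
    proof -
      obtain N c where aN: "a = (\<Sum>i<(N::nat). c i *\<^sub>R v i)" using span_range_finite_sum[OF a] by blast
      obtain d M where dM: "norm (T a - (\<Sum>k<(M::nat). d k *\<^sub>R v k)) \<le> \<epsilon>/2 * norm a"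
        using ar[OF T, of c N] unfolding aN by blast
      define z where "z = (\<Sum>k<M. d k *\<^sub>R v k)"
      have "z \<in> W" unfolding z_def using SW vS(1) by (intro subspace_sum[OF subW] subspace_scale[OF subW]) blast
      \<comment> \<open>1 - P annihilates the approximating combination z and does not increase
        norms.\<close>
      then have eq: "T a - P (T a) = (T a - z) - P (T a - z)" by (simp add: blinfun.diff_right Pid)
      show ?thesis unfolding eq using Qn[of "T a - z"] dM unfolding z_def by (rule order_trans)
    qed
    have "norm (T w - P (T w)) \<le> \<epsilon> * norm w" if "w \<in> S" for w
    proof -
      \<comment> \<open>S is the real span of v plus i times it. Both parts consist of C-fixed
        vectors up to the factor i, so they are orthogonal and neither is longer than w.\<close>
      have "S \<subseteq> {a + \<i> *\<^sub>C b | a b. a \<in> span (range v) \<and> b \<in> span (range v)}" (is "_ \<subseteq> ?X")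
        unfolding S_def
      proof (rule span_minimal)
        have "v n \<in> ?X" for n
          by (rule CollectI, rule exI[of _ "v n"], rule exI[of _ 0]) (simp add: span_base span_zero complex_vector.scale_zero_right)
        moreover have "\<i> *\<^sub>C v n \<in> ?X" for n
          by (rule CollectI, rule exI[of _ 0], rule exI[of _ "v n"]) (simp add: span_base span_zero)
        ultimately show "range v \<union> range (\<lambda>n. \<i> *\<^sub>C v n) \<subseteq> ?X" by blast
        show "subspace ?X"
          unfolding subspace_def
        proof (intro conjI allI ballI)
          show "0 \<in> ?X"
            by (rule CollectI, rule exI[of _ 0], rule exI[of _ 0]) (simp add: span_zero complex_vector.scale_zero_right)
        next
          fix x y assume "x \<in> ?X" "y \<in> ?X"
          then obtain a b a' b' where "x = a + \<i> *\<^sub>C b" "y = a' + \<i> *\<^sub>C b'"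
            and m: "a \<in> span (range v)" "b \<in> span (range v)" "a' \<in> span (range v)" "b' \<in> span (range v)" by blast
          then have "x + y = (a + a') + \<i> *\<^sub>C (b + b')" by (simp add: scaleC_add_right)
          then show "x + y \<in> ?X" using m by (blast intro: span_add)
        next
          fix c :: real and x assume "x \<in> ?X"
          then obtain a b where "x = a + \<i> *\<^sub>C b" and m: "a \<in> span (range v)" "b \<in> span (range v)" by blast
          then have "c *\<^sub>R x = (c *\<^sub>R a) + \<i> *\<^sub>C (c *\<^sub>R b)" by (simp add: scaleC_scaleR_commute scaleR_add_right)
          then show "c *\<^sub>R x \<in> ?X" using m by (blast intro: span_scale)
        qed
      qed
      then obtain a b where wab: "w = a + \<i> *\<^sub>C b" and ab: "a \<in> span (range v)" "b \<in> span (range v)"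
        using \<open>w \<in> S\<close> by blast
      have "C y = y" if "y \<in> span (range v)" for y
      proof -
        have "span (range v) \<subseteq> {y. C y = y}"
          by (rule span_minimal) (use conj_scaleR[OF C, of 0] in \<open>auto simp: vC subspace_def conj_add[OF C] conj_scaleR[OF C]\<close>)
        then show ?thesis using that by blast
      qed
      then have o1: "inner a (\<i> *\<^sub>C b) = 0" using conj_real_inner_imag[OF C] ab by blast
      then have o2: "inner (\<i> *\<^sub>C b) a = 0" by (simp only: inner_commute)
      have nw: "(norm w)\<^sup>2 = (norm a)\<^sup>2 + (norm b)\<^sup>2"
        unfolding power2_norm_eq_inner wab
        by (simp add: inner_add_left inner_add_right inner_imag_both o1 o2)
      have na: "norm a \<le> norm w" "norm b \<le> norm w"
        by (rule power2_le_imp_le; simp add: nw)+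
      have "T w - P (T w) = (T a - P (T a)) + \<i> *\<^sub>C (T b - P (T b))"
        by (simp add: wab blinfun.add_right conj_realD(1)[OF TC] Pi complex_vector.scale_right_diff_distrib)
      then have "norm (T w - P (T w)) \<le> norm (T a - P (T a)) + norm (T b - P (T b))"
        using norm_triangle_ineq[of "T a - P (T a)" "\<i> *\<^sub>C (T b - P (T b))"] by (simp add: norm_scaleC)
      also have "\<dots> \<le> \<epsilon>/2 * norm a + \<epsilon>/2 * norm b" by (intro add_mono real_part ab)
      also have "\<dots> \<le> \<epsilon>/2 * norm w + \<epsilon>/2 * norm w" using na \<epsilon> by (intro add_mono mult_left_mono) auto
      finally show ?thesis by simp
    qed
    then have "S \<subseteq> {w. norm (T w - P (T w)) \<le> \<epsilon> * norm w}" by blast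
    moreover have "closed {w. norm (T w - P (T w)) \<le> \<epsilon> * norm w}"
      by (intro closed_Collect_le continuous_intros)
    ultimately have "W \<subseteq> {w. norm (T w - P (T w)) \<le> \<epsilon> * norm w}" unfolding W_def by (rule closure_minimal)
    then show ?thesis using w by blast
  qed
  have "norm (T (P x) - P (T (P x))) \<le> \<epsilon> * norm x" if "T \<in> {A, B}" for T x
  proof -
    have "norm (T (P x) - P (T (P x))) \<le> \<epsilon> * norm (P x)" by (rule key[OF that PW])
    also have "\<dots> \<le> \<epsilon> * norm x" using orthogonal_projection_norm_le[OF Po] \<epsilon> by (intro mult_left_mono) auto
    finally show ?thesis .
  qed
  then show ?thesis using Pr Po \<open>P \<noteq> 0\<close> \<open>P \<noteq> id_blinfun\<close> by blast
qed

text \<open>With Q = 1 - P, the difference A - A' is Q A P + P A Q. The hypothesis bounds the first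
  corner by \<epsilon>, and the second is its adjoint.\<close>

lemma block_diagonal_compression:
  fixes A P :: "'a::complex_hilbert_space \<Rightarrow>\<^sub>L 'a"
  assumes C: "conjugation C" and A: "conj_real C A" and P: "conj_real C P" "orthogonal_projection P"
    and \<epsilon>: "\<epsilon> \<ge> 0" and b: "\<And>x. norm (A (P x) - P (A (P x))) \<le> \<epsilon> * norm x"
  shows "\<exists>A'. conj_real C A' \<and> norm (A' - A) \<le> 2 * \<epsilon> \<and> P o\<^sub>L A' = A' o\<^sub>L P"
proof -
  define Q where "Q = id_blinfun - P"
  define A' where "A' = P \<circ>\<^sub>L A \<circ>\<^sub>L P + Q \<circ>\<^sub>L A \<circ>\<^sub>L Q"
  have PP: "P (P x) = P x" for x using P(2) by (simp add: orthogonal_projection_iff)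
  have A'x: "A' x = P (A (P x)) + (A (x - P x) - P (A (x - P x)))" for x
    by (simp add: A'_def Q_def blinfun.add_left blinfun.diff_left)
  note PD = conj_realD[OF P(1)] and AD = conj_realD[OF A]
  have "conj_real C A'"
    by (rule conj_realI)
      (simp_all add: A'x blinfun.bilinear_simps PD(1) AD(1) PD(3) AD(3) scaleC_add_right complex_vector.scale_right_diff_distrib
        conj_add[OF C] conj_diff[OF C] inner_add_left inner_add_right inner_diff_left inner_diff_right PD(2) AD(2))
  moreover have "P o\<^sub>L A' = A' o\<^sub>L P"
    by (rule blinfun_eqI) (simp add: A'x blinfun.bilinear_simps PP)
  moreover have "norm (A' - A) \<le> 2 * \<epsilon>"
  proof (rule norm_blinfun_bound)
    fix x
    \<comment> \<open>|z|^2 is the inner product of x with Q A P z: moving P A Q to the other side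
      reduces this corner to the hypothesis.\<close>
    have 2: "norm (P (A (x - P x))) \<le> \<epsilon> * norm x"
    proof -
      define z where "z = P (A (x - P x))"
      have "(norm z)\<^sup>2 = inner x (A (P z) - P (A (P z)))"
        by (simp add: z_def power2_norm_eq_inner PD(2) AD(2) inner_diff_left inner_diff_right PP)
      also have "\<dots> \<le> norm x * norm (A (P z) - P (A (P z)))" by (rule norm_cauchy_schwarz)
      also have "\<dots> \<le> norm x * (\<epsilon> * norm z)" by (intro mult_left_mono b) simp
      finally have "norm z * norm z \<le> norm z * (\<epsilon> * norm x)" by (simp add: power2_eq_square mult_ac)
      then have "norm z \<le> \<epsilon> * norm x" using \<epsilon> by (cases "norm z = 0") (auto simp: mult_le_cancel_left)
      then show ?thesis by (simp add: z_def)
    qed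
    have "(A' - A) x = - (A (P x) - P (A (P x))) - P (A (x - P x))"
      by (simp add: blinfun.diff_left A'x blinfun.diff_right)
    then have "norm ((A' - A) x) \<le> norm (A (P x) - P (A (P x))) + norm (P (A (x - P x)))"
      using norm_triangle_ineq4[of "- (A (P x) - P (A (P x)))" "P (A (x - P x))"] by (simp add: norm_minus_commute)
    then show "norm ((A' - A) x) \<le> 2 * \<epsilon> * norm x" using b[of x] 2 by simp
  qed (use \<epsilon> in simp)
  ultimately show ?thesis by blast
qed

lemma CSO_subset_closure_RCSO:
  assumes sep: "separable_space (euclidean :: 'a::complex_hilbert_space topology)" and inf: "\<not> finite_cdim TYPE('a)"
  shows "(CSO :: ('a \<Rightarrow>\<^sub>L 'a) set) \<subseteq> closure RCSO"
proof
  fix T :: "'a \<Rightarrow>\<^sub>L 'a" assume "T \<in> CSO"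
  then obtain C A B where C: "conjugation C" and A: "conj_real C A" and B: "conj_real C B"
    and T: "T = A + imag_op \<circ>\<^sub>L B" using CSO_decomposition by blast
  show "T \<in> closure RCSO"
    unfolding closure_approachable
  proof (intro allI impI)
    fix \<epsilon> :: real assume \<epsilon>: "\<epsilon> > 0"
    \<comment> \<open>A and B are each moved by at most 2 (\<epsilon>/6), so T is moved by at most 2
      \<epsilon>/3.\<close>
    then have \<epsilon>6: "\<epsilon>/6 > 0" by simp
    obtain P where P: "conj_real C P" "orthogonal_projection P" "P \<noteq> 0" "P \<noteq> id_blinfun"
      and PT: "\<And>T x. T \<in> {A, B} \<Longrightarrow> norm (T (P x) - P (T (P x))) \<le> \<epsilon>/6 * norm x"
      using almost_commuting_projection[OF sep C inf A B \<epsilon>6] by blast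
    obtain A' where A': "conj_real C A'" "norm (A' - A) \<le> 2 * (\<epsilon>/6)" "P o\<^sub>L A' = A' o\<^sub>L P"
      using block_diagonal_compression[OF C A P(1,2) less_imp_le[OF \<epsilon>6] PT[of A]] by auto
    obtain B' where B': "conj_real C B'" "norm (B' - B) \<le> 2 * (\<epsilon>/6)" "P o\<^sub>L B' = B' o\<^sub>L P"
      using block_diagonal_compression[OF C B P(1,2) less_imp_le[OF \<epsilon>6] PT[of B]] by auto
    define S where "S = A' + imag_op \<circ>\<^sub>L B'"
    have SC: "S \<in> CSO" unfolding S_def by (rule combination_in_CSO[OF C A'(1) B'(1)])
    have "P o\<^sub>L S = S o\<^sub>L P"
    proof (rule blinfun_eqI)
      fix x
      have "P (A' x) = A' (P x)" "P (B' x) = B' (P x)"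
        using A'(3) B'(3) by (metis blinfun_apply_blinfun_compose)+
      then show "(P o\<^sub>L S) x = (S o\<^sub>L P) x"
        by (simp add: S_def blinfun.add_left blinfun.add_right conj_realD(1)[OF P(1)])
    qed
    then have "S \<in> RCSO" using SC P by (auto simp: RCSO_def irreducible_op_def)
    moreover have "S - T = (A' - A) + imag_op \<circ>\<^sub>L (B' - B)"
      by (simp add: S_def T compose_arith)
    then have "norm (S - T) \<le> norm (A' - A) + norm (B' - B)"
      using norm_triangle_ineq[of "A' - A" "imag_op \<circ>\<^sub>L (B' - B)"] norm_imag_compose[of "B' - B"] by simp
    then have "dist S T < \<epsilon>" using A'(2) B'(2) \<epsilon> by (simp add: dist_norm)
    ultimately show "\<exists>S\<in>RCSO. dist S T < \<epsilon>" by blast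
  qed
qed

section \<open>Norm closures inside the algebra of bounded operators\<close>

lemma norm_closure_eq: "norm_closure E = bounded_ops \<inter> closure (bounded_ops \<inter> E)"
  by (simp add: norm_closure_def closure_of_subtopology)

lemma CSO_subset_bounded_ops: "CSO \<subseteq> bounded_ops"
  by (auto simp: CSO_def)

lemma norm_closure_eq_of_dense:
  fixes E :: "('a::complex_hilbert_space \<Rightarrow>\<^sub>L 'a) set"
  assumes "E \<subseteq> CSO" "CSO \<subseteq> closure E"
  shows "norm_closure E = norm_closure CSO"
proof -
  have "closure CSO = closure E"
    using assms by (meson closed_closure closure_minimal closure_mono subset_antisym)
  moreover have "bounded_ops \<inter> E = E" "bounded_ops \<inter> CSO = (CSO :: ('a \<Rightarrow>\<^sub>L 'a) set)"
    using assms CSO_subset_bounded_ops by blast+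
  ultimately show ?thesis by (simp add: norm_closure_eq)
qed

theorem theorem1p2:
  assumes "separable_space (euclidean :: 'a::complex_hilbert_space topology)"
  shows "(finite_cdim TYPE('a) \<longrightarrow>
            norm_closure (ICSO :: ('a \<Rightarrow>\<^sub>L 'a) set) = CSO \<and>
            closedin (top_of_set CSO) (RCSO :: ('a \<Rightarrow>\<^sub>L 'a) set) \<and>
            nowhere_dense_in (top_of_set CSO) (RCSO :: ('a \<Rightarrow>\<^sub>L 'a) set)) \<and>
         (\<not> finite_cdim TYPE('a) \<longrightarrow>
            norm_closure (RCSO :: ('a \<Rightarrow>\<^sub>L 'a) set) = norm_closure ICSO \<and>
            norm_closure (ICSO :: ('a \<Rightarrow>\<^sub>L 'a) set) = norm_closure CSO)"
proof -
  have subI: "(ICSO :: ('a \<Rightarrow>\<^sub>L 'a) set) \<subseteq> CSO" and subR: "(RCSO :: ('a \<Rightarrow>\<^sub>L 'a) set) \<subseteq> CSO"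
    by (auto simp: ICSO_def RCSO_def)
  have I: "norm_closure (ICSO :: ('a \<Rightarrow>\<^sub>L 'a) set) = norm_closure CSO"
    by (rule norm_closure_eq_of_dense[OF subI CSO_subset_closure_ICSO[OF assms]])
  show ?thesis
  proof (intro conjI impI)
    assume fd: "finite_cdim TYPE('a)"
    have "closed (CSO :: ('a \<Rightarrow>\<^sub>L 'a) set)"
      unfolding closed_sequential_limits using CSO_sequentially_closed[OF fd] by blast
    moreover have "bounded_ops \<inter> CSO = (CSO :: ('a \<Rightarrow>\<^sub>L 'a) set)" using CSO_subset_bounded_ops by blast
    ultimately have "norm_closure (CSO :: ('a \<Rightarrow>\<^sub>L 'a) set) = CSO" by (simp add: norm_closure_eq)
    then show "norm_closure (ICSO :: ('a \<Rightarrow>\<^sub>L 'a) set) = CSO" by (simp only: I)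
    have "closed (RCSO :: ('a \<Rightarrow>\<^sub>L 'a) set)"
      unfolding closed_sequential_limits using RCSO_sequentially_closed[OF fd] by blast
    then show cl: "closedin (top_of_set CSO) (RCSO :: ('a \<Rightarrow>\<^sub>L 'a) set)"
      using subR by (rule closed_subset[rotated])
    \<comment> \<open>A nonempty relatively open part of CSO meets the dense set ICSO, so it cannot
      lie in RCSO.\<close>
    have "top_of_set CSO interior_of (RCSO :: ('a \<Rightarrow>\<^sub>L 'a) set) = {}"
    proof (rule ccontr)
      assume "top_of_set CSO interior_of (RCSO :: ('a \<Rightarrow>\<^sub>L 'a) set) \<noteq> {}"
      then obtain T U where T: "T \<in> U" and U: "openin (top_of_set CSO) U" "U \<subseteq> (RCSO :: ('a \<Rightarrow>\<^sub>L 'a) set)"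
        by (auto simp: interior_of_def)
      then obtain V where V: "open V" "U = CSO \<inter> V" by (auto simp: openin_open)
      then have "T \<in> closure ICSO" using T CSO_subset_closure_ICSO[OF assms] by blast
      then obtain S where "S \<in> ICSO" "S \<in> V" using V T by (auto simp: closure_iff_nhds_not_empty)
      then have "S \<in> RCSO" using V U(2) subI by blast
      then show False using \<open>S \<in> ICSO\<close> by (simp add: ICSO_def RCSO_def)
    qed
    then show "nowhere_dense_in (top_of_set CSO) (RCSO :: ('a \<Rightarrow>\<^sub>L 'a) set)"
      unfolding nowhere_dense_in_def using cl subR by (simp add: closure_of_closedin)
  next
    assume "\<not> finite_cdim TYPE('a)"
    from norm_closure_eq_of_dense[OF subR CSO_subset_closure_RCSO[OF assms this]]
    show "norm_closure (RCSO :: ('a \<Rightarrow>\<^sub>L 'a) set) = norm_closure ICSO" by (simp only: I)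
    show "norm_closure (ICSO :: ('a \<Rightarrow>\<^sub>L 'a) set) = norm_closure CSO" by (rule I)
  qed
qed

end
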